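(* Let $\Omega\subset\mathbb R^d$, $d\in\{2,3\}$, be a bounded polygonal (polyhedral) domain, $\mu>0$, $f\in H^{-1}(\Omega)^d$, and let $X_h=V_h\times Q_h\subset H^1_0(\Omega)^d\times L^2_0(\Omega)$ be the space of conforming equal-order finite elements of order $k\ge1$. Let $T\in L(Q_h,Q_h')$ be one of the following pressure stabilizations: (BP) ($k=1$, $P_1$ elements on a simplicial mesh) $\langle Tp,q\rangle=\sum_{K\in\mathcal T_h}h_K^2\int_K\nabla p\cdot\nabla q$; (BH) ($k=1$, $P_1$ elements on a simplicial mesh) $\langle Tp,q\rangle=\int_\Omega\bigl(I_h^1(pq)-pq\bigr)$; (LPS) $\langle Tp,q\rangle=\sum_{K\in\mathcal T_{2h}}h_K^2\int_K[\nabla p-\pi_h(\nabla p)]\cdot[\nabla q-\pi_h(\nabla q)]$. Let $S:V_h\to V_h'$ have one of the following two forms: (i) $\langle S(u),v\rangle=\sum_{K\in\mathcal T_{2h}}\delta_K^{lps}(u)\int_K[\nabla u-\pi_h(\nabla u)]\cdot[\nabla v-\pi_h(\nabla v)]$ with functions $\delta^{lps}_K:V_h\to\mathbb R_{\ge0}$ (depending on $u$ and $h_K$) satisfying $|\delta_K^{lps}(u)|\le c\|\nabla u\|_{L^2(K)}$; (ii) $\langle S(u),v\rangle=\sum_{K\in\mathcal T_h}\delta_K^{supg}(u)\int_K (u\cdot\nabla)u\cdot(u\cdot\nabla)v$ with $0\le\delta_K^{supg}(u)\le c\,h_K\|u\|_{L^\infty(K)}^{-1}$ (no upper bound being imposed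 where $u|_K=0$, in which case the term vanishes); where $c>0$ is a constant. Then there exists $(u,p)\in X_h$ such that for all $(v,q)\in X_h$ $$\int_\Omega\Bigl((u\cdot\nabla)u+\tfrac12 u\,\mathrm{div}\,u\Bigr)\cdot v+\mu\int_\Omega\nabla u:\nabla v-\int_\Omega p\,\mathrm{div}\,v+\langle S(u),v\rangle_{V_h',V_h}+\int_\Omega q\,\mathrm{div}\,u+\langle Tp,q\rangle_{Q_h',Q_h}=\langle f,v\rangle .$$
   Context: $\mathcal T_h$ is a (conforming) triangulation of $\Omega$ into cells (triangles, quadrilaterals, tetrahedra or hexahedra), $h_K=\mathrm{diam}(K)$. With $W_h$ the space of continuous functions on $\overline\Omega$ that are (mapped) polynomials of degree $k$ on each cell, $V_h=(W_h\cap H^1_0(\Omega))^d$ and $Q_h=W_h\cap L^2_0(\Omega)$, where $L^2_0(\Omega)$ is the space of $L^2$ functions with zero mean. $\|u\|_V=\|\nabla u\|_{L^2(\Omega)}$ and $\|p\|_Q=\|p\|_{L^2(\Omega)}$. For $k=1$, $I_h^1$ is the nodal Lagrange interpolation of continuous functions into continuous piecewise linear functions on $\mathcal T_h$. For terms involving $\mathcal T_{2h}$: $\mathcal T_{2h}$ is a macro-triangulation of $\Omega$ whose elements (patches) are patches of cells of $\mathcal T_h$; $D_h$ is the space of $\mathbb R^d$-valued functions that are polynomials of degree $k-1$ on each patch, discontinuous across patches; $\pi_h:L^2(\Omega)^d\to D_h$ is the $L^2$-projection (applied row-wise to matrix fields such as $\nabla u$).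
   Formalization: The coefficient functions are additionally assumed continuous: each LPS coefficient on all of V_h, each SUPG coefficient on the set of u in V_h that do not vanish identically on K; without continuity the existence claim fails. *)

theory Defs
  imports
    "HOL-Analysis.Analysis"
    "HOL-Library.Disjoint_Sets"
    "HOL-Probability.Essential_Supremum"
begin

section \<open>Differential operators\<close>

text \<open>
  Pointwise classical gradient and Jacobian. A finite element function is smooth in the interior
  of every cell, so this is its gradient off the null set of cell boundaries (where the value is
  irrelevant, all integrals being taken with respect to the complete Lebesgue measure).
\<close>

definition grad :: "(real^'d \<Rightarrow> real) \<Rightarrow> real^'d \<Rightarrow> real^'d" where
  "grad p x = (\<chi> j. frechet_derivative p (at x) (axis j 1))"

text \<open>Row \<open>i\<close> of \<open>jac u\<close> is the gradient of the component \<open>u\<^sub>i\<close>; hence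
  \<open>(u \<cdot> \<nabla>) w = jac w *v u\<close>, and the inner product of two matrices is the Frobenius product.\<close>

definition jac :: "(real^'d \<Rightarrow> real^'d) \<Rightarrow> real^'d \<Rightarrow> real^'d^'d" where
  "jac u x = (\<chi> i. grad (\<lambda>y. u y $ i) x)"

definition dvg :: "(real^'d \<Rightarrow> real^'d) \<Rightarrow> real^'d \<Rightarrow> real" where
  "dvg u x = trace (jac u x)"

section \<open>Lebesgue and Sobolev spaces\<close>

definition L2 :: "(real^'d) set \<Rightarrow> (real^'d \<Rightarrow> 'b::real_normed_vector) set" where
  "L2 \<Omega> = {g. g \<in> borel_measurable (lebesgue_on \<Omega>) \<and>
               integrable (lebesgue_on \<Omega>) (\<lambda>x. (norm (g x))\<^sup>2)}"

definition L2_norm_on :: "(real^'d) set \<Rightarrow> (real^'d \<Rightarrow> 'b::real_normed_vector) \<Rightarrow> real" where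
  "L2_norm_on A g = sqrt (\<integral>x. (norm (g x))\<^sup>2 \<partial>lebesgue_on A)"

definition Linf_norm_on :: "(real^'d) set \<Rightarrow> (real^'d \<Rightarrow> 'b::real_normed_vector) \<Rightarrow> real" where
  "Linf_norm_on A g = real_of_ereal (esssup (lebesgue_on A) (\<lambda>x. ereal (norm (g x))))"

definition L2_zero_mean :: "(real^'d) set \<Rightarrow> (real^'d \<Rightarrow> real) set" where
  "L2_zero_mean \<Omega> = {p \<in> L2 \<Omega>. (\<integral>x. p x \<partial>lebesgue_on \<Omega>) = 0}"

primrec Ck :: "nat \<Rightarrow> (real^'d \<Rightarrow> real) \<Rightarrow> bool" where
  "Ck 0 \<phi> \<longleftrightarrow> continuous_on UNIV \<phi>"
| "Ck (Suc n) \<phi> \<longleftrightarrow> (\<forall>x. \<phi> differentiable (at x)) \<and> (\<forall>j. Ck n (\<lambda>x. grad \<phi> x $ j))"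

definition test_functions :: "(real^'d) set \<Rightarrow> (real^'d \<Rightarrow> real) set" where
  "test_functions \<Omega> = {\<phi>. (\<forall>n. Ck n \<phi>) \<and>
     compact (closure {x. \<phi> x \<noteq> 0}) \<and> closure {x. \<phi> x \<noteq> 0} \<subseteq> \<Omega>}"

definition weak_gradient ::
  "(real^'d) set \<Rightarrow> (real^'d \<Rightarrow> real) \<Rightarrow> (real^'d \<Rightarrow> real^'d) \<Rightarrow> bool" where
  "weak_gradient \<Omega> u g \<longleftrightarrow> g \<in> L2 \<Omega> \<and>
     (\<forall>\<phi>\<in>test_functions \<Omega>. \<forall>j.
        (\<integral>x. u x * grad \<phi> x $ j \<partial>lebesgue_on \<Omega>) = - (\<integral>x. g x $ j * \<phi> x \<partial>lebesgue_on \<Omega>))"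

text \<open>\<open>H\<^sup>1\<^sub>0\<close> as the closure of the test functions in \<open>H\<^sup>1\<close>.\<close>

definition H1_0 :: "(real^'d) set \<Rightarrow> (real^'d \<Rightarrow> real) set" where
  "H1_0 \<Omega> = {u. u \<in> L2 \<Omega> \<and> (\<exists>g. weak_gradient \<Omega> u g \<and>
     (\<exists>\<phi>. (\<forall>n. \<phi> n \<in> test_functions \<Omega>) \<and>
        (\<lambda>n. L2_norm_on \<Omega> (\<lambda>x. u x - \<phi> n x)) \<longlonglongrightarrow> 0 \<and>
        (\<lambda>n. L2_norm_on \<Omega> (\<lambda>x. g x - grad (\<phi> n) x)) \<longlonglongrightarrow> 0))}"

text \<open>Bounded linear functionals on \<open>H\<^sup>1\<^sub>0\<close>. Boundedness makes them well defined on classes of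
  functions that agree almost everywhere on \<open>\<Omega>\<close>.\<close>

definition H_minus_1 :: "(real^'d) set \<Rightarrow> ((real^'d \<Rightarrow> real) \<Rightarrow> real) set" where
  "H_minus_1 \<Omega> = {l.
     (\<forall>u\<in>H1_0 \<Omega>. \<forall>v\<in>H1_0 \<Omega>. l (\<lambda>x. u x + v x) = l u + l v) \<and>
     (\<forall>a. \<forall>u\<in>H1_0 \<Omega>. l (\<lambda>x. a * u x) = a * l u) \<and>
     (\<exists>C. \<forall>u\<in>H1_0 \<Omega>. \<forall>g. weak_gradient \<Omega> u g \<longrightarrow>
        \<bar>l u\<bar> \<le> C * sqrt ((L2_norm_on \<Omega> u)\<^sup>2 + (L2_norm_on \<Omega> g)\<^sup>2))}"

section \<open>Domains and triangulations\<close>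

text \<open>No Lipschitz condition is imposed on the boundary.\<close>

definition polyhedral_domain :: "(real^'d) set \<Rightarrow> bool" where
  "polyhedral_domain \<Omega> \<longleftrightarrow> open \<Omega> \<and> connected \<Omega> \<and> \<Omega> \<noteq> {} \<and> bounded \<Omega> \<and>
     (\<exists>P. finite P \<and> (\<forall>S\<in>P. polytope S \<and> aff_dim S = int CARD('d) - 1) \<and> frontier \<Omega> = \<Union>P)"

definition monomial :: "('d \<Rightarrow> nat) \<Rightarrow> real^'d \<Rightarrow> real" where
  "monomial \<alpha> x = (\<Prod>i\<in>UNIV. x $ i ^ \<alpha> i)"

text \<open>Polynomials of total degree at most \<open>k\<close>, respectively of degree at most \<open>k\<close> in each variable.\<close>

definition poly_P :: "nat \<Rightarrow> (real^'d \<Rightarrow> real) set" where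
  "poly_P k = {p. \<exists>a. p = (\<lambda>x. \<Sum>\<alpha> | (\<Sum>i\<in>UNIV. \<alpha> i) \<le> k. a \<alpha> * monomial \<alpha> x)}"

definition poly_Q :: "nat \<Rightarrow> (real^'d \<Rightarrow> real) set" where
  "poly_Q k = {p. \<exists>a. p = (\<lambda>x. \<Sum>\<alpha> | \<forall>i. \<alpha> i \<le> k. a \<alpha> * monomial \<alpha> x)}"

datatype cell_shape = Simplex | Cube

fun ref_cell :: "cell_shape \<Rightarrow> (real^'d) set" where
  "ref_cell Simplex = convex hull (insert 0 Basis)"
| "ref_cell Cube = cbox 0 1"

fun ref_poly :: "cell_shape \<Rightarrow> nat \<Rightarrow> (real^'d \<Rightarrow> real) set" where
  "ref_poly Simplex k = poly_P k"
| "ref_poly Cube k = poly_Q k"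

text \<open>A cell is given by its shape together with the map from the reference cell: an affine map for
  triangles and tetrahedra, a bilinear or trilinear map for quadrilaterals and hexahedra.\<close>

type_synonym 'd cell = "cell_shape \<times> (real^'d \<Rightarrow> real^'d)"

abbreviation cell_shape_of :: "'d::finite cell \<Rightarrow> cell_shape" where "cell_shape_of \<equiv> fst"
abbreviation cell_map :: "'d::finite cell \<Rightarrow> real^'d \<Rightarrow> real^'d" where "cell_map \<equiv> snd"

definition cell_ref :: "'d::finite cell \<Rightarrow> (real^'d) set" where
  "cell_ref K = ref_cell (cell_shape_of K)"

definition region :: "'d::finite cell \<Rightarrow> (real^'d) set" where
  "region K = cell_map K ` cell_ref K"

definition valid_cell :: "'d::finite cell \<Rightarrow> bool" where
  "valid_cell K \<longleftrightarrow>
     (\<forall>j. (\<lambda>x. cell_map K x $ j) \<in> ref_poly (cell_shape_of K) 1) \<and>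
     inj_on (cell_map K) (cell_ref K) \<and>
     (\<forall>x\<in>cell_ref K. det (jac (cell_map K) x) \<noteq> 0)"

text \<open>Two distinct cells meet in a common proper face; the empty set counts as a face.\<close>

definition conforming_triangulation :: "(real^'d) set \<Rightarrow> 'd::finite cell set \<Rightarrow> bool" where
  "conforming_triangulation \<Omega> \<T> \<longleftrightarrow> finite \<T> \<and> (\<forall>K\<in>\<T>. valid_cell K) \<and>
     (\<Union>K\<in>\<T>. region K) = closure \<Omega> \<and>
     (\<forall>K\<in>\<T>. \<forall>L\<in>\<T>. K \<noteq> L \<longrightarrow>
        (\<exists>G H. G face_of cell_ref K \<and> G \<noteq> cell_ref K \<and> H face_of cell_ref L \<and> H \<noteq> cell_ref L \<and>
               region K \<inter> region L = cell_map K ` G \<and> region K \<inter> region L = cell_map L ` H))"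

definition simplicial :: "'d::finite cell set \<Rightarrow> bool" where
  "simplicial \<T> \<longleftrightarrow> (\<forall>K\<in>\<T>. cell_shape_of K = Simplex)"

definition mesh_vertices :: "'d::finite cell set \<Rightarrow> (real^'d) set" where
  "mesh_vertices \<T> = (\<Union>K\<in>\<T>. cell_map K ` {a. a extreme_point_of cell_ref K})"

text \<open>A macro-triangulation groups the cells of a triangulation into patches. No particular shape of
  the patches is required.\<close>

definition macro_triangulation :: "'d::finite cell set \<Rightarrow> 'd cell set set \<Rightarrow> bool" where
  "macro_triangulation \<T> \<M> \<longleftrightarrow> partition_on \<T> \<M>"

definition patch_region :: "'d::finite cell set \<Rightarrow> (real^'d) set" where
  "patch_region M = (\<Union>K\<in>M. region K)"

section \<open>Finite element spaces\<close>

text \<open>Functions on the closure of \<open>\<Omega>\<close> are represented by their extension by zero, so that equality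
  of functions is equality on the closure.\<close>

definition W_space :: "(real^'d) set \<Rightarrow> 'd::finite cell set \<Rightarrow> nat \<Rightarrow> (real^'d \<Rightarrow> real) set" where
  "W_space \<Omega> \<T> k = {w. continuous_on (closure \<Omega>) w \<and> (\<forall>x. x \<notin> closure \<Omega> \<longrightarrow> w x = 0) \<and>
     (\<forall>K\<in>\<T>. \<exists>p\<in>ref_poly (cell_shape_of K) k. \<forall>x\<in>cell_ref K. w (cell_map K x) = p x)}"

definition V_space :: "(real^'d) set \<Rightarrow> 'd::finite cell set \<Rightarrow> nat \<Rightarrow> (real^'d \<Rightarrow> real^'d) set" where
  "V_space \<Omega> \<T> k = {u. \<forall>i. (\<lambda>x. u x $ i) \<in> W_space \<Omega> \<T> k \<inter> H1_0 \<Omega>}"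

definition Q_space :: "(real^'d) set \<Rightarrow> 'd::finite cell set \<Rightarrow> nat \<Rightarrow> (real^'d \<Rightarrow> real) set" where
  "Q_space \<Omega> \<T> k = W_space \<Omega> \<T> k \<inter> L2_zero_mean \<Omega>"

definition V_norm :: "(real^'d) set \<Rightarrow> (real^'d \<Rightarrow> real^'d) \<Rightarrow> real" where
  "V_norm \<Omega> u = L2_norm_on \<Omega> (jac u)"

definition V_continuous_on ::
  "(real^'d) set \<Rightarrow> (real^'d \<Rightarrow> real^'d) set \<Rightarrow> ((real^'d \<Rightarrow> real^'d) \<Rightarrow> real) \<Rightarrow> bool" where
  "V_continuous_on \<Omega> A \<Phi> \<longleftrightarrow> (\<forall>u\<in>A. \<forall>\<epsilon>>0. \<exists>\<eta>>0. \<forall>w\<in>A.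
     V_norm \<Omega> (\<lambda>x. w x - u x) < \<eta> \<longrightarrow> \<bar>\<Phi> w - \<Phi> u\<bar> < \<epsilon>)"

definition nodal_interpolation ::
  "(real^'d) set \<Rightarrow> 'd::finite cell set \<Rightarrow> (real^'d \<Rightarrow> real) \<Rightarrow> real^'d \<Rightarrow> real" where
  "nodal_interpolation \<Omega> \<T> g =
     (THE w. w \<in> W_space \<Omega> \<T> 1 \<and> (\<forall>a\<in>mesh_vertices \<T>. w a = g a))"

text \<open>On the null set outside the patch interiors the value zero selects one representative.\<close>

definition D_space :: "'d::finite cell set set \<Rightarrow> nat \<Rightarrow> (real^'d \<Rightarrow> real^'d) set" where
  "D_space \<M> k = {\<zeta>.
     (\<forall>M\<in>\<M>. \<forall>i. \<exists>p\<in>poly_P (k - 1). \<forall>x\<in>interior (patch_region M). \<zeta> x $ i = p x) \<and>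
     (\<forall>x. x \<notin> (\<Union>M\<in>\<M>. interior (patch_region M)) \<longrightarrow> \<zeta> x = 0)}"

definition L2_projection ::
  "(real^'d) set \<Rightarrow> 'd::finite cell set set \<Rightarrow> nat \<Rightarrow> (real^'d \<Rightarrow> real^'d) \<Rightarrow> real^'d \<Rightarrow> real^'d" where
  "L2_projection \<Omega> \<M> k g = (THE \<zeta>. \<zeta> \<in> D_space \<M> k \<and>
     (\<forall>\<psi>\<in>D_space \<M> k. (\<integral>x. (g x - \<zeta> x) \<bullet> \<psi> x \<partial>lebesgue_on \<Omega>) = 0))"

definition L2_projection_rows ::
  "(real^'d) set \<Rightarrow> 'd::finite cell set set \<Rightarrow> nat \<Rightarrow> (real^'d \<Rightarrow> real^'d^'d) \<Rightarrow> real^'d \<Rightarrow> real^'d^'d"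
where
  "L2_projection_rows \<Omega> \<M> k G x = (\<chi> i. L2_projection \<Omega> \<M> k (\<lambda>y. G y $ i) x)"

section \<open>Pressure stabilizations\<close>

definition T_BP :: "'d::finite cell set \<Rightarrow> (real^'d \<Rightarrow> real) \<Rightarrow> (real^'d \<Rightarrow> real) \<Rightarrow> real" where
  "T_BP \<T> p q = (\<Sum>K\<in>\<T>. (diameter (region K))\<^sup>2 *
     (\<integral>x. grad p x \<bullet> grad q x \<partial>lebesgue_on (region K)))"

definition T_BH ::
  "(real^'d) set \<Rightarrow> 'd::finite cell set \<Rightarrow> (real^'d \<Rightarrow> real) \<Rightarrow> (real^'d \<Rightarrow> real) \<Rightarrow> real" where
  "T_BH \<Omega> \<T> p q =
     (\<integral>x. nodal_interpolation \<Omega> \<T> (\<lambda>y. p y * q y) x - p x * q x \<partial>lebesgue_on \<Omega>)"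

definition T_LPS ::
  "(real^'d) set \<Rightarrow> 'd::finite cell set set \<Rightarrow> nat \<Rightarrow> (real^'d \<Rightarrow> real) \<Rightarrow> (real^'d \<Rightarrow> real) \<Rightarrow> real"
where
  "T_LPS \<Omega> \<M> k p q = (\<Sum>M\<in>\<M>. (diameter (patch_region M))\<^sup>2 *
     (\<integral>x. (grad p x - L2_projection \<Omega> \<M> k (grad p) x) \<bullet>
          (grad q x - L2_projection \<Omega> \<M> k (grad q) x) \<partial>lebesgue_on (patch_region M)))"

section \<open>Velocity stabilizations\<close>

definition S_LPS ::
  "(real^'d) set \<Rightarrow> 'd::finite cell set set \<Rightarrow> nat \<Rightarrow>
   ('d cell set \<Rightarrow> (real^'d \<Rightarrow> real^'d) \<Rightarrow> real) \<Rightarrow>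
   (real^'d \<Rightarrow> real^'d) \<Rightarrow> (real^'d \<Rightarrow> real^'d) \<Rightarrow> real" where
  "S_LPS \<Omega> \<M> k \<delta> u v = (\<Sum>M\<in>\<M>. \<delta> M u *
     (\<integral>x. (jac u x - L2_projection_rows \<Omega> \<M> k (jac u) x) \<bullet>
          (jac v x - L2_projection_rows \<Omega> \<M> k (jac v) x) \<partial>lebesgue_on (patch_region M)))"

definition LPS_parameter ::
  "(real^'d) set \<Rightarrow> 'd::finite cell set \<Rightarrow> 'd cell set set \<Rightarrow> nat \<Rightarrow> real \<Rightarrow>
   ('d cell set \<Rightarrow> (real^'d \<Rightarrow> real^'d) \<Rightarrow> real) \<Rightarrow> bool" where
  "LPS_parameter \<Omega> \<T> \<M> k c \<delta> \<longleftrightarrow> (\<forall>M\<in>\<M>.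
     V_continuous_on \<Omega> (V_space \<Omega> \<T> k) (\<delta> M) \<and>
     (\<forall>u\<in>V_space \<Omega> \<T> k. 0 \<le> \<delta> M u \<and> \<bar>\<delta> M u\<bar> \<le> c * L2_norm_on (patch_region M) (jac u)))"

definition S_SUPG ::
  "'d::finite cell set \<Rightarrow> ('d cell \<Rightarrow> (real^'d \<Rightarrow> real^'d) \<Rightarrow> real) \<Rightarrow>
   (real^'d \<Rightarrow> real^'d) \<Rightarrow> (real^'d \<Rightarrow> real^'d) \<Rightarrow> real" where
  "S_SUPG \<T> \<delta> u v = (\<Sum>K\<in>\<T>. \<delta> K u *
     (\<integral>x. (jac u x *v u x) \<bullet> (jac v x *v u x) \<partial>lebesgue_on (region K)))"

text \<open>Neither the upper bound nor continuity is required at fields vanishing on the cell, where the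
  bound is infinite.\<close>

definition SUPG_parameter ::
  "(real^'d) set \<Rightarrow> 'd::finite cell set \<Rightarrow> nat \<Rightarrow> real \<Rightarrow>
   ('d cell \<Rightarrow> (real^'d \<Rightarrow> real^'d) \<Rightarrow> real) \<Rightarrow> bool" where
  "SUPG_parameter \<Omega> \<T> k c \<delta> \<longleftrightarrow> (\<forall>K\<in>\<T>.
     V_continuous_on \<Omega> {u \<in> V_space \<Omega> \<T> k. \<exists>x\<in>region K. u x \<noteq> 0} (\<delta> K) \<and>
     (\<forall>u\<in>V_space \<Omega> \<T> k. 0 \<le> \<delta> K u \<and>
        ((\<exists>x\<in>region K. u x \<noteq> 0) \<longrightarrow>
           \<delta> K u \<le> c * diameter (region K) * inverse (Linf_norm_on (region K) u))))"

end

theory Submission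
  imports Defs "HOL-Homology.Homology" "HOL-Library.Function_Algebras"
begin

text \<open>
  In coordinates with respect to bases of the two finite element spaces the discrete problem is a
  nonlinear saddle point system. Testing it with its own solution, the convective term drops out by
  skew-symmetry and both stabilizations are nonnegative, so a regularized system with a positive
  definite pressure block is coercive and has a zero by a Brouwer argument. As the symmetric forms
  and the divergence together control the pressure off their common kernel, the regularization can
  be removed without an inf-sup condition.

  The boundary values enter through skew-symmetry and the definiteness of the Dirichlet form: off a
  null set the weak gradient
  of a finite element function is its classical gradient, which is bounded there, and integration by
  parts passes to the limit from the test functions. The projections and the nodal interpolant, which
  are defined by description, have to be shown to exist, as otherwise the pressure forms need not
  be bilinear.
\<close>

section \<open>Zeros of coercive fields and saddle point systems\<close>

text \<open>The classical gradient \<open>grad\<close> has an uncontrolled value wherever a function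
  is not differentiable, in particular on cell boundaries, and it is linear only where derivatives
  exist. All integrals are therefore moved to the regular part of the mesh, an open set with
  negligible complement on which every finite element function is C1 with bounded gradient. One
  identity carries the boundary values: the integral of u^2 \<partial>_j z is -2 times the integral
  of u (\<partial>_j u) z. With components of the velocity for u and z it gives skew-symmetry; with
  z = x_j it shows that a single vanishing partial derivative forces u = 0. The dimension of the
  discrete spaces depends on the mesh, so coefficient vectors are sequences of which finitely many
  entries count. Zeros of the regularized systems stay in a box independent of \<epsilon>, and the
  residual of the original system attains the minimum zero on that box. The streamline parameter may
  blow up as the velocity tends to zero on a cell; there continuity of the stabilization is a matter
  of estimates, not of continuity of its factors.\<close>

lemma continuous_on_nat_fun_iff:
  fixes f :: "'a::topological_space \<Rightarrow> nat \<Rightarrow> real"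
  shows "continuous_on S f \<longleftrightarrow> (\<forall>i. continuous_on S (\<lambda>x. f x i))"
  by (auto intro: continuous_on_coordinatewise_then_product continuous_on_product_then_coordinatewise)

lemma continuous_on_coordinate:
  fixes f :: "'a::topological_space \<Rightarrow> nat \<Rightarrow> real"
  assumes "continuous_on S f"
  shows "continuous_on S (\<lambda>x. f x i)"
  using assms continuous_on_nat_fun_iff by blast

lemma continuous_on_nat_fun_proj [continuous_intros]: "continuous_on S (\<lambda>x::nat \<Rightarrow> real. x i)"
  by (rule continuous_on_coordinate[OF continuous_on_id])

text \<open>Tychonoff in the product topology of sequences. Since \<open>R i = 0\<close> is allowed,
  the finite-dimensional boxes that confine the approximate solutions are among these sets.\<close>

lemma compact_nat_fun_box: "compact {x :: nat \<Rightarrow> real. \<forall>i. \<bar>x i\<bar> \<le> R i}"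
proof -
  have "compactin (product_topology (\<lambda>i. euclidean) UNIV) (PiE UNIV (\<lambda>i. {- R i..R i}))"
    by (simp add: compactin_PiE)
  moreover have "PiE UNIV (\<lambda>i. {- R i..R i}) = {x :: nat \<Rightarrow> real. \<forall>i. \<bar>x i\<bar> \<le> R i}"
    by (auto simp: PiE_def Pi_def abs_le_iff) (metis minus_le_iff)+
  ultimately show ?thesis
    by (simp add: euclidean_product_topology)
qed

section \<open>Spheres of variable dimension\<close>

definition unit_sphere :: "nat \<Rightarrow> (nat \<Rightarrow> real) set" where
  "unit_sphere n = {x. (\<Sum>i<n. (x i)\<^sup>2) = 1 \<and> (\<forall>i\<ge>n. x i = 0)}"

lemma nsphere_eq_unit_sphere: "nsphere n = top_of_set (unit_sphere (Suc n))"
  unfolding nsphere euclidean_product_topology unit_sphere_def lessThan_Suc_atMost Suc_le_eq ..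

text \<open>Homology supplies this for every sphere, \<open>unit_sphere n\<close> being the sphere
  of dimension n - 1. For \<open>n = 0\<close> the set is empty and hence contractible, which is why
  dimension zero is treated separately below.\<close>

lemma not_contractible_unit_sphere:
  assumes "0 < n" shows "\<not> contractible (unit_sphere n)"
  using non_contractible_space_nsphere[of "n - 1"] assms
  by (simp add: nsphere_eq_unit_sphere)

lemma closed_coordinates_zero: "closed {x :: nat \<Rightarrow> real. \<forall>i\<ge>n. x i = 0}"
proof -
  have "closed {x :: nat \<Rightarrow> real. x i = 0}" for i
    by (intro closed_Collect_eq continuous_intros)
  then have "closed (\<Inter>i\<in>{n..}. {x :: nat \<Rightarrow> real. x i = 0})" by blast
  moreover have "(\<Inter>i\<in>{n..}. {x :: nat \<Rightarrow> real. x i = 0}) = {x. \<forall>i\<ge>n. x i = 0}" by auto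
  ultimately show ?thesis by simp
qed

lemma coordinate_le_sum_squares:
  fixes x :: "nat \<Rightarrow> real"
  assumes "i < n" shows "(x i)\<^sup>2 \<le> (\<Sum>i<n. (x i)\<^sup>2)"
  using assms by (intro member_le_sum) auto

lemma compact_unit_sphere: "compact (unit_sphere n)"
proof -
  have "closed (unit_sphere n)"
    unfolding unit_sphere_def Collect_conj_eq
    by (intro closed_Int closed_coordinates_zero closed_Collect_eq continuous_intros)
  moreover have "unit_sphere n \<subseteq> {x. \<forall>i. \<bar>x i\<bar> \<le> 1}"
  proof safe
    fix x i assume x: "x \<in> unit_sphere n"
    show "\<bar>x i\<bar> \<le> 1"
      using x coordinate_le_sum_squares[of i n x]
      by (cases "i < n") (auto simp: unit_sphere_def abs_square_le_1)
  qed
  ultimately show ?thesis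
    using compact_Int_closed[OF compact_nat_fun_box[of "\<lambda>_. 1"]] by (metis inf.absorb_iff2)
qed

text \<open>A Brouwer argument whose dimension is a term and not a type: a zero-free field would make
  the sphere contractible, by pushing the identity linearly to the field on the sphere and then
  shrinking its argument to the origin.\<close>

lemma coercive_field_has_zero:
  fixes F :: "(nat \<Rightarrow> real) \<Rightarrow> nat \<Rightarrow> real"
  assumes cont: "\<And>j. j < n \<Longrightarrow> continuous_on UNIV (\<lambda>x. F x j)"
    and r: "0 < r"
    and coercive: "\<And>x. \<forall>i\<ge>n. x i = 0 \<Longrightarrow> (\<Sum>i<n. (x i)\<^sup>2) = r\<^sup>2 \<Longrightarrow> 0 \<le> (\<Sum>i<n. x i * F x i)"
  obtains x where "\<forall>i\<ge>n. x i = 0" "\<And>j. j < n \<Longrightarrow> F x j = 0"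
proof (cases "n = 0")
  case True
  then show ?thesis using that[of "\<lambda>_. 0"] by auto
next
  case False
  note witness = that
  show ?thesis
  proof (rule ccontr)
    assume "\<not> thesis"
    then have nz: "\<exists>j<n. F x j \<noteq> 0" if "\<forall>i\<ge>n. x i = 0" for x using that witness by blast
    \<comment> \<open>Radial projection onto the sphere. It cuts off the components from
      \<open>n\<close> on, about which nothing is known for \<open>F\<close>.\<close>
    define N where "N v i = (if i < n then v i / sqrt (\<Sum>i<n. (v i)\<^sup>2) else 0)" for v :: "nat \<Rightarrow> real" and i
    have pos: "0 < (\<Sum>i<n. (v i)\<^sup>2)" if "\<exists>j<n. v j \<noteq> 0" for v :: "nat \<Rightarrow> real"
      using that by (auto intro!: sum_pos2)
    have N_in: "N v \<in> unit_sphere n" if "\<exists>j<n. v j \<noteq> 0" for v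
      using pos[OF that] by (simp add: N_def unit_sphere_def power_divide flip: sum_divide_distrib)
    have contN: "continuous_on S (\<lambda>x. N (g x))"
      if "\<And>x. x \<in> S \<Longrightarrow> \<exists>j<n. g x j \<noteq> 0" "\<And>j. j < n \<Longrightarrow> continuous_on S (\<lambda>x. g x j)"
      for S :: "(real \<times> (nat \<Rightarrow> real)) set" and g
    proof -
      have "continuous_on S (\<lambda>x. N (g x) i)" for i
      proof (cases "i < n")
        case True
        have "continuous_on S (\<lambda>x. g x i / sqrt (\<Sum>i<n. (g x i)\<^sup>2))"
        proof (intro continuous_on_divide continuous_on_real_sqrt continuous_on_sum continuous_on_power)
          show "\<forall>x\<in>S. sqrt (\<Sum>i<n. (g x i)\<^sup>2) \<noteq> 0"
          proof
            fix x assume "x \<in> S"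
            then show "sqrt (\<Sum>i<n. (g x i)\<^sup>2) \<noteq> 0" using pos[OF that(1)[of x]] by simp
          qed
        qed (use that(2) True in auto)
        then show ?thesis using True by (simp add: N_def)
      qed (simp add: N_def)
      then show ?thesis by (simp add: continuous_on_nat_fun_iff)
    qed
    have contF: "continuous_on S (\<lambda>x. F (h x) j)" if "continuous_on S h" "j < n"
      for S :: "(real \<times> (nat \<Rightarrow> real)) set" and h j
      by (rule continuous_on_compose2[OF cont[OF that(2)] that(1)]) auto
    have conth: "continuous_on S (\<lambda>x. \<lambda>i. h x i)" if "\<And>i. continuous_on S (\<lambda>x. h x i)"
      for S :: "(real \<times> (nat \<Rightarrow> real)) set" and h :: "_ \<Rightarrow> nat \<Rightarrow> real"
      using that by (simp add: continuous_on_nat_fun_iff)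
    define g1 where "g1 = (\<lambda>(t, x). \<lambda>i. (1 - t) * x i + t * F (\<lambda>i. r * x i) i)"
    define g2 where "g2 = (\<lambda>(t, x). F (\<lambda>i. (1 - t) * r * x i))"
    \<comment> \<open>Pairing with \<open>x\<close> gives at least \<open>1 - t\<close>, as
      \<open>x\<close> has norm 1 and the field is coercive on the sphere of radius
      \<open>r\<close>; at \<open>t = 1\<close> the assumed absence of zeros takes over.\<close>
    have nz1: "\<exists>j<n. g1 p j \<noteq> 0" if p: "p \<in> {0..1} \<times> unit_sphere n" for p
    proof -
      obtain t x where tx: "p = (t, x)" "0 \<le> t" "t \<le> 1" "x \<in> unit_sphere n" using p by auto
      have x: "(\<Sum>i<n. (x i)\<^sup>2) = 1" "\<forall>i\<ge>n. x i = 0" using tx by (auto simp: unit_sphere_def)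
      have "0 \<le> (\<Sum>i<n. (r * x i) * F (\<lambda>i. r * x i) i)"
        using x by (intro coercive) (auto simp: power_mult_distrib simp flip: sum_distrib_left)
      also have "\<dots> = r * (\<Sum>i<n. x i * F (\<lambda>i. r * x i) i)"
        by (simp add: sum_distrib_left mult.assoc)
      finally have ge: "0 \<le> (\<Sum>i<n. x i * F (\<lambda>i. r * x i) i)"
        using r by (simp add: zero_le_mult_iff)
      show ?thesis
      proof (cases "t = 1")
        case True
        then show ?thesis using nz[of "\<lambda>i. r * x i"] x tx by (auto simp: g1_def)
      next
        case False
        have "(\<Sum>i<n. x i * g1 p i) = (1 - t) * (\<Sum>i<n. (x i)\<^sup>2) + t * (\<Sum>i<n. x i * F (\<lambda>i. r * x i) i)"
          by (simp add: tx g1_def sum_distrib_left power2_eq_square algebra_simps flip: sum.distrib sum_subtractf)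
        also have "\<dots> > 0" using x ge tx False by (simp add: add_pos_nonneg)
        finally have "(\<Sum>i<n. x i * g1 p i) \<noteq> 0" by simp
        then obtain i where "i \<in> {..<n}" "x i * g1 p i \<noteq> 0"
          by (rule sum.not_neutral_contains_not_neutral)
        then show ?thesis by auto
      qed
    qed
    have nz2: "\<exists>j<n. g2 p j \<noteq> 0" if p: "p \<in> {0..1} \<times> unit_sphere n" for p
      using p nz by (auto simp: g2_def unit_sphere_def)
    have "homotopic_with_canon (\<lambda>_. True) (unit_sphere n) (unit_sphere n) id (\<lambda>x. N (F (\<lambda>i. r * x i)))"
    proof (subst homotopic_with, simp, intro exI[of _ "\<lambda>p. N (g1 p)"] conjI ballI allI)
      have "continuous_on ({0..1} \<times> unit_sphere n) (\<lambda>p. N (g1 p))"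
      proof (rule contN)
        show "\<exists>j<n. g1 p j \<noteq> 0" if "p \<in> {0..1} \<times> unit_sphere n" for p
          using nz1 that by blast
      next
        fix j assume j: "j < n"
        show "continuous_on ({0..1} \<times> unit_sphere n) (\<lambda>p. g1 p j)"
          unfolding g1_def case_prod_unfold
          by (intro continuous_on_add continuous_on_mult continuous_on_diff continuous_on_const
              continuous_on_fst continuous_on_id contF[OF _ j] conth continuous_on_coordinate[OF continuous_on_snd])
      qed
      then show "continuous_map (prod_topology (top_of_set {0..1}) (top_of_set (unit_sphere n))) (top_of_set (unit_sphere n)) (\<lambda>p. N (g1 p))"
        using nz1 N_in by (auto simp: Pi_iff)
      show "N (g1 (0, x)) = id x" if "x \<in> topspace (top_of_set (unit_sphere n))" for x
        using that by (auto simp: g1_def N_def unit_sphere_def fun_eq_iff)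
      show "N (g1 (1, x)) = N (F (\<lambda>i. r * x i))" if "x \<in> topspace (top_of_set (unit_sphere n))" for x
        by (simp add: g1_def)
    qed auto
    moreover have "homotopic_with_canon (\<lambda>_. True) (unit_sphere n) (unit_sphere n) (\<lambda>x. N (F (\<lambda>i. r * x i))) (\<lambda>x. N (F (\<lambda>_. 0)))"
      unfolding homotopic_with_def
    proof (intro exI[of _ "\<lambda>p. N (g2 p)"] conjI allI impI)
      have "continuous_on ({0..1} \<times> unit_sphere n) (\<lambda>p. N (g2 p))"
      proof (rule contN)
        show "\<exists>j<n. g2 p j \<noteq> 0" if "p \<in> {0..1} \<times> unit_sphere n" for p
          using nz2 that by blast
      next
        fix j assume j: "j < n"
        show "continuous_on ({0..1} \<times> unit_sphere n) (\<lambda>p. g2 p j)"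
          unfolding g2_def case_prod_unfold
          by (intro continuous_on_mult continuous_on_diff continuous_on_const
              continuous_on_fst continuous_on_id contF[OF _ j] conth continuous_on_coordinate[OF continuous_on_snd])
      qed
      then show "continuous_map (prod_topology (top_of_set {0..1}) (top_of_set (unit_sphere n))) (top_of_set (unit_sphere n)) (\<lambda>p. N (g2 p))"
        using nz2 N_in by (auto simp: Pi_iff)
    qed (auto simp: g2_def)
    ultimately have "homotopic_with_canon (\<lambda>_. True) (unit_sphere n) (unit_sphere n) id (\<lambda>x. N (F (\<lambda>_. 0)))"
      by (rule homotopic_with_trans)
    then have "contractible (unit_sphere n)"
      unfolding contractible_def by blast
    then show False using not_contractible_unit_sphere False by blast
  qed
qed

section \<open>Quadratic forms on coordinate space\<close>

text \<open>The minimum of \<open>q\<close> over the slice of the unit sphere by the cone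
  \<open>K\<close> is attained and positive, and homogeneity spreads it over \<open>K\<close>.
  Restricting to a cone admits forms that are definite only on the complement of their
  kernel.\<close>

lemma pos_def_form_lower_bound:
  fixes q :: "(nat \<Rightarrow> real) \<Rightarrow> real"
  assumes cont: "continuous_on UNIV q"
    and hom: "\<And>s x. q (\<lambda>i. s * x i) = s\<^sup>2 * q x"
    and K: "closed K" "\<And>s x. x \<in> K \<Longrightarrow> (\<lambda>i. s * x i) \<in> K"
    and pos: "\<And>x. x \<in> K \<Longrightarrow> \<forall>i\<ge>n. x i = 0 \<Longrightarrow> \<exists>i<n. x i \<noteq> 0 \<Longrightarrow> 0 < q x"
  obtains l where "0 < l" "\<And>x. x \<in> K \<Longrightarrow> \<forall>i\<ge>n. x i = 0 \<Longrightarrow> l * (\<Sum>i<n. (x i)\<^sup>2) \<le> q x"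
proof -
  have q0: "q x = 0" if "\<And>i. x i = 0" for x
    using hom[of 0 x] that by (metis mult_zero_left power_zero_numeral mult_zero_right ext)
  have ne: "\<exists>i<n. x i \<noteq> 0" if "x \<in> unit_sphere n" for x
    using that by (rule_tac ccontr) (auto simp: unit_sphere_def)
  have scaled: "(\<lambda>i. x i / sqrt s) \<in> unit_sphere n" "q x = s * q (\<lambda>i. x i / sqrt s)"
    if "\<forall>i\<ge>n. x i = 0" "s = (\<Sum>i<n. (x i)\<^sup>2)" "s > 0" for x s
    using that hom[of "sqrt s" "\<lambda>i. x i / sqrt s"]
    by (auto simp: unit_sphere_def power_divide simp flip: sum_divide_distrib)
  have zero: "\<And>i. x i = 0" if "\<forall>i\<ge>n. x i = 0" "\<not> (\<Sum>i<n. (x i)\<^sup>2) > 0" for x :: "nat \<Rightarrow> real"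
  proof -
    fix i
    show "x i = 0"
      using that coordinate_le_sum_squares[of i n x] by (cases "i < n") (auto simp: not_less dest: order_trans)
  qed
  define S where "S = unit_sphere n \<inter> K"
  have "compact S" unfolding S_def using compact_unit_sphere K by (intro compact_Int_closed)
  show ?thesis
  proof (cases "S = {}")
    case True
    \<comment> \<open>An empty slice means that \<open>K\<close> has no nonzero vector supported in
      the first \<open>n\<close> coordinates, so any positive constant would do.\<close>
    have "1 * (\<Sum>i<n. (x i)\<^sup>2) \<le> q x" if x: "x \<in> K" "\<forall>i\<ge>n. x i = 0" for x
    proof (cases "(\<Sum>i<n. (x i)\<^sup>2) > 0")
      case pos: True
      have "(\<lambda>i. x i / sqrt (\<Sum>i<n. (x i)\<^sup>2)) \<in> K"
        using K(2)[OF x(1), of "1 / sqrt (\<Sum>i<n. (x i)\<^sup>2)"] by simp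
      then show ?thesis using scaled[OF x(2) refl pos] True by (auto simp: S_def)
    next
      case False
      then show ?thesis using zero[OF x(2)] q0 by simp
    qed
    then show ?thesis using that[of 1] by simp
  next
    case False
    obtain x0 where x0: "x0 \<in> S" "\<And>x. x \<in> S \<Longrightarrow> q x0 \<le> q x"
      using continuous_attains_inf[OF \<open>compact S\<close> False continuous_on_subset[OF cont]] by auto
    have "0 < q x0" using x0(1) ne pos by (auto simp: S_def unit_sphere_def)
    moreover have "q x0 * (\<Sum>i<n. (x i)\<^sup>2) \<le> q x" if x: "x \<in> K" "\<forall>i\<ge>n. x i = 0" for x
    proof (cases "(\<Sum>i<n. (x i)\<^sup>2) > 0")
      case pos: True
      have "(\<lambda>i. x i / sqrt (\<Sum>i<n. (x i)\<^sup>2)) \<in> K"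
        using K(2)[OF x(1), of "1 / sqrt (\<Sum>i<n. (x i)\<^sup>2)"] by simp
      then have "q x0 \<le> q (\<lambda>i. x i / sqrt (\<Sum>i<n. (x i)\<^sup>2))"
        using scaled(1)[OF x(2) refl pos] by (intro x0(2)) (simp add: S_def)
      then show ?thesis unfolding scaled(2)[OF x(2) refl pos] using pos by (simp add: mult.commute)
    next
      case False
      then have "(\<Sum>i<n. (x i)\<^sup>2) = 0" "q x = 0" using zero[OF x(2) False] q0 by simp_all
      then show ?thesis by simp
    qed
    ultimately show ?thesis using that by blast
  qed
qed

text \<open>Along \<open>s * d + e\<close>, with \<open>e\<close> the \<open>l\<close>-th unit
  vector, the form equals \<open>t l l + 2 * s * a\<close>, the quadratic term dropping out because
  \<open>d\<close> is isotropic. An affine function of \<open>s\<close> that never becomes negative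
  has slope zero.\<close>

lemma quadratic_form_kernel:
  fixes t :: "nat \<Rightarrow> nat \<Rightarrow> real"
  assumes sym: "\<And>k l. t k l = t l k"
    and psd: "\<And>d. 0 \<le> (\<Sum>k<m. \<Sum>l<m. t k l * d k * d l)"
    and zero: "(\<Sum>k<m. \<Sum>l<m. t k l * d k * d l) = 0"
    and l: "l < m"
  shows "(\<Sum>k<m. t k l * d k) = 0"
proof (rule ccontr)
  define a where "a = (\<Sum>k<m. t k l * d k)"
  assume "(\<Sum>k<m. t k l * d k) \<noteq> 0"
  then have a: "a \<noteq> 0" by (simp add: a_def)
  have expand: "(\<Sum>k<m. \<Sum>i<m. t k i * (s * d k + of_bool (k = l)) * (s * d i + of_bool (i = l)))
    = t l l + 2 * s * a" for s
  proof -
    have "(\<Sum>k<m. \<Sum>i<m. t k i * (s * d k + of_bool (k = l)) * (s * d i + of_bool (i = l)))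
      = (\<Sum>k<m. \<Sum>i<m. s * s * (t k i * d k * d i) + s * (of_bool (i = l) * (t k i * d k))
          + s * (of_bool (k = l) * (t k i * d i)) + of_bool (k = l) * (of_bool (i = l) * t k i))"
      by (intro sum.cong refl) (simp add: algebra_simps)
    also have "\<dots> = s * s * (\<Sum>k<m. \<Sum>i<m. t k i * d k * d i)
        + s * (\<Sum>k<m. \<Sum>i<m. of_bool (i = l) * (t k i * d k))
        + s * (\<Sum>k<m. \<Sum>i<m. of_bool (k = l) * (t k i * d i))
        + (\<Sum>k<m. \<Sum>i<m. of_bool (k = l) * (of_bool (i = l) * t k i))"
      by (simp only: sum.distrib sum_distrib_left)
    also have "(\<Sum>k<m. \<Sum>i<m. of_bool (i = l) * (t k i * d k)) = a"
      using l by (simp add: a_def)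
    also have "(\<Sum>k<m. \<Sum>i<m. of_bool (k = l) * (t k i * d i)) = a"
      using l sym by (subst sum.swap) (simp add: a_def)
    also have "(\<Sum>k<m. \<Sum>i<m. of_bool (k = l) * (of_bool (i = l) * t k i)) = t l l"
      using l by (simp add: sum_distrib_left[symmetric])
    finally show ?thesis using zero by simp
  qed
  have "0 \<le> t l l + 2 * s * a" for s
    using psd[of "\<lambda>k. s * d k + of_bool (k = l)"] expand by metis
  from this[of "- (\<bar>t l l\<bar> + 1) / a"] show False using a by simp
qed

text \<open>The pressure block is regularized by \<open>\<epsilon>\<close> times the identity. The regularized pressure is
  automatically orthogonal to the common kernel of \<open>t\<close> and \<open>b\<close>, on whose complement the two
  forms control it uniformly in \<open>\<epsilon>\<close>; no inf-sup condition is needed.\<close>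

lemma saddle_point_system_solvable:
  fixes \<alpha> :: "(nat \<Rightarrow> real) \<Rightarrow> nat \<Rightarrow> real" and b t :: "nat \<Rightarrow> nat \<Rightarrow> real"
  assumes cont: "\<And>j. j < n \<Longrightarrow> continuous_on UNIV (\<lambda>c. \<alpha> c j)"
    and dep: "\<And>c c'. (\<And>i. i < n \<Longrightarrow> c i = c' i) \<Longrightarrow> \<alpha> c = \<alpha> c'"
    and kappa: "0 < \<kappa>"
    and coercive: "\<And>c. \<kappa> * (\<Sum>j<n. (c j)\<^sup>2) - (\<Sum>j<n. \<beta> j * c j) \<le> (\<Sum>j<n. c j * \<alpha> c j)"
    and sym: "\<And>k l. t k l = t l k"
    and psd: "\<And>d. 0 \<le> (\<Sum>k<m. \<Sum>l<m. t k l * d k * d l)"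
  obtains c d where "\<And>j. j < n \<Longrightarrow> \<alpha> c j - (\<Sum>l<m. b j l * d l) = 0"
    and "\<And>l. l < m \<Longrightarrow> (\<Sum>j<n. b j l * c j) + (\<Sum>k<m. t k l * d k) = 0"
proof -
  define B where "B x j = (\<Sum>l<m. b j l * x (n + l))" for x :: "nat \<Rightarrow> real" and j
  \<comment> \<open>Velocity coordinates come first, pressure coordinate \<open>l\<close> sits at
    index \<open>n + l\<close>. The coupling enters the two blocks with opposite signs, so that it
    cancels when the field is paired with \<open>x\<close>.\<close>
  define F where "F \<epsilon> x j = (if j < n then \<alpha> x j - B x j
      else (\<Sum>i<n. b i (j - n) * x i) + (\<Sum>k<m. t k (j - n) * x (n + k)) + \<epsilon> * x j)"
    for \<epsilon> x j
  \<comment> \<open>The constant left over when the load is absorbed by Young's inequality, at the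
    price of half of the coercivity constant.\<close>
  define K where "K = (\<Sum>j<n. (\<beta> j)\<^sup>2) / (2 * \<kappa>)"
  have K0: "0 \<le> K" using kappa by (simp add: K_def sum_nonneg)
  define tt where "tt x = (\<Sum>k<m. \<Sum>l<m. t k l * x (n + k) * x (n + l))" for x :: "nat \<Rightarrow> real"
  have tt0: "0 \<le> tt x" for x unfolding tt_def using psd[of "\<lambda>i. x (n + i)"] .
  have contF: "continuous_on UNIV (\<lambda>x. F \<epsilon> x j)" for \<epsilon> j
    by (cases "j < n") (auto simp: F_def B_def intro!: continuous_intros cont)
  have split: "(\<Sum>j<n + m. g j) = (\<Sum>j<n. g j) + (\<Sum>l<m. g (n + l))" for g :: "nat \<Rightarrow> real"
    by (induction m) auto
  have energy: "(\<Sum>j<n + m. x j * F \<epsilon> x j) = (\<Sum>j<n. x j * \<alpha> x j) + tt x + \<epsilon> * (\<Sum>l<m. (x (n + l))\<^sup>2)"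
    for x \<epsilon>
  proof -
    have "(\<Sum>j<n. x j * F \<epsilon> x j) = (\<Sum>j<n. x j * \<alpha> x j) - (\<Sum>j<n. \<Sum>l<m. x j * (b j l * x (n + l)))"
      by (simp add: F_def B_def right_diff_distrib sum_subtractf sum_distrib_left)
    moreover have "(\<Sum>l<m. x (n + l) * F \<epsilon> x (n + l)) = (\<Sum>l<m. \<Sum>j<n. x j * (b j l * x (n + l)))
        + (\<Sum>l<m. \<Sum>k<m. t k l * x (n + k) * x (n + l)) + \<epsilon> * (\<Sum>l<m. (x (n + l))\<^sup>2)"
      by (simp add: F_def distrib_left sum.distrib sum_distrib_left power2_eq_square ac_simps)
    moreover have "(\<Sum>l<m. \<Sum>k<m. t k l * x (n + k) * x (n + l)) = tt x"
      unfolding tt_def by (rule sum.swap)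
    moreover have "(\<Sum>l<m. \<Sum>j<n. x j * (b j l * x (n + l))) = (\<Sum>j<n. \<Sum>l<m. x j * (b j l * x (n + l)))"
      by (rule sum.swap)
    ultimately show ?thesis by (simp add: split)
  qed
  have young: "\<kappa> / 2 * (\<Sum>j<n. (x j)\<^sup>2) - K \<le> (\<Sum>j<n. x j * \<alpha> x j)" for x
  proof -
    have "\<beta> j * x j \<le> \<kappa> / 2 * (x j)\<^sup>2 + (\<beta> j)\<^sup>2 / (2 * \<kappa>)" for j
    proof -
      have "0 \<le> (\<kappa> * x j - \<beta> j)\<^sup>2 / (2 * \<kappa>)" using kappa by simp
      also have "\<dots> = \<kappa> / 2 * (x j)\<^sup>2 + (\<beta> j)\<^sup>2 / (2 * \<kappa>) - \<beta> j * x j"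
        using kappa by (simp add: power2_eq_square field_simps)
      finally show ?thesis by simp
    qed
    then have "(\<Sum>j<n. \<beta> j * x j) \<le> (\<Sum>j<n. \<kappa> / 2 * (x j)\<^sup>2 + (\<beta> j)\<^sup>2 / (2 * \<kappa>))" by (intro sum_mono)
    also have "\<dots> = \<kappa> / 2 * (\<Sum>j<n. (x j)\<^sup>2) + K"
      by (simp add: sum.distrib sum_distrib_left K_def sum_divide_distrib)
    finally show ?thesis using coercive[of x] by simp
  qed
  have ex: "\<exists>x. (\<forall>i\<ge>n + m. x i = 0) \<and> (\<forall>j<n + m. F \<epsilon> x j = 0)" if e: "0 < \<epsilon>" for \<epsilon>
  proof -
    \<comment> \<open>The pairing is at least \<open>\<rho> * |x|^2 - K\<close>, which equals
      \<open>\<rho>\<close> on the sphere of radius \<open>r\<close>. This radius may grow without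
      bound as \<epsilon> tends to zero, so bounds uniform in \<epsilon> need a separate
      argument.\<close>
    define \<rho> where "\<rho> = min (\<kappa> / 2) \<epsilon>"
    have rho: "0 < \<rho>" using e kappa by (simp add: \<rho>_def)
    define r where "r = sqrt (K / \<rho> + 1)"
    have r: "0 < r" "r\<^sup>2 = K / \<rho> + 1" using K0 rho by (auto simp: r_def add_nonneg_pos)
    have "0 \<le> (\<Sum>i<n + m. x i * F \<epsilon> x i)" if "(\<Sum>i<n + m. (x i)\<^sup>2) = r\<^sup>2" for x
    proof -
      have "\<rho> * (\<Sum>i<n + m. (x i)\<^sup>2) = \<rho> * (\<Sum>j<n. (x j)\<^sup>2) + \<rho> * (\<Sum>l<m. (x (n + l))\<^sup>2)"
        by (simp add: split distrib_left)
      also have "\<dots> \<le> \<kappa> / 2 * (\<Sum>j<n. (x j)\<^sup>2) + \<epsilon> * (\<Sum>l<m. (x (n + l))\<^sup>2)"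
        by (intro add_mono mult_right_mono sum_nonneg) (auto simp: \<rho>_def)
      also have "\<dots> \<le> (\<Sum>i<n + m. x i * F \<epsilon> x i) + K"
        using young[of x] tt0[of x] by (simp add: energy)
      finally have "\<rho> * r\<^sup>2 \<le> (\<Sum>i<n + m. x i * F \<epsilon> x i) + K" by (simp add: that)
      moreover have "\<rho> * r\<^sup>2 = K + \<rho>" using rho by (simp add: r field_simps)
      ultimately show ?thesis using rho by simp
    qed
    then show ?thesis
      using coercive_field_has_zero[of "n + m" "F \<epsilon>" r] contF r(1) by metis
  qed
  \<comment> \<open>Independent of \<epsilon>: at a zero the energy identity gives
    \<open>\<kappa> / 2 * |c|^2 \<le> K\<close> for the velocity part \<open>c\<close>.\<close>
  define R where "R = sqrt (2 * K / \<kappa>)"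
  define P where "P = {x :: nat \<Rightarrow> real. \<forall>i. \<bar>x i\<bar> \<le> (if i < n then R else 0)}"
  have compP: "compact P" unfolding P_def by (rule compact_nat_fun_box)
  have "\<exists>A. \<forall>j<n. \<forall>x\<in>P. \<bar>\<alpha> x j\<bar> \<le> A"
  proof -
    have "\<exists>A. \<forall>x\<in>P. \<bar>\<alpha> x j\<bar> \<le> A" if "j < n" for j
      using compact_imp_bounded[OF compact_continuous_image[OF continuous_on_subset[OF cont[OF that]] compP]]
      by (auto simp: bounded_iff)
    then obtain A where A: "\<And>j x. j < n \<Longrightarrow> x \<in> P \<Longrightarrow> \<bar>\<alpha> x j\<bar> \<le> A j" by metis
    have "\<bar>\<alpha> x j\<bar> \<le> (\<Sum>j<n. \<bar>A j\<bar>)" if "j < n" "x \<in> P" for j x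
      using A[OF that] member_le_sum[of j "{..<n}" "\<lambda>j. \<bar>A j\<bar>"] that by force
    then show ?thesis by blast
  qed
  then obtain A where A: "\<And>j x. j < n \<Longrightarrow> x \<in> P \<Longrightarrow> \<bar>\<alpha> x j\<bar> \<le> A" by blast
  \<comment> \<open>\<open>N\<close> consists of the pressures that neither form sees, and
    \<open>Kp\<close> is its orthogonal complement. By semidefiniteness \<open>D\<close> vanishes on
    \<open>N\<close> only, hence it is positive definite on \<open>Kp\<close>.\<close>
  define N where "N = {q :: nat \<Rightarrow> real. (\<forall>l<m. (\<Sum>k<m. t k l * q k) = 0) \<and> (\<forall>j<n. (\<Sum>l<m. b j l * q l) = 0)}"
  define Kp where "Kp = {d :: nat \<Rightarrow> real. \<forall>q\<in>N. (\<Sum>l<m. q l * d l) = 0}"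
  define D where "D d = (\<Sum>k<m. \<Sum>l<m. t k l * d k * d l) + (\<Sum>j<n. (\<Sum>l<m. b j l * d l)\<^sup>2)"
    for d :: "nat \<Rightarrow> real"
  obtain \<omega> where omega: "0 < \<omega>" "\<And>d. d \<in> Kp \<Longrightarrow> \<forall>i\<ge>m. d i = 0 \<Longrightarrow> \<omega> * (\<Sum>l<m. (d l)\<^sup>2) \<le> D d"
  proof (rule pos_def_form_lower_bound[of D Kp m])
    show "continuous_on UNIV D"
      unfolding D_def by (intro continuous_intros)
    show "D (\<lambda>i. s * d i) = s\<^sup>2 * D d" for s d
    proof -
      have "(\<Sum>l<m. b j l * (s * d l)) = s * (\<Sum>l<m. b j l * d l)" for j
        by (simp add: sum_distrib_left ac_simps)
      then show ?thesis
        by (simp add: D_def distrib_left sum_distrib_left power2_eq_square power_mult_distrib ac_simps)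
    qed
    have "Kp = (\<Inter>q\<in>N. {d. (\<Sum>l<m. q l * d l) = 0})" by (auto simp: Kp_def)
    then show "closed Kp" by (auto intro!: closed_INT closed_Collect_eq continuous_intros)
    show "(\<lambda>i. s * d i) \<in> Kp" if "d \<in> Kp" for s d
    proof -
      have "(\<Sum>l<m. q l * (s * d l)) = s * (\<Sum>l<m. q l * d l)" for q
        by (simp add: sum_distrib_left ac_simps)
      then show ?thesis using that by (simp add: Kp_def)
    qed
    show "0 < D d" if d: "d \<in> Kp" "\<exists>i<m. d i \<noteq> 0" for d
    proof (rule ccontr)
      assume "\<not> 0 < D d"
      moreover have nn: "0 \<le> (\<Sum>k<m. \<Sum>l<m. t k l * d k * d l)" "0 \<le> (\<Sum>j<n. (\<Sum>l<m. b j l * d l)\<^sup>2)"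
        using psd by (auto intro: sum_nonneg)
      ultimately have z: "(\<Sum>k<m. \<Sum>l<m. t k l * d k * d l) = 0" "(\<Sum>j<n. (\<Sum>l<m. b j l * d l)\<^sup>2) = 0"
        by (auto simp: D_def)
      have "d \<in> N"
        using z(2) quadratic_form_kernel[OF sym psd z(1)] by (auto simp: N_def sum_nonneg_eq_0_iff)
      then have "(\<Sum>l<m. d l * d l) = 0" using d(1) by (auto simp: Kp_def)
      then show False using d(2) by (auto simp: sum_nonneg_eq_0_iff)
    qed
  qed blast
  \<comment> \<open>The pressure bound from \<open>\<omega> * |d|^2 \<le> D d\<close>: the part of
    \<open>D\<close> that comes from \<open>t\<close> is at most \<open>K\<close> by the energy
    identity, and each entry of the coupling part equals an entry of \<alpha> by the momentum
    equation, hence is at most \<open>A\<close> in modulus.\<close>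
  define Q where "Q = sqrt ((K + (\<Sum>j<n. A\<^sup>2)) / \<omega>)"
  define X where "X = {x :: nat \<Rightarrow> real. \<forall>i. \<bar>x i\<bar> \<le> (if i < n then R else if i < n + m then Q else 0)}"
  have compX: "compact X" unfolding X_def by (rule compact_nat_fun_box)
  have R0: "0 \<le> R" using K0 kappa by (simp add: R_def)
  have Q0: "0 \<le> Q" using K0 omega(1) by (simp add: Q_def sum_nonneg)
  have inX: "x \<in> X" if e: "0 < \<epsilon>" and x: "\<forall>i\<ge>n + m. x i = 0" "\<forall>j<n + m. F \<epsilon> x j = 0" for \<epsilon> x
  proof -
    have E0: "(\<Sum>j<n. x j * \<alpha> x j) + tt x + \<epsilon> * (\<Sum>l<m. (x (n + l))\<^sup>2) = 0"
      using x(2) unfolding energy[symmetric] by (intro sum.neutral) auto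
    moreover have "0 \<le> \<epsilon> * (\<Sum>l<m. (x (n + l))\<^sup>2)" using e by (simp add: sum_nonneg)
    ultimately have E: "\<kappa> / 2 * (\<Sum>j<n. (x j)\<^sup>2) + tt x \<le> K" using young[of x] by simp
    then have "(\<Sum>j<n. (x j)\<^sup>2) \<le> 2 * K / \<kappa>" using kappa tt0[of x] by (simp add: field_simps)
    then have xR: "\<bar>x j\<bar> \<le> R" if "j < n" for j
      using coordinate_le_sum_squares[OF that, of x] unfolding R_def
      by (intro real_le_rsqrt) (simp add: power2_abs)
    have ttK: "tt x \<le> K"
    proof -
      have "0 \<le> \<kappa> / 2 * (\<Sum>j<n. (x j)\<^sup>2)"
        using kappa by (intro mult_nonneg_nonneg sum_nonneg) auto
      then show ?thesis using E by linarith
    qed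
    define d where "d l = (if l < m then x (n + l) else 0)" for l
    have Bx: "B x j = \<alpha> x j" if "j < n" for j
      using x(2)[rule_format, of j] that by (simp add: F_def)
    \<comment> \<open>Summing the regularized pressure equations against \<open>q\<close> in
      \<open>N\<close> kills both forms and leaves \<epsilon> times the product of \<open>q\<close>
      and \<open>d\<close>.\<close>
    have "d \<in> Kp"
      unfolding Kp_def
    proof safe
      fix q assume q: "q \<in> N"
      have "0 = (\<Sum>l<m. q l * F \<epsilon> x (n + l))" using x(2) by simp
      also have "\<dots> = (\<Sum>l<m. \<Sum>i<n. x i * (b i l * q l)) + (\<Sum>l<m. \<Sum>k<m. x (n + k) * (t l k * q l))
          + \<epsilon> * (\<Sum>l<m. q l * x (n + l))"
        by (simp add: F_def distrib_left sum.distrib sum_distrib_left ac_simps sym)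
      also have "(\<Sum>l<m. \<Sum>i<n. x i * (b i l * q l)) = (\<Sum>i<n. x i * (\<Sum>l<m. b i l * q l))"
        by (subst sum.swap) (simp add: sum_distrib_left)
      also have "\<dots> = 0" using q by (simp add: N_def)
      also have "(\<Sum>l<m. \<Sum>k<m. x (n + k) * (t l k * q l)) = (\<Sum>k<m. x (n + k) * (\<Sum>l<m. t l k * q l))"
        by (subst sum.swap) (simp add: sum_distrib_left)
      also have "\<dots> = 0" using q by (simp add: N_def)
      finally show "(\<Sum>l<m. q l * d l) = 0" using e by (simp add: d_def)
    qed
    then have "\<omega> * (\<Sum>l<m. (d l)\<^sup>2) \<le> D d" by (rule omega(2)) (simp add: d_def)
    also have "D d = tt x + (\<Sum>j<n. (B x j)\<^sup>2)"
      by (simp add: D_def tt_def d_def B_def)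
    also have "\<dots> \<le> K + (\<Sum>j<n. A\<^sup>2)"
    proof (intro add_mono ttK sum_mono)
      fix j assume "j \<in> {..<n}"
      then have j: "j < n" by simp
      \<comment> \<open>\<open>A\<close> bounds \<alpha> on vectors without pressure entries; as
        \<alpha> depends on the velocity coordinates alone, these entries may be erased.\<close>
      define x' where "x' i = (if i < n then x i else 0)" for i
      have "\<alpha> x = \<alpha> x'" by (rule dep) (simp add: x'_def)
      moreover have "x' \<in> P" using xR by (simp add: P_def x'_def)
      ultimately have "\<bar>B x j\<bar> \<le> A" using A[OF j] Bx[OF j] by simp
      then show "(B x j)\<^sup>2 \<le> A\<^sup>2" by (metis abs_ge_zero abs_le_square_iff abs_of_nonneg order_trans)
    qed
    finally have "(\<Sum>l<m. (d l)\<^sup>2) \<le> (K + (\<Sum>j<n. A\<^sup>2)) / \<omega>"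
      using omega(1) by (simp add: field_simps)
    then have dQ: "\<bar>d l\<bar> \<le> Q" if "l < m" for l
      using coordinate_le_sum_squares[OF that, of d] unfolding Q_def
      by (intro real_le_rsqrt) (simp add: power2_abs)
    have "\<bar>x i\<bar> \<le> Q" if "n \<le> i" "i < n + m" for i
      using dQ[of "i - n"] that by (auto simp: d_def)
    then show "x \<in> X" using xR x(1) by (auto simp: X_def)
  qed
  \<comment> \<open>Residual of the system without regularization. Its minimum over the compact box
    is attained, and zeros of the regularized systems show that it is arbitrarily small; this takes
    the place of a convergent subsequence.\<close>
  define G where "G x = (\<Sum>j<n + m. \<bar>F 0 x j\<bar>)" for x
  have contG: "continuous_on X G"
    unfolding G_def by (intro continuous_intros continuous_on_subset[OF contF]) auto
  have "(\<lambda>_. 0) \<in> X" using R0 Q0 by (simp add: X_def)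
  then obtain z where z: "z \<in> X" "\<And>x. x \<in> X \<Longrightarrow> G z \<le> G x"
    using continuous_attains_inf[OF compX _ contG] by auto
  have small: "G z \<le> \<epsilon> * (m * Q)" if e: "0 < \<epsilon>" for \<epsilon>
  proof -
    obtain x where x: "\<forall>i\<ge>n + m. x i = 0" "\<forall>j<n + m. F \<epsilon> x j = 0" using ex[OF e] by blast
    have "x \<in> X" by (rule inX[OF e x])
    have "\<bar>F 0 x (n + l)\<bar> \<le> \<epsilon> * Q" if "l < m" for l
    proof -
      have "F 0 x (n + l) = - (\<epsilon> * x (n + l))" using x(2)[rule_format, of "n + l"] that by (simp add: F_def)
      then have "\<bar>F 0 x (n + l)\<bar> = \<epsilon> * \<bar>x (n + l)\<bar>" using e by (simp add: abs_mult)
      moreover have "\<bar>x (n + l)\<bar> \<le> Q" using \<open>x \<in> X\<close> that unfolding X_def mem_Collect_eq by (elim allE[of _ "n + l"]) simp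
      ultimately show ?thesis using e by simp
    qed
    then have "(\<Sum>l<m. \<bar>F 0 x (n + l)\<bar>) \<le> (\<Sum>l<m. \<epsilon> * Q)" by (intro sum_mono) simp
    moreover have "F 0 x j = 0" if "j < n" for j
      using x(2)[rule_format, of j] that by (simp add: F_def)
    then have "(\<Sum>j<n. \<bar>F 0 x j\<bar>) = 0" by simp
    ultimately have "G x \<le> \<epsilon> * (m * Q)" by (simp add: G_def split mult.left_commute)
    then show ?thesis using z(2)[OF \<open>x \<in> X\<close>] by simp
  qed
  have "G z \<le> 0"
  proof (rule field_le_epsilon)
    fix e :: real assume e: "0 < e"
    define \<epsilon> where "\<epsilon> = e / (m * Q + 1)"
    have mQ: "0 \<le> m * Q" using Q0 by simp
    have p: "0 < m * Q + 1" using mQ by linarith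
    have "0 < \<epsilon>" unfolding \<epsilon>_def using e p by (rule divide_pos_pos)
    then have "G z \<le> \<epsilon> * (m * Q)" by (rule small)
    also have "\<dots> \<le> \<epsilon> * (m * Q + 1)" using \<open>0 < \<epsilon>\<close> by simp
    also have "\<dots> = e" using p by (simp add: \<epsilon>_def)
    finally show "G z \<le> 0 + e" by simp
  qed
  moreover have "0 \<le> G z" by (simp add: G_def sum_nonneg)
  ultimately have "G z = 0" by simp
  then have F0: "F 0 z j = 0" if "j < n + m" for j
    using that by (simp add: G_def sum_nonneg_eq_0_iff)
  show ?thesis
  proof (rule that[of z "\<lambda>l. z (n + l)"])
    show "\<alpha> z j - (\<Sum>l<m. b j l * z (n + l)) = 0" if "j < n" for j
      using F0[of j] that by (simp add: F_def B_def)
    show "(\<Sum>j<n. b j l * z j) + (\<Sum>k<m. t k l * z (n + k)) = 0" if "l < m" for l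
      using F0[of "n + l"] that by (simp add: F_def)
  qed
qed

section \<open>Bounded measurable and square integrable functions\<close>

text \<open>Finite element functions and their gradients lie in this class on the regular part of
  the mesh. It is closed under the products that occur in the forms and contained in L1 on sets of
  finite measure, so integrability of an integrand can be read off its shape.\<close>

definition bounded_measurable_on :: "(real^'d) set \<Rightarrow> (real^'d \<Rightarrow> 'b::euclidean_space) \<Rightarrow> bool" where
  "bounded_measurable_on A f \<longleftrightarrow> f \<in> borel_measurable (lebesgue_on A) \<and> bounded (f ` A)"

lemma bounded_measurable_onD:
  assumes "bounded_measurable_on A f"
  shows "f \<in> borel_measurable (lebesgue_on A)" "\<exists>C. \<forall>x\<in>A. norm (f x) \<le> C"
  using assms by (auto simp: bounded_measurable_on_def bounded_iff)

named_theorems bm_intros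

lemma bm_const [bm_intros]: "bounded_measurable_on A (\<lambda>x. c)"
  by (auto simp: bounded_measurable_on_def bounded_iff)

lemma bm_bilinear:
  assumes "bounded_bilinear h" "bounded_measurable_on A f" "bounded_measurable_on A g"
  shows "bounded_measurable_on A (\<lambda>x. h (f x) (g x))"
proof -
  interpret bounded_bilinear h by fact
  obtain C where C: "\<And>x. x \<in> A \<Longrightarrow> norm (f x) \<le> C" using bounded_measurable_onD(2)[OF assms(2)] by blast
  obtain D where D: "\<And>x. x \<in> A \<Longrightarrow> norm (g x) \<le> D" using bounded_measurable_onD(2)[OF assms(3)] by blast
  obtain K where K: "\<And>a b. norm (h a b) \<le> norm a * norm b * K" "0 \<le> K"
    using nonneg_bounded by auto
  have "norm (h (f x) (g x)) \<le> C * D * K" if "x \<in> A" for x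
  proof -
    have "norm (f x) * norm (g x) \<le> C * D"
      using C[OF that] D[OF that] norm_ge_zero[of "f x"] by (intro mult_mono) (linarith | simp)+
    then have "norm (f x) * norm (g x) * K \<le> C * D * K" by (rule mult_right_mono[OF _ K(2)])
    then show ?thesis using K(1)[of "f x" "g x"] by linarith
  qed
  then have "bounded ((\<lambda>x. h (f x) (g x)) ` A)" by (auto simp: bounded_iff)
  moreover have "(\<lambda>x. h (f x) (g x)) \<in> borel_measurable (lebesgue_on A)"
  proof (rule borel_measurable_continuous_Pair[where H=h])
    show "continuous_on UNIV (\<lambda>x. h (fst x) (snd x))"
      by (rule continuous_on[OF continuous_on_fst[OF continuous_on_id] continuous_on_snd[OF continuous_on_id]])
  qed (use assms(2,3) in \<open>simp_all add: bounded_measurable_on_def\<close>)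
  ultimately show ?thesis by (simp add: bounded_measurable_on_def)
qed

lemma bm_linear:
  assumes "bounded_linear h" "bounded_measurable_on A f"
  shows "bounded_measurable_on A (\<lambda>x. h (f x))"
proof -
  have f: "f \<in> borel_measurable (lebesgue_on A)" "bounded (f ` A)"
    using assms(2) by (simp_all only: bounded_measurable_on_def)
  have "bounded ((\<lambda>x. h (f x)) ` A)"
    using bounded_linear_image[OF f(2) assms(1)] by (simp only: image_image)
  moreover have "(\<lambda>x. h (f x)) \<in> borel_measurable (lebesgue_on A)"
    by (rule borel_measurable_continuous_on[OF linear_continuous_on[OF assms(1)] f(1)])
  ultimately show ?thesis by (simp only: bounded_measurable_on_def)
qed

lemma bm_add [bm_intros]:
  assumes "bounded_measurable_on A f" "bounded_measurable_on A g"
  shows "bounded_measurable_on A (\<lambda>x. f x + g x)"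
  using assms bounded_plus_comp[of f A g] borel_measurable_add[of f "lebesgue_on A" g]
  by (simp add: bounded_measurable_on_def)

lemma bm_scaleR [bm_intros]:
  "bounded_measurable_on A f \<Longrightarrow> bounded_measurable_on A g \<Longrightarrow> bounded_measurable_on A (\<lambda>x. f x *\<^sub>R g x)"
  by (rule bm_bilinear[OF bounded_bilinear_scaleR])

lemma bm_mult [bm_intros]:
  fixes f g :: "real^'d \<Rightarrow> real"
  shows "bounded_measurable_on A f \<Longrightarrow> bounded_measurable_on A g \<Longrightarrow> bounded_measurable_on A (\<lambda>x. f x * g x)"
  by (rule bm_bilinear[OF bounded_bilinear_mult])

lemma bm_inner [bm_intros]:
  "bounded_measurable_on A f \<Longrightarrow> bounded_measurable_on A g \<Longrightarrow> bounded_measurable_on A (\<lambda>x. f x \<bullet> g x)"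
  by (rule bm_bilinear[OF bounded_bilinear_inner])

lemma bm_uminus [bm_intros]: "bounded_measurable_on A f \<Longrightarrow> bounded_measurable_on A (\<lambda>x. - f x)"
  by (rule bm_linear[OF bounded_linear_minus[OF bounded_linear_ident]])

lemma bm_diff [bm_intros]:
  "bounded_measurable_on A f \<Longrightarrow> bounded_measurable_on A g \<Longrightarrow> bounded_measurable_on A (\<lambda>x. f x - g x)"
  using bm_add[OF _ bm_uminus, of A f g] by simp

lemma bm_sum [bm_intros]:
  "(\<And>i. i \<in> I \<Longrightarrow> bounded_measurable_on A (f i)) \<Longrightarrow> bounded_measurable_on A (\<lambda>x. \<Sum>i\<in>I. f i x)"
proof (induction I rule: infinite_finite_induct)
  case (insert i I)
  then show ?case using bm_add[of A "f i" "\<lambda>x. \<Sum>i\<in>I. f i x"] by simp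
qed (simp_all add: bm_const)

lemma bm_vec_nth [bm_intros]:
  "bounded_measurable_on A f \<Longrightarrow> bounded_measurable_on A (\<lambda>x. f x $ i)"
  by (rule bm_linear[OF bounded_linear_vec_nth])

lemma bm_vec_lambda [bm_intros]:
  fixes f :: "'n::finite \<Rightarrow> real^'d \<Rightarrow> 'b::euclidean_space"
  assumes "\<And>i. bounded_measurable_on A (f i)"
  shows "bounded_measurable_on A (\<lambda>x. \<chi> i. f i x)"
proof -
  have "(\<lambda>x. \<chi> i. f i x) = (\<lambda>x. \<Sum>i\<in>UNIV. axis i (f i x))"
    by (auto simp: fun_eq_iff vec_eq_iff axis_def if_distrib[of "\<lambda>x. x $ _"])
  moreover have "bounded_linear (\<lambda>y::'b. axis i y :: 'b^'n)" for i
    unfolding linear_conv_bounded_linear[symmetric] by (rule linearI) (simp_all add: axis_def vec_eq_iff)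
  then have "bounded_measurable_on A (\<lambda>x. axis i (f i x))" for i
    using bm_linear[OF _ assms] by blast
  then have "bounded_measurable_on A (\<lambda>x. \<Sum>i\<in>UNIV. axis i (f i x))" by (rule bm_sum)
  ultimately show ?thesis by simp
qed

lemma bm_matrix_vector_mult [bm_intros]:
  fixes f :: "real^'d \<Rightarrow> real^'n^'m"
  assumes "bounded_measurable_on A f" "bounded_measurable_on A g"
  shows "bounded_measurable_on A (\<lambda>x. f x *v g x)"
  unfolding matrix_vector_mult_def by (intro bm_intros assms)

lemma bm_trace [bm_intros]:
  fixes f :: "real^'d \<Rightarrow> real^'n^'n"
  assumes "bounded_measurable_on A f"
  shows "bounded_measurable_on A (\<lambda>x. trace (f x))"
  unfolding trace_def by (intro bm_intros assms)

lemma bm_subset: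
  assumes "bounded_measurable_on A f" "B \<subseteq> A"
  shows "bounded_measurable_on B f"
proof -
  have f: "f \<in> borel_measurable (lebesgue_on A)" "bounded (f ` A)"
    using assms(1) by (simp_all only: bounded_measurable_on_def)
  show ?thesis
    unfolding bounded_measurable_on_def
    using measurable_restrict_mono[OF f(1) assms(2)] bounded_subset[OF f(2) image_mono[OF assms(2)]] by (rule conjI)
qed

lemma bm_cong:
  assumes "\<And>x. x \<in> A \<Longrightarrow> f x = g x"
  shows "bounded_measurable_on A f \<longleftrightarrow> bounded_measurable_on A g"
proof -
  have "f ` A = g ` A" using assms by auto
  moreover have "f \<in> borel_measurable (lebesgue_on A) \<longleftrightarrow> g \<in> borel_measurable (lebesgue_on A)"
    using assms by (intro measurable_cong) auto
  ultimately show ?thesis by (simp add: bounded_measurable_on_def)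
qed

lemma bm_continuous:
  assumes "continuous_on A f" "bounded (f ` A)" "A \<in> sets lebesgue"
  shows "bounded_measurable_on A f"
  using continuous_imp_measurable_on_sets_lebesgue[OF assms(1,3)] assms(2)
  by (simp add: bounded_measurable_on_def)

lemma bm_integrable:
  assumes "bounded_measurable_on A f" "A \<in> lmeasurable"
  shows "integrable (lebesgue_on A) f"
proof -
  obtain C where C: "\<And>x. x \<in> A \<Longrightarrow> norm (f x) \<le> C" using bounded_measurable_onD(2)[OF assms(1)] by blast
  have "finite_measure (lebesgue_on A)" using assms(2) by (simp add: finite_measure_lebesgue_on)
  then interpret finite_measure "lebesgue_on A" .
  show ?thesis
  proof (rule integrable_const_bound[where B=C])
    show "AE x in lebesgue_on A. norm (f x) \<le> C" using C by (intro AE_I2) simp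
  qed (use assms(1) in \<open>simp add: bounded_measurable_on_def\<close>)
qed

text \<open>Nothing is assumed about \<open>f\<close>: by completeness of Lebesgue measure a change
  on a null set affects neither measurability nor the integral, and if the integrands are not
  measurable both integrals are zero by convention. This tolerates arbitrary values of
  \<open>grad\<close> on cell boundaries.\<close>

lemma integral_lebesgue_on_Int_negligible:
  fixes f :: "real^'d \<Rightarrow> 'b::euclidean_space"
  assumes AB: "A \<in> sets lebesgue" "B \<in> sets lebesgue" "negligible (A - B)"
  shows "(\<integral>x. f x \<partial>lebesgue_on A) = (\<integral>x. f x \<partial>lebesgue_on (A \<inter> B))"
proof -
  have "A \<inter> B \<in> sets lebesgue" using AB by blast
  then have eq: "(\<integral>x. f x \<partial>lebesgue_on A) = (\<integral>x. indicator A x *\<^sub>R f x \<partial>lebesgue)"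
    "(\<integral>x. f x \<partial>lebesgue_on (A \<inter> B)) = (\<integral>x. indicator (A \<inter> B) x *\<^sub>R f x \<partial>lebesgue)"
    using AB by (simp_all add: integral_restrict_space)
  have ae: "AE x in lebesgue. indicator A x *\<^sub>R f x = indicator (A \<inter> B) x *\<^sub>R f x"
    using AB(3) unfolding negligible_iff_null_sets
    by (rule AE_I') (auto simp: indicator_def)
  then have ae': "AE x in lebesgue. indicator (A \<inter> B) x *\<^sub>R f x = indicator A x *\<^sub>R f x"
    by eventually_elim (rule sym)
  have mono: "g \<in> borel_measurable lebesgue"
    if "h \<in> borel_measurable lebesgue" "AE x in lebesgue. h x = g x" for g h :: "real^'d \<Rightarrow> 'b"
    using that by (rule borel_measurable_AE)
  show ?thesis
  proof (cases "(\<lambda>x. indicator A x *\<^sub>R f x) \<in> borel_measurable lebesgue")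
    case True
    then have "(\<lambda>x. indicator (A \<inter> B) x *\<^sub>R f x) \<in> borel_measurable lebesgue"
      by (rule mono[OF _ ae])
    then show ?thesis unfolding eq by (rule integral_cong_AE[OF True _ ae])
  next
    case False
    then have "(\<lambda>x. indicator (A \<inter> B) x *\<^sub>R f x) \<notin> borel_measurable lebesgue"
    proof (rule contrapos_nn)
      assume "(\<lambda>x. indicator (A \<inter> B) x *\<^sub>R f x) \<in> borel_measurable lebesgue"
      then show "(\<lambda>x. indicator A x *\<^sub>R f x) \<in> borel_measurable lebesgue"
        by (rule mono[OF _ ae'])
    qed
    then have "\<not> integrable lebesgue (\<lambda>x. indicator (A \<inter> B) x *\<^sub>R f x)"
      by (rule contrapos_nn) (rule borel_measurable_integrable)
    then have "(\<integral>x. indicator (A \<inter> B) x *\<^sub>R f x \<partial>lebesgue) = 0"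
      by (rule not_integrable_integral_eq)
    moreover from False have "\<not> integrable lebesgue (\<lambda>x. indicator A x *\<^sub>R f x)"
      by (rule contrapos_nn) (rule borel_measurable_integrable)
    then have "(\<integral>x. indicator A x *\<^sub>R f x \<partial>lebesgue) = 0"
      by (rule not_integrable_integral_eq)
    ultimately show ?thesis unfolding eq by argo
  qed
qed

section \<open>Square integrability and limits of products\<close>

lemma Cauchy_Schwarz_integral:
  fixes f g :: "'a \<Rightarrow> real"
  assumes f: "f \<in> borel_measurable M" "integrable M (\<lambda>x. (f x)\<^sup>2)"
    and g: "g \<in> borel_measurable M" "integrable M (\<lambda>x. (g x)\<^sup>2)"
  shows "integrable M (\<lambda>x. f x * g x)"
    and "\<bar>\<integral>x. f x * g x \<partial>M\<bar> \<le> sqrt (\<integral>x. (f x)\<^sup>2 \<partial>M) * sqrt (\<integral>x. (g x)\<^sup>2 \<partial>M)"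
proof -
  have bound: "\<bar>a * b\<bar> \<le> a\<^sup>2 + b\<^sup>2" for a b :: real
  proof -
    have "2 * (\<bar>a\<bar> * \<bar>b\<bar>) \<le> a\<^sup>2 + b\<^sup>2"
      using zero_le_power2[of "\<bar>a\<bar> - \<bar>b\<bar>"] by (simp add: power2_diff)
    moreover have "0 \<le> \<bar>a\<bar> * \<bar>b\<bar>" by simp
    ultimately show ?thesis unfolding abs_mult by linarith
  qed
  show int: "integrable M (\<lambda>x. f x * g x)"
    by (rule Bochner_Integration.integrable_bound[OF Bochner_Integration.integrable_add[OF f(2) g(2)]])
       (use f g bound in auto)
  define a b c where "a = (\<integral>x. (f x)\<^sup>2 \<partial>M)" and "b = (\<integral>x. f x * g x \<partial>M)" and "c = (\<integral>x. (g x)\<^sup>2 \<partial>M)"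
  have a0: "0 \<le> a" "0 \<le> c" by (simp_all add: a_def c_def)
  \<comment> \<open>A polynomial in \<open>s\<close> without negative values has nonpositive
    discriminant; if its quadratic term is missing, it must be constant, which is the case
    \<open>a = 0\<close> below.\<close>
  have quad: "0 \<le> a * s\<^sup>2 + 2 * b * s + c" for s
  proof -
    have "0 \<le> (\<integral>x. (s * f x + g x)\<^sup>2 \<partial>M)" by simp
    also have "(\<lambda>x. (s * f x + g x)\<^sup>2) = (\<lambda>x. s\<^sup>2 * (f x)\<^sup>2 + 2 * s * (f x * g x) + (g x)\<^sup>2)"
      by (simp add: fun_eq_iff power2_eq_square algebra_simps)
    also have "(\<integral>x. s\<^sup>2 * (f x)\<^sup>2 + 2 * s * (f x * g x) + (g x)\<^sup>2 \<partial>M) = s\<^sup>2 * a + 2 * s * b + c"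
      unfolding a_def b_def c_def using f g int by simp
    finally show ?thesis by (simp add: ac_simps)
  qed
  have "b\<^sup>2 \<le> a * c"
  proof (cases "a = 0")
    case True
    have "b = 0"
    proof (rule ccontr)
      assume "b \<noteq> 0"
      then show False using quad[of "- (c + 1) / (2 * b)"] True by simp
    qed
    then show ?thesis using a0 by simp
  next
    case False
    then show ?thesis using quad[of "- b / a"] a0 by (simp add: power2_eq_square field_simps)
  qed
  then have "sqrt (b\<^sup>2) \<le> sqrt (a * c)" by (rule real_sqrt_le_mono)
  then show "\<bar>b\<bar> \<le> sqrt a * sqrt c" by (simp add: real_sqrt_mult)
qed


definition square_integrable :: "'a measure \<Rightarrow> ('a \<Rightarrow> real) \<Rightarrow> bool" where
  "square_integrable M f \<longleftrightarrow> f \<in> borel_measurable M \<and> integrable M (\<lambda>x. (f x)\<^sup>2)"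

lemma square_integrable_mult_integrable:
  "square_integrable M f \<Longrightarrow> square_integrable M g \<Longrightarrow> integrable M (\<lambda>x. f x * g x)"
  using Cauchy_Schwarz_integral(1) by (auto simp: square_integrable_def)

lemma square_integrable_add:
  assumes "square_integrable M f" "square_integrable M g"
  shows "square_integrable M (\<lambda>x. f x + g x)"
proof -
  have "integrable M (\<lambda>x. (f x)\<^sup>2 + 2 * (f x * g x) + (g x)\<^sup>2)"
    using assms square_integrable_mult_integrable[OF assms] by (simp add: square_integrable_def)
  moreover have "(\<lambda>x. (f x)\<^sup>2 + 2 * (f x * g x) + (g x)\<^sup>2) = (\<lambda>x. (f x + g x)\<^sup>2)"
    by (simp add: power2_sum algebra_simps)
  ultimately show ?thesis using assms by (auto simp: square_integrable_def)
qed

lemma square_integrable_scale: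
  assumes "square_integrable M f"
  shows "square_integrable M (\<lambda>x. c * f x)"
  using assms by (auto simp: square_integrable_def power_mult_distrib)

lemma square_integrable_diff:
  assumes "square_integrable M f" "square_integrable M g"
  shows "square_integrable M (\<lambda>x. f x - g x)"
  using square_integrable_add[OF assms(1) square_integrable_scale[OF assms(2), of "-1"]] by simp

lemma square_integrable_mult_bounded:
  assumes f: "square_integrable M f" and h: "h \<in> borel_measurable M" "\<And>x. x \<in> space M \<Longrightarrow> \<bar>h x\<bar> \<le> C"
  shows "square_integrable M (\<lambda>x. f x * h x)"
    and "(\<integral>x. (f x * h x)\<^sup>2 \<partial>M) \<le> C\<^sup>2 * (\<integral>x. (f x)\<^sup>2 \<partial>M)"
proof -
  have le: "(f x * h x)\<^sup>2 \<le> C\<^sup>2 * (f x)\<^sup>2" if "x \<in> space M" for x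
  proof -
    have "(h x)\<^sup>2 \<le> C\<^sup>2" using h(2)[OF that] by (metis abs_ge_zero abs_le_square_iff abs_of_nonneg order_trans)
    then show ?thesis unfolding power_mult_distrib by (metis mult.commute mult_right_mono zero_le_power2)
  qed
  have [measurable]: "f \<in> borel_measurable M" "h \<in> borel_measurable M" using f h by (auto simp: square_integrable_def)
  have i: "integrable M (\<lambda>x. C\<^sup>2 * (f x)\<^sup>2)" using f by (simp add: square_integrable_def)
  have "integrable M (\<lambda>x. (f x * h x)\<^sup>2)"
    by (rule Bochner_Integration.integrable_bound[OF i]) (use le in \<open>auto intro!: AE_I2\<close>)
  then show "square_integrable M (\<lambda>x. f x * h x)" by (simp add: square_integrable_def)
  show "(\<integral>x. (f x * h x)\<^sup>2 \<partial>M) \<le> C\<^sup>2 * (\<integral>x. (f x)\<^sup>2 \<partial>M)"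
    unfolding Bochner_Integration.integral_mult_right_zero[symmetric]
    by (rule integral_mono[OF \<open>integrable M (\<lambda>x. (f x * h x)\<^sup>2)\<close> i le])
qed

text \<open>The product is expanded around the limits, and the three error terms are controlled by
  the Cauchy-Schwarz inequality.\<close>

lemma tendsto_integral_mult:
  assumes f: "\<And>n. square_integrable M (fn n)" "square_integrable M f" "(\<lambda>n. \<integral>x. (fn n x - f x)\<^sup>2 \<partial>M) \<longlonglongrightarrow> 0"
    and g: "\<And>n. square_integrable M (gn n)" "square_integrable M g" "(\<lambda>n. \<integral>x. (gn n x - g x)\<^sup>2 \<partial>M) \<longlonglongrightarrow> 0"
  shows "(\<lambda>n. \<integral>x. fn n x * gn n x \<partial>M) \<longlonglongrightarrow> (\<integral>x. f x * g x \<partial>M)"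
proof -
  let ?N = "\<lambda>f. sqrt (\<integral>x. (f x)\<^sup>2 \<partial>M)"
  let ?fd = "\<lambda>n x. fn n x - f x" and ?gd = "\<lambda>n x. gn n x - g x"
  have fd: "square_integrable M (?fd n)" and gd: "square_integrable M (?gd n)" for n
    by (intro square_integrable_diff f g)+
  have CS: "\<bar>\<integral>x. a x * b x \<partial>M\<bar> \<le> ?N a * ?N b" if "square_integrable M a" "square_integrable M b" for a b
    using that Cauchy_Schwarz_integral(2) by (auto simp: square_integrable_def)
  have "norm ((\<integral>x. fn n x * gn n x \<partial>M) - (\<integral>x. f x * g x \<partial>M))
      \<le> ?N (?fd n) * ?N (?gd n) + (?N f * ?N (?gd n) + ?N (?fd n) * ?N g)" for n
  proof -
    have "(\<integral>x. fn n x * gn n x \<partial>M) = (\<integral>x. f x * g x + (?fd n x * ?gd n x + (f x * ?gd n x + ?fd n x * g x)) \<partial>M)"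
      by (rule Bochner_Integration.integral_cong) (simp_all add: algebra_simps)
    also have "\<dots> = (\<integral>x. f x * g x \<partial>M) + ((\<integral>x. ?fd n x * ?gd n x \<partial>M)
        + ((\<integral>x. f x * ?gd n x \<partial>M) + (\<integral>x. ?fd n x * g x \<partial>M)))"
      using square_integrable_mult_integrable[OF f(2) g(2)] square_integrable_mult_integrable[OF fd[of n] gd[of n]]
        square_integrable_mult_integrable[OF f(2) gd[of n]] square_integrable_mult_integrable[OF fd[of n] g(2)]
      by (simp only: Bochner_Integration.integral_add Bochner_Integration.integrable_add)
    finally show ?thesis
      using CS[OF fd[of n] gd[of n]] CS[OF f(2) gd[of n]] CS[OF fd[of n] g(2)] unfolding real_norm_def by linarith
  qed
  moreover have "(\<lambda>n. ?N (?fd n) * ?N (?gd n) + (?N f * ?N (?gd n) + ?N (?fd n) * ?N g)) \<longlonglongrightarrow> 0"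
  proof -
    have A: "(\<lambda>n. ?N (?fd n)) \<longlonglongrightarrow> 0" and B: "(\<lambda>n. ?N (?gd n)) \<longlonglongrightarrow> 0"
      using tendsto_real_sqrt[OF f(3)] tendsto_real_sqrt[OF g(3)] by simp_all
    show ?thesis
      using tendsto_add[OF tendsto_mult[OF A B] tendsto_add[OF tendsto_mult[OF tendsto_const B] tendsto_mult[OF A tendsto_const]],
          of "?N f" "?N g"] by simp
  qed
  ultimately have "(\<lambda>n. (\<integral>x. fn n x * gn n x \<partial>M) - (\<integral>x. f x * g x \<partial>M)) \<longlonglongrightarrow> 0"
    by (rule Lim_null_comparison[OF always_eventually[OF allI]])
  then show ?thesis by (simp add: LIM_zero_iff)
qed

text \<open>The bounded factor is absorbed into the first sequence, where it preserves convergence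
  in L2. Integrals of three factors pass to the limit this way as long as one factor is fixed and
  bounded.\<close>

lemma tendsto_integral_mult_bounded:
  assumes f: "\<And>n. square_integrable M (fn n)" "square_integrable M f" "(\<lambda>n. \<integral>x. (fn n x - f x)\<^sup>2 \<partial>M) \<longlonglongrightarrow> 0"
    and g: "\<And>n. square_integrable M (gn n)" "square_integrable M g" "(\<lambda>n. \<integral>x. (gn n x - g x)\<^sup>2 \<partial>M) \<longlonglongrightarrow> 0"
    and h: "h \<in> borel_measurable M" "\<And>x. x \<in> space M \<Longrightarrow> \<bar>h x\<bar> \<le> C"
  shows "(\<lambda>n. \<integral>x. fn n x * gn n x * h x \<partial>M) \<longlonglongrightarrow> (\<integral>x. f x * g x * h x \<partial>M)"
proof -
  have "(\<lambda>n. \<integral>x. (fn n x * h x) * gn n x \<partial>M) \<longlonglongrightarrow> (\<integral>x. (f x * h x) * g x \<partial>M)"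
  proof (rule tendsto_integral_mult[OF _ _ _ g])
    have "norm (\<integral>x. (fn n x * h x - f x * h x)\<^sup>2 \<partial>M) \<le> C\<^sup>2 * (\<integral>x. (fn n x - f x)\<^sup>2 \<partial>M)" for n
      using square_integrable_mult_bounded(2)[OF square_integrable_diff[OF f(1)[of n] f(2)] h]
      by (simp add: left_diff_distrib)
    moreover have "(\<lambda>n. C\<^sup>2 * (\<integral>x. (fn n x - f x)\<^sup>2 \<partial>M)) \<longlonglongrightarrow> 0"
      using tendsto_mult_right_zero[OF f(3)] by simp
    ultimately show "(\<lambda>n. \<integral>x. (fn n x * h x - f x * h x)\<^sup>2 \<partial>M) \<longlonglongrightarrow> 0"
      by (rule Lim_null_comparison[OF always_eventually[OF allI]])
    show "square_integrable M (\<lambda>x. fn n x * h x)" for n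
      by (rule square_integrable_mult_bounded(1)[OF f(1) h])
    show "square_integrable M (\<lambda>x. f x * h x)"
      by (rule square_integrable_mult_bounded(1)[OF f(2) h])
  qed
  then show ?thesis by (simp add: ac_simps)
qed

lemma bm_square_integrable:
  fixes f :: "real^'d \<Rightarrow> real"
  assumes "bounded_measurable_on A f" "A \<in> lmeasurable"
  shows "square_integrable (lebesgue_on A) f"
  using bm_integrable[OF bm_mult[OF assms(1,1)] assms(2)] assms(1)
  by (simp add: square_integrable_def bounded_measurable_on_def power2_eq_square)

section \<open>Gradients and integration by parts\<close>

lemma grad_nth:
  assumes "(f has_derivative f') (at x)"
  shows "grad f x $ j = f' (axis j 1)"
  using frechet_derivative_at[OF assms] by (simp add: grad_def)

lemma has_derivative_grad:
  assumes "f differentiable (at x)"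
  shows "(f has_derivative (\<lambda>h. grad f x \<bullet> h)) (at x)"
proof -
  obtain f' where f': "(f has_derivative f') (at x)" using assms by (auto simp: differentiable_def)
  interpret bounded_linear f' by (rule has_derivative_bounded_linear[OF f'])
  have "f' h = grad f x \<bullet> h" for h
  proof -
    have "f' h = f' (\<Sum>i\<in>UNIV. h $ i *\<^sub>R axis i 1)"
      using basis_expansion[of h] by (simp add: scalar_mult_eq_scaleR)
    also have "\<dots> = (\<Sum>i\<in>UNIV. h $ i * f' (axis i 1))" by (simp add: sum scaleR)
    also have "\<dots> = grad f x \<bullet> h" by (simp add: inner_vec_def grad_nth[OF f'] mult.commute)
    finally show ?thesis .
  qed
  then have "f' = (\<lambda>h. grad f x \<bullet> h)" by auto
  then show ?thesis using f' by simp
qed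

lemma grad_lincomb:
  assumes "f differentiable (at x)" "g differentiable (at x)"
  shows "grad (\<lambda>y. a * f y + b * g y) x = a *\<^sub>R grad f x + b *\<^sub>R grad g x"
proof -
  have "((\<lambda>y. a * f y + b * g y) has_derivative (\<lambda>h. a * (grad f x \<bullet> h) + b * (grad g x \<bullet> h))) (at x)"
    by (intro derivative_intros has_derivative_grad assms)
  then show ?thesis by (simp add: vec_eq_iff grad_nth inner_axis)
qed

lemma grad_mult:
  assumes "f differentiable (at x)" "g differentiable (at x)"
  shows "grad (\<lambda>y. f y * g y) x = f x *\<^sub>R grad g x + g x *\<^sub>R grad f x"
proof -
  have "((\<lambda>y. f y * g y) has_derivative (\<lambda>h. f x * (grad g x \<bullet> h) + (grad f x \<bullet> h) * g x)) (at x)"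
    by (intro derivative_intros has_derivative_grad assms)
  then show ?thesis by (simp add: vec_eq_iff grad_nth inner_axis mult.commute)
qed

lemma grad_const [simp]: "grad (\<lambda>x. c) = (\<lambda>x. 0)"
  by (simp add: fun_eq_iff vec_eq_iff grad_nth[OF has_derivative_const])

lemma grad_coordinate: "grad (\<lambda>x::real^'d. x $ i) = (\<lambda>x. axis i 1)"
proof
  fix x :: "real^'d"
  have "((\<lambda>x::real^'d. x $ i) has_derivative (\<lambda>h. h $ i)) (at x)"
    by (rule bounded_linear.has_derivative[OF bounded_linear_vec_nth has_derivative_ident])
  then show "grad (\<lambda>x::real^'d. x $ i) x = axis i 1"
    by (simp add: vec_eq_iff grad_nth axis_def)
qed

text \<open>Differentiability is meant in the whole space, not within \<open>S\<close>, so that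
  \<open>grad\<close> is the true gradient at every point of \<open>S\<close>.\<close>

definition C1_on :: "(real^'d) set \<Rightarrow> (real^'d \<Rightarrow> real) \<Rightarrow> bool" where
  "C1_on S f \<longleftrightarrow> (\<forall>x\<in>S. f differentiable (at x)) \<and> continuous_on S (grad f)"

lemma C1_onD:
  assumes "C1_on S f"
  shows "x \<in> S \<Longrightarrow> f differentiable (at x)" "continuous_on S (grad f)" "continuous_on S f"
  using assms by (auto simp: C1_on_def intro!: differentiable_imp_continuous_on differentiable_at_imp_differentiable_on)

lemma C1_on_mult:
  assumes "C1_on S f" "C1_on S g"
  shows "C1_on S (\<lambda>x. f x * g x)"
proof -
  have "continuous_on S (\<lambda>x. f x *\<^sub>R grad g x + g x *\<^sub>R grad f x)"
    by (intro continuous_intros C1_onD assms)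
  then have "continuous_on S (grad (\<lambda>x. f x * g x))"
    using assms by (subst continuous_on_cong[OF refl grad_mult]) (auto simp: C1_on_def)
  then show ?thesis using assms by (auto simp: C1_on_def)
qed

lemma C1_on_lincomb:
  assumes "C1_on S f" "C1_on S g"
  shows "C1_on S (\<lambda>x. a * f x + b * g x)"
proof -
  have "continuous_on S (\<lambda>x. a *\<^sub>R grad f x + b *\<^sub>R grad g x)"
    by (intro continuous_intros C1_onD assms)
  then have "continuous_on S (grad (\<lambda>x. a * f x + b * g x))"
    using assms by (subst continuous_on_cong[OF refl grad_lincomb]) (auto simp: C1_on_def)
  then show ?thesis using assms by (auto simp: C1_on_def)
qed

lemma C1_on_coordinate: "C1_on S (\<lambda>x. x $ i)"
  by (auto simp: C1_on_def grad_coordinate intro!: bounded_linear_imp_differentiable bounded_linear_vec_nth)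

section \<open>Box averages under translation\<close>

lemma has_vector_derivative_line:
  assumes "f differentiable (at (x + t *\<^sub>R axis j 1))"
  shows "((\<lambda>t. f (x + t *\<^sub>R axis j 1)) has_vector_derivative grad f (x + t *\<^sub>R axis j 1) $ j) (at t within U)"
proof -
  have "((\<lambda>t. x + t *\<^sub>R axis j 1) has_derivative (\<lambda>h. h *\<^sub>R axis j 1)) (at t within U)"
    by (auto intro!: derivative_eq_intros)
  from has_derivative_compose[OF this has_derivative_grad[OF assms]]
  show ?thesis by (simp add: has_vector_derivative_def inner_axis)
qed

text \<open>Differentiation under the integral over a compact box. A derivative of \<open>f\<close>
  becomes a derivative with respect to the translation of the box, so that differentiability is
  expressed by integrals, which behave well under L2 limits.\<close>

lemma box_average_derivative:
  fixes f :: "real^'d \<Rightarrow> real"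
  assumes f: "C1_on S f" and sub: "\<And>x t. x \<in> cbox a b \<Longrightarrow> t \<in> {- \<eta>..\<eta>} \<Longrightarrow> x + t *\<^sub>R axis j 1 \<in> S"
    and s: "s \<in> {- \<eta>..\<eta>}"
  shows "((\<lambda>t. integral (cbox a b) (\<lambda>x. f (x + t *\<^sub>R axis j 1))) has_vector_derivative
    integral (cbox a b) (\<lambda>x. grad f (x + s *\<^sub>R axis j 1) $ j)) (at s within {- \<eta>..\<eta>})"
proof (rule leibniz_rule_vector_derivative)
  show "((\<lambda>t. f (x + t *\<^sub>R axis j 1)) has_vector_derivative grad f (x + t *\<^sub>R axis j 1) $ j) (at t within {- \<eta>..\<eta>})"
    if "t \<in> {- \<eta>..\<eta>}" "x \<in> cbox a b" for t x
    using that f sub by (intro has_vector_derivative_line) (auto simp: C1_on_def)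
  show "(\<lambda>x. f (x + t *\<^sub>R axis j 1)) integrable_on cbox a b" if "t \<in> {- \<eta>..\<eta>}" for t
    using that sub by (intro integrable_continuous continuous_on_compose2[OF C1_onD(3)[OF f]] continuous_intros) auto
  have "continuous_on ({- \<eta>..\<eta>} \<times> cbox a b) (\<lambda>p. grad f (snd p + fst p *\<^sub>R axis j 1) $ j)"
    using sub by (intro continuous_intros continuous_on_compose2[OF C1_onD(2)[OF f]]) auto
  then show "continuous_on ({- \<eta>..\<eta>} \<times> cbox a b) (\<lambda>(t, x). grad f (x + t *\<^sub>R axis j 1) $ j)"
    by (simp add: case_prod_unfold)
qed (use s in auto)

lemma integral_cbox_shift:
  fixes f :: "real^'d \<Rightarrow> real"
  assumes "f integrable_on cbox (a + c) (b + c)"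
  shows "integral (cbox a b) (\<lambda>x. f (x + c)) = integral (cbox (a + c) (b + c)) f"
    and "(\<lambda>x. f (x + c)) integrable_on cbox a b"
proof -
  have img: "(\<lambda>x. x - c) ` cbox (a + c) (b + c) = cbox a b"
    using cbox_translation[of "- c" "a + c" "b + c"] by (simp add: add.commute)
  have "((\<lambda>x. f (1 *\<^sub>R x + c)) has_integral (1 / (\<bar>1\<bar> ^ DIM(real^'d))) *\<^sub>R integral (cbox (a + c) (b + c)) f)
      ((\<lambda>x. (1 / 1) *\<^sub>R x + - ((1 / 1) *\<^sub>R c)) ` cbox (a + c) (b + c))"
    by (rule has_integral_affinity[OF integrable_integral[OF assms]]) simp
  then have "((\<lambda>x. f (x + c)) has_integral integral (cbox (a + c) (b + c)) f) (cbox a b)"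
    by (simp add: img)
  then show "integral (cbox a b) (\<lambda>x. f (x + c)) = integral (cbox (a + c) (b + c)) f"
    "(\<lambda>x. f (x + c)) integrable_on cbox a b"
    by (auto simp: integral_unique)
qed

lemma grad_zero_off_support:
  assumes "x \<notin> closure {x. f x \<noteq> 0}" shows "grad f x = 0"
proof -
  have "\<forall>\<^sub>F y in nhds x. y \<in> - closure {x. f x \<noteq> 0}"
    using assms by (intro eventually_nhds_in_open) auto
  then have ev: "\<forall>\<^sub>F y in nhds x. 0 = f y"
  proof eventually_elim
    fix y assume "y \<in> - closure {x. f x \<noteq> 0}"
    then show "0 = f y" using closure_subset[of "{x. f x \<noteq> 0}"] by auto
  qed
  have "((\<lambda>y. 0) has_derivative (\<lambda>h. 0)) (at x)" by (rule has_derivative_const)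
  then have "(f has_derivative (\<lambda>h. 0)) (at x)"
    by (rule has_derivative_transform_eventually)
       (use ev eventually_nhds_x_imp_x[OF ev] in \<open>simp_all add: eventually_at_filter eventually_mono\<close>)
  then show ?thesis by (simp add: vec_eq_iff grad_nth)
qed

lemma integral_compact_support:
  fixes F :: "real^'d \<Rightarrow> real"
  assumes F: "continuous_on UNIV F" and K: "\<And>x. x \<notin> K \<Longrightarrow> F x = 0" and sub: "K \<subseteq> A" "K \<subseteq> cbox a b"
  shows "integral A F = integral (cbox a b) F"
proof -
  have "integral A F = integral UNIV (\<lambda>x. if x \<in> A then F x else 0)"
    by (simp add: integral_restrict_UNIV)
  also have "(\<lambda>x. if x \<in> A then F x else 0) = (\<lambda>x. if x \<in> cbox a b then F x else 0)"
    using K sub by (auto simp: fun_eq_iff)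
  also have "integral UNIV \<dots> = integral (cbox a b) F"
    by (simp add: integral_restrict_UNIV)
  finally show ?thesis .
qed

text \<open>Moving a box that contains the support does not change the integral over it, so the derivative
  of that integral along a coordinate direction vanishes.\<close>

lemma integral_grad_compact_support:
  fixes f :: "real^'d \<Rightarrow> real"
  assumes f: "C1_on UNIV f" and K: "compact (closure {x. f x \<noteq> 0})" "closure {x. f x \<noteq> 0} \<subseteq> A"
    and A: "A \<in> lmeasurable"
  shows "(\<integral>x. grad f x $ j \<partial>lebesgue_on A) = 0" "integrable (lebesgue_on A) (\<lambda>x. grad f x $ j)"
proof -
  let ?K = "closure {x. f x \<noteq> 0}"
  obtain R where R: "\<And>x. x \<in> ?K \<Longrightarrow> norm x \<le> R"
    using compact_imp_bounded[OF K(1)] by (auto simp: bounded_iff)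
  \<comment> \<open>The margin of 1 around the support leaves room for translations by
    \<open>t\<close> between -1 and 1.\<close>
  define v :: "real^'d" where "v = (\<chi> i. R + 1)"
  have inb: "x \<in> cbox (- v + t *\<^sub>R axis j 1) (v + t *\<^sub>R axis j 1)" if "x \<in> ?K" "t \<in> {- 1..1}" for x t
  proof -
    have x: "\<bar>x $ i\<bar> \<le> R" for i using R[OF that(1)] component_le_norm_cart[of x i] by linarith
    have t: "\<bar>t * axis j 1 $ i\<bar> \<le> 1" for i using that(2) by (auto simp: axis_def)
    have le: "- (R + 1) + t * axis j 1 $ i \<le> x $ i" "x $ i \<le> R + 1 + t * axis j 1 $ i" for i
      using x[of i] t[of i] by linarith+
    have "(- v + t *\<^sub>R axis j 1) $ i = - (R + 1) + t * axis j 1 $ i" "(v + t *\<^sub>R axis j 1) $ i = R + 1 + t * axis j 1 $ i" for i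
      by (simp_all add: v_def)
    then show ?thesis using le by (simp only: mem_box_cart simp_thms)
  qed
  have gK: "grad f x $ j = 0" if "x \<notin> ?K" for x using grad_zero_off_support[OF that] by simp
  have fK: "f x = 0" if "x \<notin> ?K" for x using that closure_subset[of "{x. f x \<noteq> 0}"] by auto
  have cont: "continuous_on UNIV f" "continuous_on UNIV (\<lambda>x. grad f x $ j)"
    using C1_onD[OF f] by (auto intro!: continuous_intros)
  have const: "integral (cbox (- v) v) (\<lambda>x. f (x + t *\<^sub>R axis j 1)) = integral UNIV f" if "t \<in> {- 1..1}" for t
  proof -
    have "integral (cbox (- v) v) (\<lambda>x. f (x + t *\<^sub>R axis j 1)) = integral (cbox (- v + t *\<^sub>R axis j 1) (v + t *\<^sub>R axis j 1)) f"
      using cont by (intro integral_cbox_shift integrable_continuous) (auto intro: continuous_on_subset)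
    also have "\<dots> = integral UNIV f"
    proof (rule integral_compact_support[OF cont(1) fK, symmetric])
      show "?K \<subseteq> cbox (- v + t *\<^sub>R axis j 1) (v + t *\<^sub>R axis j 1)" using inb[OF _ that] by blast
    qed simp_all
    finally show ?thesis .
  qed
  have "((\<lambda>t. integral (cbox (- v) v) (\<lambda>x. f (x + t *\<^sub>R axis j 1))) has_vector_derivative
      integral (cbox (- v) v) (\<lambda>x. grad f (x + 0 *\<^sub>R axis j 1) $ j)) (at 0 within {- 1..1})"
    by (rule box_average_derivative[OF f]) auto
  moreover have "((\<lambda>t. integral (cbox (- v) v) (\<lambda>x. f (x + t *\<^sub>R axis j 1))) has_vector_derivative 0) (at 0 within {- 1..1})"
    by (rule has_vector_derivative_transform[OF _ _ has_vector_derivative_const[of "integral UNIV f"]])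
       (use const in auto)
  ultimately have zero: "integral (cbox (- v) v) (\<lambda>x. grad f x $ j) = 0"
    using vector_derivative_unique_within_closed_interval[of "- 1" 1 0] by fastforce
  have sub: "?K \<subseteq> cbox (- v) v" using inb[of _ 0] by auto
  have "bounded ((\<lambda>x. grad f x $ j) ` A)"
  proof -
    have "bounded ((\<lambda>x. grad f x $ j) ` ?K)"
      by (intro compact_imp_bounded compact_continuous_image K continuous_on_subset[OF cont(2)]) auto
    then have "bounded (insert 0 ((\<lambda>x. grad f x $ j) ` ?K))" by simp
    then show ?thesis by (rule bounded_subset) (use gK in auto)
  qed
  then have "bounded_measurable_on A (\<lambda>x. grad f x $ j)"
    using A cont(2) by (intro bm_continuous) (auto intro: continuous_on_subset fmeasurableD)
  then show i: "integrable (lebesgue_on A) (\<lambda>x. grad f x $ j)" using A by (rule bm_integrable)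
  have "(\<integral>x. grad f x $ j \<partial>lebesgue_on A) = integral A (\<lambda>x. grad f x $ j)"
    using i A by (intro lebesgue_integral_eq_integral) (auto intro: fmeasurableD)
  also have "\<dots> = integral (cbox (- v) v) (\<lambda>x. grad f x $ j)"
    by (rule integral_compact_support[OF cont(2) gK K(2) sub])
  finally show "(\<integral>x. grad f x $ j \<partial>lebesgue_on A) = 0" using zero by simp
qed

text \<open>Boxes form an intersection-stable generator of the Borel sets, so all integrals over
  Borel sets vanish and the density is zero almost everywhere. The argument runs with a Borel
  version \<open>g\<close> of the Lebesgue measurable \<open>f\<close>.\<close>

lemma AE_zero_if_box_integrals_zero:
  fixes f :: "real^'d \<Rightarrow> real"
  assumes f: "integrable lebesgue f" and zero: "\<And>a b. integral (cbox a b) f = 0"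
  shows "AE x in lebesgue. f x = 0"
proof -
  obtain g where g: "g \<in> borel_measurable lborel" "AE x in lborel. f x = g x"
    using completion_ex_borel_measurable_real[of f lborel] f by auto
  have g_lebesgue: "AE x in lebesgue. f x = g x" using g(2) by (rule AE_completion)
  have "integrable lebesgue g"
    by (rule integrable_cong_AE_imp[OF f measurable_completion[OF g(1)]]) (use g_lebesgue in \<open>auto elim: eventually_mono\<close>)
  then have int: "integrable lborel g" using g(1) by (simp add: integrable_completion)
  have setint: "set_integrable lborel A g" if "A \<in> sets borel" for A
    using int that unfolding set_integrable_def by (intro integrable_mult_indicator) auto
  have box0: "set_lebesgue_integral lborel (box a b) g = 0" for a b
  proof -
    have "set_lebesgue_integral lborel (box a b) g = (\<integral>x. indicator (box a b) x *\<^sub>R g x \<partial>lebesgue)"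
      unfolding set_lebesgue_integral_def using g(1) by (subst integral_completion) auto
    also have "\<dots> = (\<integral>x. indicator (box a b) x *\<^sub>R f x \<partial>lebesgue)"
    proof (rule integral_cong_AE)
      show "AE x in lebesgue. indicator (box a b) x *\<^sub>R g x = indicator (box a b) x *\<^sub>R f x"
        using g_lebesgue by eventually_elim simp
      show "(\<lambda>x. indicator (box a b) x *\<^sub>R f x) \<in> borel_measurable lebesgue"
        by (intro borel_measurable_integrable integrable_mult_indicator f) auto
      show "(\<lambda>x. indicator (box a b) x *\<^sub>R g x) \<in> borel_measurable lebesgue"
        by (intro borel_measurable_integrable integrable_mult_indicator \<open>integrable lebesgue g\<close>) auto
    qed
    also have "\<dots> = (\<integral>x. f x \<partial>lebesgue_on (box a b))"
      by (subst integral_restrict_space) auto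
    also have "\<dots> = integral (box a b) f"
    proof (rule lebesgue_integral_eq_integral)
      have "integrable lebesgue (\<lambda>x. indicator (box a b) x *\<^sub>R f x)"
        by (rule integrable_mult_indicator[OF _ f]) simp
      then show "integrable (lebesgue_on (box a b)) f"
        by (subst integrable_restrict_space) (simp_all only: set_integrable_def, simp)
    qed simp
    also have "\<dots> = 0" using zero[of a b] by (simp add: integral_open_interval)
    finally show ?thesis .
  qed
  \<comment> \<open>Complements in the Dynkin system need the integral over the whole space, which
    is reached by an increasing sequence of boxes.\<close>
  have UNIV0: "set_lebesgue_integral lborel UNIV g = 0"
  proof -
    define Bn where "Bn n = box (- (real n *\<^sub>R (1::real^'d))) (real n *\<^sub>R 1)" for n
    have "(\<lambda>n. set_lebesgue_integral lborel (Bn n) g) \<longlonglongrightarrow> set_lebesgue_integral lborel (\<Union>n. Bn n) g"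
    proof (rule set_integral_cont_up)
      show "incseq Bn" by (auto simp: incseq_def Bn_def mem_box_cart intro: order_less_le_trans order_le_less_trans)
        (smt (verit) of_nat_mono)+
    qed (auto simp: Bn_def intro: setint)
    moreover have "(\<Union>n. Bn n) = UNIV"
    proof -
      have "x \<in> (\<Union>n. Bn n)" for x :: "real^'d"
      proof -
        obtain n where n: "norm x < real n" using reals_Archimedean2 by blast
        have "\<bar>x $ i\<bar> < real n" for i using component_le_norm_cart[of x i] n by linarith
        then have "x \<in> Bn n" by (auto simp: Bn_def mem_box_cart abs_less_iff minus_less_iff)
        then show ?thesis by blast
      qed
      then show ?thesis by blast
    qed
    moreover have "set_lebesgue_integral lborel (Bn n) g = 0" for n unfolding Bn_def by (rule box0)
    ultimately show ?thesis by (simp add: LIMSEQ_const_iff)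
  qed
  have borel0: "set_lebesgue_integral lborel A g = 0" if "A \<in> sets borel" for A
  proof -
    have Int: "Int_stable (range (\<lambda>(a, b). box a b :: (real^'d) set))"
      by (auto simp: Int_stable_def box_Int_box)
    have subset_Pow: "range (\<lambda>(a, b). box a b :: (real^'d) set) \<subseteq> Pow UNIV" by simp
    have "A \<in> sigma_sets UNIV (range (\<lambda>(a, b). box a b :: (real^'d) set))"
      using that unfolding borel_eq_box by simp
    then show ?thesis
    proof (induction rule: sigma_sets_induct_disjoint[OF Int subset_Pow, consumes 1, case_names basic empty compl union])
      case (compl A)
      have A: "A \<in> sets borel" using compl(1) unfolding borel_eq_box by simp
      have "set_lebesgue_integral lborel (A \<union> (UNIV - A)) g
          = set_lebesgue_integral lborel A g + set_lebesgue_integral lborel (UNIV - A) g"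
        using A by (intro set_integral_Un setint) auto
      then show ?case using compl UNIV0 by simp
    next
      case (union A)
      have A: "A i \<in> sets borel" for i using union(2) unfolding borel_eq_box by auto
      have "set_lebesgue_integral lborel (\<Union>i. A i) g = suminf (\<lambda>i. set_lebesgue_integral lborel (A i) g)"
        using A union(1) by (intro lebesgue_integral_countable_add setint) (auto simp: disjoint_family_on_def)
      then show ?case using union by simp
    qed (use box0 in \<open>auto simp: set_lebesgue_integral_def\<close>)
  qed
  have "AE x in lborel. g x = 0"
    by (rule sigma_finite_measure.density_zero[OF sigma_finite_lborel int]) (use borel0 in auto)
  then have "AE x in lebesgue. g x = 0" by (rule AE_completion)
  then show ?thesis using g_lebesgue by eventually_elim simp
qed

section \<open>Test functions and square integrable fields\<close>

lemma Ck_add: "Ck n f \<Longrightarrow> Ck n g \<Longrightarrow> Ck n (\<lambda>x. a * f x + b * g x)"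
proof (induction n arbitrary: f g)
  case 0
  then show ?case by (auto intro!: continuous_intros)
next
  case (Suc n)
  have d: "f differentiable (at x)" "g differentiable (at x)" for x using Suc.prems by auto
  have "(\<lambda>x. grad (\<lambda>x. a * f x + b * g x) x $ j) = (\<lambda>x. a * (grad f x $ j) + b * (grad g x $ j))" for j
    by (simp add: fun_eq_iff grad_lincomb[OF d])
  then show ?case using Suc by (auto intro!: d derivative_intros)
qed

lemma Ck_zero: "Ck n (\<lambda>x. 0)"
  by (induction n) simp_all

lemma test_functions_lincomb:
  assumes "f \<in> test_functions A" "g \<in> test_functions A"
  shows "(\<lambda>x. a * f x + b * g x) \<in> test_functions A"
proof -
  let ?F = "closure {x. f x \<noteq> 0}" and ?G = "closure {x. g x \<noteq> 0}" and ?S = "closure {x. a * f x + b * g x \<noteq> 0}"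
  have sub: "?S \<subseteq> ?F \<union> ?G"
    unfolding closure_Un[symmetric] by (rule closure_mono) auto
  have c: "compact (?F \<union> ?G)" using assms by (auto simp: test_functions_def intro!: compact_Un)
  have "compact ?S"
    using compact_Int_closed[OF c, of ?S] sub by (simp add: Int_absorb1)
  moreover have "?S \<subseteq> A" using sub assms by (auto simp: test_functions_def)
  ultimately show ?thesis using assms by (simp add: test_functions_def Ck_add)
qed

lemma test_functions_zero: "(\<lambda>x. 0) \<in> test_functions A"
  by (simp add: test_functions_def Ck_zero)

lemma test_functions_C1:
  assumes "f \<in> test_functions A" shows "C1_on S f"
proof -
  have "Ck (Suc 0) f" using assms by (simp add: test_functions_def del: Ck.simps)
  then have d: "\<And>x. f differentiable (at x)" and c: "\<And>j. continuous_on UNIV (\<lambda>x. grad f x $ j)" by auto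
  have "continuous_on UNIV (grad f)"
    using continuous_on_vec_lambda[of UNIV "\<lambda>j x. grad f x $ j"] c by (simp add: vec_lambda_eta)
  then show ?thesis using d by (auto simp: C1_on_def intro: continuous_on_subset)
qed

lemma L2_real_iff: "(f :: real^'d \<Rightarrow> real) \<in> L2 A \<longleftrightarrow> square_integrable (lebesgue_on A) f"
  by (simp add: L2_def square_integrable_def)

text \<open>The estimate (s + t)^2 \<le> 2 s^2 + 2 t^2 stands in for the triangle inequality of the
  L2 norm; for sequences tending to zero the loss of a constant is harmless.\<close>

lemma L2_lincomb:
  fixes f g :: "real^'d \<Rightarrow> 'b::euclidean_space"
  assumes f: "f \<in> L2 A" and g: "g \<in> L2 A"
  shows "(\<lambda>x. a *\<^sub>R f x + b *\<^sub>R g x) \<in> L2 A"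
    and "(L2_norm_on A (\<lambda>x. a *\<^sub>R f x + b *\<^sub>R g x))\<^sup>2 \<le> 2 * a\<^sup>2 * (L2_norm_on A f)\<^sup>2 + 2 * b\<^sup>2 * (L2_norm_on A g)\<^sup>2"
proof -
  have le: "(norm (a *\<^sub>R f x + b *\<^sub>R g x))\<^sup>2 \<le> 2 * a\<^sup>2 * (norm (f x))\<^sup>2 + 2 * b\<^sup>2 * (norm (g x))\<^sup>2" for x
  proof -
    have "norm (a *\<^sub>R f x + b *\<^sub>R g x) \<le> \<bar>a\<bar> * norm (f x) + \<bar>b\<bar> * norm (g x)"
      using norm_triangle_ineq[of "a *\<^sub>R f x" "b *\<^sub>R g x"] by simp
    then have "(norm (a *\<^sub>R f x + b *\<^sub>R g x))\<^sup>2 \<le> (\<bar>a\<bar> * norm (f x) + \<bar>b\<bar> * norm (g x))\<^sup>2"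
      by (rule power_mono) simp
    also have "\<dots> \<le> 2 * (\<bar>a\<bar> * norm (f x))\<^sup>2 + 2 * (\<bar>b\<bar> * norm (g x))\<^sup>2"
      using zero_le_power2[of "\<bar>a\<bar> * norm (f x) - \<bar>b\<bar> * norm (g x)"]
      unfolding power2_sum power2_diff by linarith
    finally show ?thesis by (simp add: power_mult_distrib)
  qed
  have m: "f \<in> borel_measurable (lebesgue_on A)" "g \<in> borel_measurable (lebesgue_on A)"
    and i: "integrable (lebesgue_on A) (\<lambda>x. 2 * a\<^sup>2 * (norm (f x))\<^sup>2 + 2 * b\<^sup>2 * (norm (g x))\<^sup>2)"
    using f g by (auto simp: L2_def)
  have m': "(\<lambda>x. a *\<^sub>R f x + b *\<^sub>R g x) \<in> borel_measurable (lebesgue_on A)" using m by simp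
  have i': "integrable (lebesgue_on A) (\<lambda>x. (norm (a *\<^sub>R f x + b *\<^sub>R g x))\<^sup>2)"
    by (rule Bochner_Integration.integrable_bound[OF i])
       (use m' le in \<open>auto intro!: AE_I2 simp: abs_of_nonneg\<close>)
  then show "(\<lambda>x. a *\<^sub>R f x + b *\<^sub>R g x) \<in> L2 A" using m' by (simp add: L2_def)
  have "(\<integral>x. (norm (a *\<^sub>R f x + b *\<^sub>R g x))\<^sup>2 \<partial>lebesgue_on A)
      \<le> (\<integral>x. 2 * a\<^sup>2 * (norm (f x))\<^sup>2 + 2 * b\<^sup>2 * (norm (g x))\<^sup>2 \<partial>lebesgue_on A)"
    by (rule integral_mono[OF i' i le])
  then show "(L2_norm_on A (\<lambda>x. a *\<^sub>R f x + b *\<^sub>R g x))\<^sup>2 \<le> 2 * a\<^sup>2 * (L2_norm_on A f)\<^sup>2 + 2 * b\<^sup>2 * (L2_norm_on A g)\<^sup>2"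
    using f g by (simp add: L2_norm_on_def L2_def)
qed

lemma L2_norm_lincomb_tendsto:
  fixes f g :: "nat \<Rightarrow> real^'d \<Rightarrow> 'b::euclidean_space"
  assumes "\<And>n. f n \<in> L2 A" "\<And>n. g n \<in> L2 A"
    and "(\<lambda>n. L2_norm_on A (f n)) \<longlonglongrightarrow> 0" "(\<lambda>n. L2_norm_on A (g n)) \<longlonglongrightarrow> 0"
  shows "(\<lambda>n. L2_norm_on A (\<lambda>x. a *\<^sub>R f n x + b *\<^sub>R g n x)) \<longlonglongrightarrow> 0"
proof -
  have "(\<lambda>n. 2 * a\<^sup>2 * (L2_norm_on A (f n))\<^sup>2 + 2 * b\<^sup>2 * (L2_norm_on A (g n))\<^sup>2) \<longlonglongrightarrow> 2 * a\<^sup>2 * 0\<^sup>2 + 2 * b\<^sup>2 * 0\<^sup>2"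
    by (intro tendsto_intros assms)
  then have lim: "(\<lambda>n. 2 * a\<^sup>2 * (L2_norm_on A (f n))\<^sup>2 + 2 * b\<^sup>2 * (L2_norm_on A (g n))\<^sup>2) \<longlonglongrightarrow> 0" by simp
  have "norm ((L2_norm_on A (\<lambda>x. a *\<^sub>R f n x + b *\<^sub>R g n x))\<^sup>2)
      \<le> 2 * a\<^sup>2 * (L2_norm_on A (f n))\<^sup>2 + 2 * b\<^sup>2 * (L2_norm_on A (g n))\<^sup>2" for n
    using L2_lincomb(2)[OF assms(1,2)] by simp
  then have "(\<lambda>n. (L2_norm_on A (\<lambda>x. a *\<^sub>R f n x + b *\<^sub>R g n x))\<^sup>2) \<longlonglongrightarrow> 0"
    using lim by (rule Lim_null_comparison[OF always_eventually[OF allI]])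
  from tendsto_real_sqrt[OF this] show ?thesis by (simp add: L2_norm_on_def)
qed

lemma L2_component:
  fixes g :: "real^'d \<Rightarrow> real^'n"
  assumes "g \<in> L2 A"
  shows "square_integrable (lebesgue_on A) (\<lambda>x. g x $ j)"
    and "(\<integral>x. (g x $ j)\<^sup>2 \<partial>lebesgue_on A) \<le> (L2_norm_on A g)\<^sup>2"
proof -
  have m: "g \<in> borel_measurable (lebesgue_on A)" and i: "integrable (lebesgue_on A) (\<lambda>x. (norm (g x))\<^sup>2)"
    using assms by (auto simp: L2_def)
  have m': "(\<lambda>x. g x $ j) \<in> borel_measurable (lebesgue_on A)"
    by (rule borel_measurable_continuous_on[OF linear_continuous_on[OF bounded_linear_vec_nth] m])
  have le: "(g x $ j)\<^sup>2 \<le> (norm (g x))\<^sup>2" for x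
    using component_le_norm_cart[of "g x" j] by (simp add: abs_le_square_iff[symmetric])
  have i': "integrable (lebesgue_on A) (\<lambda>x. (g x $ j)\<^sup>2)"
    by (rule Bochner_Integration.integrable_bound[OF i]) (use m' le in \<open>auto intro!: AE_I2\<close>)
  then show "square_integrable (lebesgue_on A) (\<lambda>x. g x $ j)" using m' by (simp add: square_integrable_def)
  show "(\<integral>x. (g x $ j)\<^sup>2 \<partial>lebesgue_on A) \<le> (L2_norm_on A g)\<^sup>2"
    using integral_mono[OF i' i le] by (simp add: L2_norm_on_def)
qed

lemma bm_L2:
  fixes g :: "real^'d \<Rightarrow> 'b::euclidean_space"
  assumes "bounded_measurable_on A g" "A \<in> lmeasurable"
  shows "g \<in> L2 A"
  using bm_integrable[OF bm_inner[OF assms(1,1)] assms(2)] assms(1)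
  by (simp add: L2_def bounded_measurable_on_def power2_norm_eq_inner)

section \<open>The space H1_0 on a bounded open set\<close>

locale bounded_open_set =
  fixes \<Omega> :: "(real^'d) set"
  assumes open_domain: "open \<Omega>" and bounded_domain: "bounded \<Omega>"
begin

lemma lmeasurable_domain: "\<Omega> \<in> lmeasurable"
  by (rule lmeasurable_open[OF bounded_domain open_domain])

lemma sets_domain: "\<Omega> \<in> sets lebesgue"
  using lmeasurable_domain by (rule fmeasurableD)

lemma bm_continuous_on_closure:
  assumes "continuous_on (closure \<Omega>) f"
  shows "bounded_measurable_on \<Omega> f"
proof -
  have "compact (closure \<Omega>)" using bounded_domain by simp
  then have "bounded (f ` closure \<Omega>)" using assms by (intro compact_imp_bounded compact_continuous_image)
  then have "bounded (f ` \<Omega>)" by (rule bounded_subset) (use closure_subset in blast)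
  then show ?thesis
    using continuous_on_subset[OF assms closure_subset] sets_domain by (intro bm_continuous)
qed

lemma bm_C1:
  assumes "C1_on UNIV f"
  shows "bounded_measurable_on \<Omega> f" "bounded_measurable_on \<Omega> (grad f)"
  using C1_onD(2,3)[OF assms] by (auto intro!: bm_continuous_on_closure intro: continuous_on_subset)

lemma square_integrable_bm:
  "bounded_measurable_on \<Omega> (f :: real^'d \<Rightarrow> real) \<Longrightarrow> square_integrable (lebesgue_on \<Omega>) f"
  by (rule bm_square_integrable[OF _ lmeasurable_domain])

lemma H1_0I:
  assumes "u \<in> L2 \<Omega>" "weak_gradient \<Omega> u g" "\<And>n. \<phi> n \<in> test_functions \<Omega>"
    "(\<lambda>n. L2_norm_on \<Omega> (\<lambda>x. u x - \<phi> n x)) \<longlonglongrightarrow> 0" "(\<lambda>n. L2_norm_on \<Omega> (\<lambda>x. g x - grad (\<phi> n) x)) \<longlonglongrightarrow> 0"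
  shows "u \<in> H1_0 \<Omega>"
  unfolding H1_0_def mem_Collect_eq using assms by (intro conjI exI[of _ g] exI[of _ \<phi>] allI)

text \<open>Weak gradients and approximating sequences are combined with the same coefficients. This
  is what makes the velocity space a linear space.\<close>

lemma H1_0_lincomb:
  assumes u: "u \<in> H1_0 \<Omega>" and v: "v \<in> H1_0 \<Omega>"
  shows "(\<lambda>x. a * u x + b * v x) \<in> H1_0 \<Omega>"
proof -
  obtain g \<phi> where g: "u \<in> L2 \<Omega>" "weak_gradient \<Omega> u g" "\<And>n. \<phi> n \<in> test_functions \<Omega>"
      "(\<lambda>n. L2_norm_on \<Omega> (\<lambda>x. u x - \<phi> n x)) \<longlonglongrightarrow> 0" "(\<lambda>n. L2_norm_on \<Omega> (\<lambda>x. g x - grad (\<phi> n) x)) \<longlonglongrightarrow> 0"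
    using u by (auto simp: H1_0_def)
  obtain h \<psi> where h: "v \<in> L2 \<Omega>" "weak_gradient \<Omega> v h" "\<And>n. \<psi> n \<in> test_functions \<Omega>"
      "(\<lambda>n. L2_norm_on \<Omega> (\<lambda>x. v x - \<psi> n x)) \<longlonglongrightarrow> 0" "(\<lambda>n. L2_norm_on \<Omega> (\<lambda>x. h x - grad (\<psi> n) x)) \<longlonglongrightarrow> 0"
    using v by (auto simp: H1_0_def)
  have gL: "g \<in> L2 \<Omega>" and hL: "h \<in> L2 \<Omega>" using g(2) h(2) by (auto simp: weak_gradient_def)
  let ?w = "\<lambda>x. a * u x + b * v x" and ?k = "\<lambda>x. a *\<^sub>R g x + b *\<^sub>R h x" and ?\<chi> = "\<lambda>n x. a * \<phi> n x + b * \<psi> n x"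
  have bm: "bounded_measurable_on \<Omega> f" "bounded_measurable_on \<Omega> (grad f)" if "f \<in> test_functions \<Omega>" for f
    using bm_C1[OF test_functions_C1[OF that]] by auto
  have wL: "?w \<in> L2 \<Omega>" using L2_lincomb(1)[OF g(1) h(1)] by simp
  have "weak_gradient \<Omega> ?w ?k"
    unfolding weak_gradient_def
  proof (intro conjI ballI allI)
    show "?k \<in> L2 \<Omega>" by (rule L2_lincomb(1)[OF gL hL])
    fix f j assume f: "f \<in> test_functions \<Omega>"
    have i: "integrable (lebesgue_on \<Omega>) (\<lambda>x. u x * grad f x $ j)" "integrable (lebesgue_on \<Omega>) (\<lambda>x. v x * grad f x $ j)"
      using g(1) h(1) by (auto intro!: square_integrable_mult_integrable square_integrable_bm bm_vec_nth bm[OF f] simp: L2_real_iff)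
    have k: "integrable (lebesgue_on \<Omega>) (\<lambda>x. g x $ j * f x)" "integrable (lebesgue_on \<Omega>) (\<lambda>x. h x $ j * f x)"
      by (intro square_integrable_mult_integrable square_integrable_bm bm[OF f] L2_component gL hL)+
    have e: "(\<integral>x. u x * grad f x $ j \<partial>lebesgue_on \<Omega>) = - (\<integral>x. g x $ j * f x \<partial>lebesgue_on \<Omega>)"
      "(\<integral>x. v x * grad f x $ j \<partial>lebesgue_on \<Omega>) = - (\<integral>x. h x $ j * f x \<partial>lebesgue_on \<Omega>)"
      using g(2) h(2) f by (auto simp: weak_gradient_def)
    have "(\<integral>x. ?w x * grad f x $ j \<partial>lebesgue_on \<Omega>) = (\<integral>x. a * (u x * grad f x $ j) + b * (v x * grad f x $ j) \<partial>lebesgue_on \<Omega>)"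
      by (rule Bochner_Integration.integral_cong) (simp_all add: algebra_simps)
    also have "\<dots> = a * (\<integral>x. u x * grad f x $ j \<partial>lebesgue_on \<Omega>) + b * (\<integral>x. v x * grad f x $ j \<partial>lebesgue_on \<Omega>)"
      using i by simp
    also have "\<dots> = - (a * (\<integral>x. g x $ j * f x \<partial>lebesgue_on \<Omega>) + b * (\<integral>x. h x $ j * f x \<partial>lebesgue_on \<Omega>))"
      unfolding e by simp
    also have "a * (\<integral>x. g x $ j * f x \<partial>lebesgue_on \<Omega>) + b * (\<integral>x. h x $ j * f x \<partial>lebesgue_on \<Omega>)
        = (\<integral>x. a * (g x $ j * f x) + b * (h x $ j * f x) \<partial>lebesgue_on \<Omega>)"
      using k by simp
    also have "\<dots> = (\<integral>x. ?k x $ j * f x \<partial>lebesgue_on \<Omega>)"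
      by (rule Bochner_Integration.integral_cong) (simp_all add: algebra_simps)
    finally show "(\<integral>x. ?w x * grad f x $ j \<partial>lebesgue_on \<Omega>) = - (\<integral>x. ?k x $ j * f x \<partial>lebesgue_on \<Omega>)" .
  qed
  moreover have "?\<chi> n \<in> test_functions \<Omega>" for n by (rule test_functions_lincomb[OF g(3) h(3)])
  moreover have "(\<lambda>n. L2_norm_on \<Omega> (\<lambda>x. ?w x - ?\<chi> n x)) \<longlonglongrightarrow> 0"
  proof -
    have d: "(\<lambda>x. u x - \<phi> n x) \<in> L2 \<Omega>" "(\<lambda>x. v x - \<psi> n x) \<in> L2 \<Omega>" for n
      using g(1) h(1) square_integrable_bm[OF bm(1)[OF g(3)]] square_integrable_bm[OF bm(1)[OF h(3)]]
      by (simp_all add: L2_real_iff square_integrable_diff)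
    have "(\<lambda>x. a *\<^sub>R (u x - \<phi> n x) + b *\<^sub>R (v x - \<psi> n x)) = (\<lambda>x. ?w x - ?\<chi> n x)" for n
      by (simp add: fun_eq_iff algebra_simps)
    then show ?thesis using L2_norm_lincomb_tendsto[OF d g(4) h(4), of a b] by simp
  qed
  moreover have "(\<lambda>n. L2_norm_on \<Omega> (\<lambda>x. ?k x - grad (?\<chi> n) x)) \<longlonglongrightarrow> 0"
  proof -
    have d: "(\<lambda>x. g x - grad (\<phi> n) x) \<in> L2 \<Omega>" "(\<lambda>x. h x - grad (\<psi> n) x) \<in> L2 \<Omega>" for n
      using L2_lincomb(1)[OF gL bm_L2[OF bm(2)[OF g(3)] lmeasurable_domain], of 1 "-1"]
        L2_lincomb(1)[OF hL bm_L2[OF bm(2)[OF h(3)] lmeasurable_domain], of 1 "-1"] by simp_all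
    have diff: "f differentiable (at x)" if "f \<in> test_functions \<Omega>" for f x
      using C1_onD(1)[OF test_functions_C1[OF that, of UNIV]] by simp
    have "(\<lambda>x. a *\<^sub>R (g x - grad (\<phi> n) x) + b *\<^sub>R (h x - grad (\<psi> n) x)) = (\<lambda>x. ?k x - grad (?\<chi> n) x)" for n
      by (simp add: fun_eq_iff grad_lincomb diff g(3) h(3) algebra_simps)
    then show ?thesis using L2_norm_lincomb_tendsto[OF d g(5) h(5), of a b] by simp
  qed
  ultimately show ?thesis by (rule H1_0I[OF wL, of ?k ?\<chi>])
qed

lemma H1_0_zero: "(\<lambda>x. 0) \<in> H1_0 \<Omega>"
proof -
  have z: "(\<lambda>x. 0) \<in> L2 \<Omega>" "(\<lambda>x. 0 :: real^'d) \<in> L2 \<Omega>" by (simp_all add: L2_def)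
  then have "weak_gradient \<Omega> (\<lambda>x. 0) (\<lambda>x. 0)" by (simp add: weak_gradient_def)
  moreover have "(\<lambda>n. L2_norm_on \<Omega> (\<lambda>x. 0 - (\<lambda>n x. 0) n x)) \<longlonglongrightarrow> 0"
    "(\<lambda>n. L2_norm_on \<Omega> (\<lambda>x. (0 :: real^'d) - grad ((\<lambda>n x. 0) n) x)) \<longlonglongrightarrow> 0"
    by (simp_all add: L2_norm_on_def)
  ultimately show ?thesis
    unfolding H1_0_def mem_Collect_eq
    by (intro conjI z exI[of _ "\<lambda>x. 0 :: real^'d"] exI[of _ "\<lambda>n x. 0 :: real"] allI test_functions_zero) auto
qed

text \<open>The gradient is kept as the L2 limit of gradients of test functions, component by
  component; identities for test functions are then carried over by limits of integrals.\<close>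

lemma H1_0_approximation:
  assumes "u \<in> H1_0 \<Omega>"
  obtains g \<phi> where "square_integrable (lebesgue_on \<Omega>) u" "\<And>j. square_integrable (lebesgue_on \<Omega>) (\<lambda>x. g x $ j)"
    "\<And>n. \<phi> n \<in> test_functions \<Omega>" "(\<lambda>n. \<integral>x. (\<phi> n x - u x)\<^sup>2 \<partial>lebesgue_on \<Omega>) \<longlonglongrightarrow> 0"
    "\<And>j. (\<lambda>n. \<integral>x. (grad (\<phi> n) x $ j - g x $ j)\<^sup>2 \<partial>lebesgue_on \<Omega>) \<longlonglongrightarrow> 0"
proof -
  obtain g \<phi> where g: "u \<in> L2 \<Omega>" "weak_gradient \<Omega> u g" "\<And>n. \<phi> n \<in> test_functions \<Omega>"
      "(\<lambda>n. L2_norm_on \<Omega> (\<lambda>x. u x - \<phi> n x)) \<longlonglongrightarrow> 0" "(\<lambda>n. L2_norm_on \<Omega> (\<lambda>x. g x - grad (\<phi> n) x)) \<longlonglongrightarrow> 0"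
    using assms by (auto simp: H1_0_def)
  have gL: "g \<in> L2 \<Omega>" using g(2) by (simp add: weak_gradient_def)
  have "(\<lambda>n. (L2_norm_on \<Omega> (\<lambda>x. u x - \<phi> n x))\<^sup>2) \<longlonglongrightarrow> 0" using tendsto_power[OF g(4), of 2] by simp
  then have 1: "(\<lambda>n. \<integral>x. (\<phi> n x - u x)\<^sup>2 \<partial>lebesgue_on \<Omega>) \<longlonglongrightarrow> 0"
    by (simp add: L2_norm_on_def power2_commute)
  have 2: "(\<lambda>n. \<integral>x. (grad (\<phi> n) x $ j - g x $ j)\<^sup>2 \<partial>lebesgue_on \<Omega>) \<longlonglongrightarrow> 0" for j
  proof -
    have d: "(\<lambda>x. g x - grad (\<phi> n) x) \<in> L2 \<Omega>" for n
      using L2_lincomb(1)[OF gL bm_L2[OF bm_C1(2)[OF test_functions_C1[OF g(3)]] lmeasurable_domain], of 1 "-1"] by simp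
    have "norm (\<integral>x. (grad (\<phi> n) x $ j - g x $ j)\<^sup>2 \<partial>lebesgue_on \<Omega>) \<le> (L2_norm_on \<Omega> (\<lambda>x. g x - grad (\<phi> n) x))\<^sup>2" for n
      using L2_component(2)[OF d[of n], of j] by (simp add: power2_commute)
    moreover have "(\<lambda>n. (L2_norm_on \<Omega> (\<lambda>x. g x - grad (\<phi> n) x))\<^sup>2) \<longlonglongrightarrow> 0" using tendsto_power[OF g(5), of 2] by simp
    ultimately show ?thesis by (rule Lim_null_comparison[OF always_eventually[OF allI]])
  qed
  show ?thesis
    using that[of g \<phi>] g(1,3) 1 2 L2_component(1)[OF gL] by (simp add: L2_real_iff)
qed


section \<open>Weak gradients versus classical gradients\<close>

text \<open>Cauchy-Schwarz against the constant 1, which is square integrable because the domain is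
  bounded.\<close>

lemma tendsto_integral_abs:
  assumes f: "\<And>n. square_integrable (lebesgue_on \<Omega>) (f n)"
    and lim: "(\<lambda>n. \<integral>x. (f n x)\<^sup>2 \<partial>lebesgue_on \<Omega>) \<longlonglongrightarrow> 0"
  shows "(\<lambda>n. \<integral>x. \<bar>f n x\<bar> \<partial>lebesgue_on \<Omega>) \<longlonglongrightarrow> 0"
proof -
  have one: "square_integrable (lebesgue_on \<Omega>) (\<lambda>x. 1)" by (intro square_integrable_bm bm_const)
  have abs: "square_integrable (lebesgue_on \<Omega>) (\<lambda>x. \<bar>f n x\<bar>)" for n
    using f[of n] by (auto simp: square_integrable_def)
  have "norm (\<integral>x. \<bar>f n x\<bar> \<partial>lebesgue_on \<Omega>) \<le> sqrt (\<integral>x. (f n x)\<^sup>2 \<partial>lebesgue_on \<Omega>) * sqrt (\<integral>x. 1 \<partial>lebesgue_on \<Omega>)" for n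
    using Cauchy_Schwarz_integral(2)[of "\<lambda>x. \<bar>f n x\<bar>" "lebesgue_on \<Omega>" "\<lambda>x. 1"] abs[of n] one
    by (simp add: square_integrable_def)
  moreover have "(\<lambda>n. sqrt (\<integral>x. (f n x)\<^sup>2 \<partial>lebesgue_on \<Omega>) * sqrt (\<integral>x. 1 \<partial>lebesgue_on \<Omega>)) \<longlonglongrightarrow> 0"
    using tendsto_mult_left_zero[OF tendsto_real_sqrt[OF lim, simplified]] .
  ultimately show ?thesis by (rule Lim_null_comparison[OF always_eventually[OF allI]])
qed

lemma square_integrable_absolutely_integrable:
  assumes "square_integrable (lebesgue_on \<Omega>) f"
  shows "f absolutely_integrable_on \<Omega>"
proof -
  have one: "square_integrable (lebesgue_on \<Omega>) (\<lambda>x. 1)" by (intro square_integrable_bm bm_const)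
  have "integrable (lebesgue_on \<Omega>) (\<lambda>x. f x * 1)" by (rule square_integrable_mult_integrable[OF assms one])
  then show ?thesis
    by (simp add: absolutely_integrable_measurable_real[OF sets_domain] borel_measurable_integrable)
qed

text \<open>The bound is the same for all boxes in the domain, so convergence of box averages is
  uniform over all translates that stay inside.\<close>

lemma integral_subbox_le:
  assumes f: "square_integrable (lebesgue_on \<Omega>) f" and sub: "cbox a b \<subseteq> \<Omega>"
  shows "\<bar>integral (cbox a b) f\<bar> \<le> (\<integral>x. \<bar>f x\<bar> \<partial>lebesgue_on \<Omega>)"
proof -
  have ai: "f absolutely_integrable_on \<Omega>" by (rule square_integrable_absolutely_integrable[OF f])
  have "f absolutely_integrable_on cbox a b" by (rule absolutely_integrable_on_subcbox[OF ai sub])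
  then have "norm (integral (cbox a b) f) \<le> integral (cbox a b) (\<lambda>x. \<bar>f x\<bar>)"
    by (intro integral_norm_bound_integral) (auto simp: absolutely_integrable_on_def)
  also have "\<dots> \<le> integral \<Omega> (\<lambda>x. \<bar>f x\<bar>)"
    using \<open>f absolutely_integrable_on cbox a b\<close> ai sub by (intro integral_subset_le) (auto simp: absolutely_integrable_on_def)
  also have "\<dots> = (\<integral>x. \<bar>f x\<bar> \<partial>lebesgue_on \<Omega>)"
    using absolutely_integrable_imp_integrable[OF ai sets_domain]
    by (intro lebesgue_integral_eq_integral[symmetric] sets_domain) auto
  finally show ?thesis by simp
qed

text \<open>Both box averages of the approximations and of their derivatives converge, uniformly under
  translation of the box; differentiating the limit with respect to the translation identifies the
  two gradients.\<close>

lemma box_integral_weak_gradient: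
  assumes U: "open U" "U \<subseteq> \<Omega>" "C1_on U u"
    and u: "square_integrable (lebesgue_on \<Omega>) u" "\<And>j. square_integrable (lebesgue_on \<Omega>) (\<lambda>x. g x $ j)"
    and \<phi>: "\<And>n. \<phi> n \<in> test_functions \<Omega>" "(\<lambda>n. \<integral>x. (\<phi> n x - u x)\<^sup>2 \<partial>lebesgue_on \<Omega>) \<longlonglongrightarrow> 0"
      "\<And>j. (\<lambda>n. \<integral>x. (grad (\<phi> n) x $ j - g x $ j)\<^sup>2 \<partial>lebesgue_on \<Omega>) \<longlonglongrightarrow> 0"
    and ab: "cbox a b \<subseteq> U"
  shows "integral (cbox a b) (\<lambda>x. g x $ j) = integral (cbox a b) (\<lambda>x. grad u x $ j)"
proof (cases "cbox a b = {}")
  case False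
  \<comment> \<open>A compact box in the open set \<open>U\<close> keeps a positive distance from
    the complement, so all translates by at most \<eta> remain in \<open>U\<close>.\<close>
  obtain \<eta> where \<eta>: "0 < \<eta>" "{x. infdist x (cbox a b) \<le> \<eta>} \<subseteq> U"
    using compact_in_open_separated[OF False compact_cbox U(1) ab] by blast
  have inO: "x + t *\<^sub>R axis j 1 \<in> U" if "x \<in> cbox a b" "t \<in> {- \<eta>..\<eta>}" for x t
  proof -
    have "infdist (x + t *\<^sub>R axis j 1) (cbox a b) \<le> dist (x + t *\<^sub>R axis j 1) x"
      by (rule infdist_le[OF that(1)])
    also have "\<dots> \<le> \<eta>" using that(2) by (simp add: dist_norm abs_le_iff)
    finally show ?thesis using \<eta>(2) by blast
  qed
  let ?e = "axis j 1 :: real^'d"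
  have shifted: "cbox (a + t *\<^sub>R ?e) (b + t *\<^sub>R ?e) \<subseteq> \<Omega>" if "t \<in> {- \<eta>..\<eta>}" for t
  proof
    fix y assume "y \<in> cbox (a + t *\<^sub>R ?e) (b + t *\<^sub>R ?e)"
    then have "y - t *\<^sub>R ?e \<in> cbox a b"
      by (auto simp: mem_box algebra_simps)
    from inO[OF this that] show "y \<in> \<Omega>" using U(2) by auto
  qed
  have shift_le: "\<bar>integral (cbox a b) (\<lambda>x. f (x + t *\<^sub>R ?e)) - integral (cbox a b) (\<lambda>x. k (x + t *\<^sub>R ?e))\<bar>
      \<le> (\<integral>x. \<bar>f x - k x\<bar> \<partial>lebesgue_on \<Omega>)"
    if f: "square_integrable (lebesgue_on \<Omega>) f" and k: "square_integrable (lebesgue_on \<Omega>) k" and t: "t \<in> {- \<eta>..\<eta>}" for f k t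
  proof -
    have i: "f integrable_on cbox (a + t *\<^sub>R ?e) (b + t *\<^sub>R ?e)" "k integrable_on cbox (a + t *\<^sub>R ?e) (b + t *\<^sub>R ?e)"
      using absolutely_integrable_on_subcbox[OF square_integrable_absolutely_integrable[OF f] shifted[OF t]]
        absolutely_integrable_on_subcbox[OF square_integrable_absolutely_integrable[OF k] shifted[OF t]]
      by (auto simp: absolutely_integrable_on_def)
    show ?thesis
      using integral_subbox_le[OF square_integrable_diff[OF f k] shifted[OF t]]
      by (simp add: integral_cbox_shift(1)[OF i(1)] integral_cbox_shift(1)[OF i(2)] integral_diff i)
  qed
  have sq: "square_integrable (lebesgue_on \<Omega>) (\<phi> n)" "square_integrable (lebesgue_on \<Omega>) (\<lambda>x. grad (\<phi> n) x $ j)" for n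
    using bm_C1[OF test_functions_C1[OF \<phi>(1)[of n]]] by (auto intro!: square_integrable_bm bm_vec_nth)
  define G where "G n t = integral (cbox a b) (\<lambda>x. \<phi> n (x + t *\<^sub>R ?e))" for n t
  define H where "H t = integral (cbox a b) (\<lambda>x. g (x + t *\<^sub>R ?e) $ j)" for t
  let ?I = "{- \<eta>..\<eta>}"
  define Hn where "Hn n t = integral (cbox a b) (\<lambda>x. grad (\<phi> n) (x + t *\<^sub>R ?e) $ j)" for n t
  \<comment> \<open>Termwise differentiation of a sequence: the parameter derivatives converge
    uniformly in \<open>t\<close>, since \<open>shift_le\<close> bounds the error by one integral
    over the whole domain, and for the values convergence at \<open>t = 0\<close> is enough.\<close>
  have "\<exists>\<Gamma>. \<forall>t\<in>?I. (\<lambda>n. G n t) \<longlonglongrightarrow> \<Gamma> t \<and> (\<Gamma> has_derivative (\<lambda>h. h * H t)) (at t within ?I)"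
  proof (rule has_derivative_sequence)
    show "(G n has_derivative (\<lambda>h. h * Hn n t)) (at t within ?I)" if "t \<in> ?I" for n t
      using box_average_derivative[OF test_functions_C1[OF \<phi>(1), of UNIV] _ that, of a b j n]
      unfolding G_def Hn_def has_vector_derivative_def by simp
    have d: "(\<lambda>n. \<integral>x. \<bar>grad (\<phi> n) x $ j - g x $ j\<bar> \<partial>lebesgue_on \<Omega>) \<longlonglongrightarrow> 0"
      by (rule tendsto_integral_abs[OF square_integrable_diff[OF sq(2) u(2)] \<phi>(3)])
    show "\<forall>\<^sub>F n in sequentially. \<forall>t\<in>?I. \<forall>h. norm (h * Hn n t - h * H t) \<le> e * norm h" if "0 < e" for e
    proof -
      have "\<forall>\<^sub>F n in sequentially. (\<integral>x. \<bar>grad (\<phi> n) x $ j - g x $ j\<bar> \<partial>lebesgue_on \<Omega>) < e"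
        using order_tendstoD(2)[OF d that] .
      then show ?thesis
      proof eventually_elim
        fix n assume n: "(\<integral>x. \<bar>grad (\<phi> n) x $ j - g x $ j\<bar> \<partial>lebesgue_on \<Omega>) < e"
        show "\<forall>t\<in>?I. \<forall>h. norm (h * Hn n t - h * H t) \<le> e * norm h"
        proof (intro ballI allI)
          fix t h assume t: "t \<in> ?I"
          have "\<bar>Hn n t - H t\<bar> \<le> e"
            using shift_le[OF sq(2)[of n] u(2)[of j] t] n unfolding Hn_def H_def by linarith
          then have "\<bar>h\<bar> * \<bar>Hn n t - H t\<bar> \<le> \<bar>h\<bar> * e" by (intro mult_left_mono) auto
          then show "norm (h * Hn n t - h * H t) \<le> e * norm h"
            by (simp add: abs_mult mult.commute flip: right_diff_distrib)
        qed
      qed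
    qed
    have "(\<lambda>n. G n 0) \<longlonglongrightarrow> integral (cbox a b) (\<lambda>x. u (x + 0 *\<^sub>R ?e))"
    proof (rule LIM_zero_cancel, rule Lim_null_comparison[OF always_eventually[OF allI]])
      show "norm (G n 0 - integral (cbox a b) (\<lambda>x. u (x + 0 *\<^sub>R ?e))) \<le> (\<integral>x. \<bar>\<phi> n x - u x\<bar> \<partial>lebesgue_on \<Omega>)" for n
        using shift_le[OF sq(1)[of n] u(1), of 0] \<eta>(1) by (simp add: G_def)
      show "(\<lambda>n. \<integral>x. \<bar>\<phi> n x - u x\<bar> \<partial>lebesgue_on \<Omega>) \<longlonglongrightarrow> 0"
        by (rule tendsto_integral_abs[OF square_integrable_diff[OF sq(1) u(1)] \<phi>(2)])
    qed
    then show "(\<lambda>n. G n 0) \<longlonglongrightarrow> integral (cbox a b) (\<lambda>x. u (x + 0 *\<^sub>R ?e))" .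
  qed (use \<eta>(1) in auto)
  then obtain \<Gamma> where \<Gamma>: "\<And>t. t \<in> ?I \<Longrightarrow> (\<lambda>n. G n t) \<longlonglongrightarrow> \<Gamma> t"
    "\<And>t. t \<in> ?I \<Longrightarrow> (\<Gamma> has_derivative (\<lambda>h. h * H t)) (at t within ?I)" by blast
  have \<Gamma>_eq: "\<Gamma> t = integral (cbox a b) (\<lambda>x. u (x + t *\<^sub>R ?e))" if t: "t \<in> ?I" for t
  proof (rule LIMSEQ_unique[OF \<Gamma>(1)[OF t]])
    show "(\<lambda>n. G n t) \<longlonglongrightarrow> integral (cbox a b) (\<lambda>x. u (x + t *\<^sub>R ?e))"
    proof (rule LIM_zero_cancel, rule Lim_null_comparison[OF always_eventually[OF allI]])
      show "norm (G n t - integral (cbox a b) (\<lambda>x. u (x + t *\<^sub>R ?e))) \<le> (\<integral>x. \<bar>\<phi> n x - u x\<bar> \<partial>lebesgue_on \<Omega>)" for n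
        using shift_le[OF sq(1)[of n] u(1) t] by (simp add: G_def)
      show "(\<lambda>n. \<integral>x. \<bar>\<phi> n x - u x\<bar> \<partial>lebesgue_on \<Omega>) \<longlonglongrightarrow> 0"
        by (rule tendsto_integral_abs[OF square_integrable_diff[OF sq(1) u(1)] \<phi>(2)])
    qed
  qed
  have z: "0 \<in> ?I" using \<eta>(1) by simp
  have D1: "(\<Gamma> has_vector_derivative integral (cbox a b) (\<lambda>x. grad u (x + 0 *\<^sub>R ?e) $ j)) (at 0 within ?I)"
    by (rule has_vector_derivative_transform[OF z \<Gamma>_eq box_average_derivative[OF U(3) inO z]])
  have D2: "(\<Gamma> has_vector_derivative H 0) (at 0 within ?I)"
    using \<Gamma>(2)[OF z] by (simp add: has_vector_derivative_def)
  have "integral (cbox a b) (\<lambda>x. grad u (x + 0 *\<^sub>R ?e) $ j) = H 0"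
    by (rule vector_derivative_unique_within_closed_interval[of "- \<eta>" \<eta> 0 \<Gamma>, unfolded box_real, OF _ z D1 D2])
       (use \<eta>(1) in simp)
  then show ?thesis by (simp add: H_def)
qed simp

text \<open>On a box inside \<open>U\<close> the difference of the two gradients has vanishing
  integrals over all subboxes, hence it is zero almost everywhere there. Countably many such boxes
  cover \<open>U\<close>.\<close>

lemma AE_weak_gradient:
  assumes U: "open U" "U \<subseteq> \<Omega>" "C1_on U u"
    and u: "square_integrable (lebesgue_on \<Omega>) u" "\<And>j. square_integrable (lebesgue_on \<Omega>) (\<lambda>x. g x $ j)"
    and \<phi>: "\<And>n. \<phi> n \<in> test_functions \<Omega>" "(\<lambda>n. \<integral>x. (\<phi> n x - u x)\<^sup>2 \<partial>lebesgue_on \<Omega>) \<longlonglongrightarrow> 0"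
      "\<And>j. (\<lambda>n. \<integral>x. (grad (\<phi> n) x $ j - g x $ j)\<^sup>2 \<partial>lebesgue_on \<Omega>) \<longlonglongrightarrow> 0"
  shows "AE x in lebesgue. x \<in> U \<longrightarrow> g x $ j = grad u x $ j"
proof -
  have box: "AE x in lebesgue. x \<in> cbox p q \<longrightarrow> g x $ j = grad u x $ j" if pq: "cbox p q \<subseteq> U" for p q
  proof -
    \<comment> \<open>Extension by zero turns the integral over any box into the one over its
      intersection with \<open>cbox p q\<close>, which is again a box.\<close>
    let ?f = "\<lambda>x. if x \<in> cbox p q then g x $ j - grad u x $ j else 0"
    have ai: "(\<lambda>x. g x $ j) absolutely_integrable_on cbox p q"
      by (rule absolutely_integrable_on_subcbox[OF square_integrable_absolutely_integrable[OF u(2)]]) (use pq U(2) in blast)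
    have ai': "(\<lambda>x. grad u x $ j) absolutely_integrable_on cbox p q"
      by (intro absolutely_integrable_continuous continuous_intros continuous_on_subset[OF C1_onD(2)[OF U(3)] pq])
    have aid: "(\<lambda>x. g x $ j - grad u x $ j) absolutely_integrable_on cbox p q"
      by (rule set_integral_diff(1)[OF ai ai'])
    have "AE x in lebesgue. ?f x = 0"
    proof (rule AE_zero_if_box_integrals_zero)
      have "(\<lambda>x. indicator (cbox p q) x *\<^sub>R (g x $ j - grad u x $ j)) = ?f" by (auto simp: fun_eq_iff)
      then show "integrable lebesgue ?f" using aid by (simp add: set_integrable_def)
      fix a b
      obtain c d where cd: "cbox a b \<inter> cbox p q = cbox c d" by (rule that[OF Int_interval])
      have sub: "cbox c d \<subseteq> cbox p q" using cd by blast
      have "integral (cbox a b) ?f = integral (cbox a b \<inter> cbox p q) (\<lambda>x. g x $ j - grad u x $ j)"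
        by (simp only: integral_restrict_Int Int_commute)
      also have "\<dots> = integral (cbox c d) (\<lambda>x. g x $ j) - integral (cbox c d) (\<lambda>x. grad u x $ j)"
        unfolding cd
        using absolutely_integrable_on_subcbox[OF ai sub] absolutely_integrable_on_subcbox[OF ai' sub]
        by (intro integral_diff) (auto simp: absolutely_integrable_on_def)
      also have "\<dots> = 0"
        using box_integral_weak_gradient[OF U u \<phi>, of c d j] sub pq by auto
      finally show "integral (cbox a b) ?f = 0" .
    qed
    then show ?thesis by eventually_elim (auto split: if_splits)
  qed
  obtain D where D: "countable D" "D \<subseteq> Pow U" "\<And>X. X \<in> D \<Longrightarrow> \<exists>a b. X = cbox a b" "\<Union> D = U"
    using open_countable_Union_open_cbox[OF U(1)] by metis
  have "AE x in lebesgue. \<forall>X\<in>D. x \<in> X \<longrightarrow> g x $ j = grad u x $ j"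
    unfolding AE_ball_countable[OF D(1)]
  proof
    fix X assume "X \<in> D"
    then obtain a b where "X = cbox a b" "cbox a b \<subseteq> U" using D(2,3) by blast
    then show "AE x in lebesgue. x \<in> X \<longrightarrow> g x $ j = grad u x $ j" using box by simp
  qed
  then show ?thesis by eventually_elim (use D(4) in blast)
qed

section \<open>Integration by parts with zero boundary values\<close>

text \<open>For a test function \<psi> the derivative of \<open>\<psi> * \<psi> * f\<close> has
  integral zero by compact support, whatever \<open>f\<close> does at the boundary. The resulting
  identity is quadratic in \<psi> and its gradient with coefficients bounded on the domain, so it
  persists under L2 limits.\<close>

lemma integral_square_by_parts:
  assumes u: "square_integrable (lebesgue_on \<Omega>) u" "\<And>j. square_integrable (lebesgue_on \<Omega>) (\<lambda>x. g x $ j)"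
    and \<psi>: "\<And>n. \<psi> n \<in> test_functions \<Omega>" "(\<lambda>n. \<integral>x. (\<psi> n x - u x)\<^sup>2 \<partial>lebesgue_on \<Omega>) \<longlonglongrightarrow> 0"
      "\<And>j. (\<lambda>n. \<integral>x. (grad (\<psi> n) x $ j - g x $ j)\<^sup>2 \<partial>lebesgue_on \<Omega>) \<longlonglongrightarrow> 0"
    and f: "C1_on UNIV f"
  shows "(\<integral>x. u x * u x * grad f x $ j \<partial>lebesgue_on \<Omega>) = - 2 * (\<integral>x. u x * g x $ j * f x \<partial>lebesgue_on \<Omega>)"
proof -
  have bf: "bounded_measurable_on \<Omega> f" "bounded_measurable_on \<Omega> (\<lambda>x. grad f x $ j)"
    using bm_C1[OF f] by (auto intro: bm_vec_nth)
  have b\<psi>: "bounded_measurable_on \<Omega> (\<psi> n)" "bounded_measurable_on \<Omega> (\<lambda>x. grad (\<psi> n) x $ j)" for n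
    using bm_C1[OF test_functions_C1[OF \<psi>(1)]] by (auto intro: bm_vec_nth)
  obtain C where C: "\<And>x. x \<in> \<Omega> \<Longrightarrow> \<bar>f x\<bar> \<le> C" using bounded_measurable_onD(2)[OF bf(1)] by auto
  obtain C' where C': "\<And>x. x \<in> \<Omega> \<Longrightarrow> \<bar>grad f x $ j\<bar> \<le> C'" using bounded_measurable_onD(2)[OF bf(2)] by auto
  have eq: "(\<integral>x. \<psi> n x * \<psi> n x * grad f x $ j \<partial>lebesgue_on \<Omega>) = - 2 * (\<integral>x. \<psi> n x * grad (\<psi> n) x $ j * f x \<partial>lebesgue_on \<Omega>)" for n
  proof -
    let ?F = "\<lambda>x. \<psi> n x * \<psi> n x * f x"
    have C1: "C1_on UNIV (\<psi> n)" by (rule test_functions_C1[OF \<psi>(1)])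
    have sub: "closure {x. ?F x \<noteq> 0} \<subseteq> closure {x. \<psi> n x \<noteq> 0}" by (rule closure_mono) auto
    have comp: "compact (closure {x. \<psi> n x \<noteq> 0})" "closure {x. \<psi> n x \<noteq> 0} \<subseteq> \<Omega>"
      using \<psi>(1)[of n] by (auto simp: test_functions_def)
    have "compact (closure {x. ?F x \<noteq> 0})"
      using compact_Int_closed[OF comp(1) closed_closure, of "{x. ?F x \<noteq> 0}"] sub by (simp add: Int_absorb1)
    then have "(\<integral>x. grad ?F x $ j \<partial>lebesgue_on \<Omega>) = 0"
      using sub comp(2) by (intro integral_grad_compact_support(1) C1_on_mult C1 f lmeasurable_domain) auto
    moreover have "grad ?F x $ j = \<psi> n x * \<psi> n x * grad f x $ j + 2 * (\<psi> n x * grad (\<psi> n) x $ j * f x)" for x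
    proof -
      have d: "\<psi> n differentiable (at x)" "f differentiable (at x)" using C1_onD(1)[OF C1] C1_onD(1)[OF f] by auto
      have "grad ?F x = (\<psi> n x * \<psi> n x) *\<^sub>R grad f x + f x *\<^sub>R (\<psi> n x *\<^sub>R grad (\<psi> n) x + \<psi> n x *\<^sub>R grad (\<psi> n) x)"
        using grad_mult[OF differentiable_mult[OF d(1) d(1)] d(2)] grad_mult[OF d(1) d(1)] by simp
      then show ?thesis by (simp add: algebra_simps)
    qed
    moreover have "integrable (lebesgue_on \<Omega>) (\<lambda>x. \<psi> n x * \<psi> n x * grad f x $ j)"
      "integrable (lebesgue_on \<Omega>) (\<lambda>x. \<psi> n x * grad (\<psi> n) x $ j * f x)"
      by (intro bm_integrable[OF _ lmeasurable_domain] bm_mult b\<psi> bf)+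
    ultimately show ?thesis by simp
  qed
  have sq: "square_integrable (lebesgue_on \<Omega>) (\<psi> n)" "square_integrable (lebesgue_on \<Omega>) (\<lambda>x. grad (\<psi> n) x $ j)" for n
    by (intro square_integrable_bm b\<psi>)+
  have m: "f \<in> borel_measurable (lebesgue_on \<Omega>)" "(\<lambda>x. grad f x $ j) \<in> borel_measurable (lebesgue_on \<Omega>)"
    using bf by (simp_all only: bounded_measurable_on_def)
  have "(\<lambda>n. \<integral>x. \<psi> n x * \<psi> n x * grad f x $ j \<partial>lebesgue_on \<Omega>) \<longlonglongrightarrow> (\<integral>x. u x * u x * grad f x $ j \<partial>lebesgue_on \<Omega>)"
    by (rule tendsto_integral_mult_bounded[OF sq(1) u(1) \<psi>(2) sq(1) u(1) \<psi>(2) m(2)]) (use C' in simp)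
  moreover have "(\<lambda>n. \<integral>x. \<psi> n x * grad (\<psi> n) x $ j * f x \<partial>lebesgue_on \<Omega>) \<longlonglongrightarrow> (\<integral>x. u x * g x $ j * f x \<partial>lebesgue_on \<Omega>)"
    by (rule tendsto_integral_mult_bounded[OF sq(1) u(1) \<psi>(2) sq(2) u(2) \<psi>(3) m(1)]) (use C in simp)
  then have "(\<lambda>n. - 2 * (\<integral>x. \<psi> n x * grad (\<psi> n) x $ j * f x \<partial>lebesgue_on \<Omega>)) \<longlonglongrightarrow> - 2 * (\<integral>x. u x * g x $ j * f x \<partial>lebesgue_on \<Omega>)"
    by (rule tendsto_mult_left)
  ultimately show ?thesis unfolding eq by (rule LIMSEQ_unique)
qed

end

text \<open>A nonempty open set is never negligible, so the open set of points with nonzero value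
  must be empty.\<close>

lemma continuous_AE_zero:
  fixes f :: "real^'d \<Rightarrow> 'b::real_normed_vector"
  assumes S: "open S" "continuous_on S f" and ae: "AE x in lebesgue. x \<in> S \<longrightarrow> f x = 0" and x: "x \<in> S"
  shows "f x = 0"
proof (rule ccontr)
  assume nz: "f x \<noteq> 0"
  have "open (S \<inter> f -` (- {0}))" by (rule continuous_open_preimage[OF S(2,1)]) auto
  moreover have "negligible (S \<inter> f -` (- {0}))"
  proof -
    obtain N where "N \<in> null_sets lebesgue" "{x \<in> space lebesgue. \<not> (x \<in> S \<longrightarrow> f x = 0)} \<subseteq> N"
      using ae by (rule AE_E3) auto
    then have "negligible N" "S \<inter> f -` (- {0}) \<subseteq> N" by (auto simp: negligible_iff_null_sets)
    then show ?thesis by (rule negligible_subset)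
  qed
  ultimately have "S \<inter> f -` (- {0}) = {}" using open_not_negligible by blast
  then show False using nz x by auto
qed

context bounded_open_set
begin

text \<open>The multiplier \<open>z\<close> is reached by a second limit: the test functions
  approximating it are admissible C1 multipliers while \<open>u\<close> stays fixed. Boundedness of
  \<open>u\<close> puts \<open>u * u\<close> and its product with the weak derivative into L2, so L2
  convergence of the multipliers suffices. Weak gradients are replaced by classical ones at the
  end.\<close>

lemma integral_square_by_parts_grad:
  assumes U: "open U" "U \<subseteq> \<Omega>" "negligible (\<Omega> - U)"
    and u: "u \<in> H1_0 \<Omega>" "C1_on U u" "bounded_measurable_on \<Omega> u" "bounded_measurable_on U (\<lambda>x. grad u x $ j)"
    and z: "z \<in> H1_0 \<Omega>" "C1_on U z" "bounded_measurable_on \<Omega> z" "bounded_measurable_on U (\<lambda>x. grad z x $ j)"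
  shows "(\<integral>x. u x * u x * grad z x $ j \<partial>lebesgue_on U) = - 2 * (\<integral>x. u x * grad u x $ j * z x \<partial>lebesgue_on U)"
proof -
  obtain g \<phi> where g: "square_integrable (lebesgue_on \<Omega>) u" "\<And>j. square_integrable (lebesgue_on \<Omega>) (\<lambda>x. g x $ j)"
    and \<phi>: "\<And>n. \<phi> n \<in> test_functions \<Omega>" "(\<lambda>n. \<integral>x. (\<phi> n x - u x)\<^sup>2 \<partial>lebesgue_on \<Omega>) \<longlonglongrightarrow> 0"
    "\<And>j. (\<lambda>n. \<integral>x. (grad (\<phi> n) x $ j - g x $ j)\<^sup>2 \<partial>lebesgue_on \<Omega>) \<longlonglongrightarrow> 0"
    using H1_0_approximation[OF u(1)] by blast
  obtain h \<psi> where h: "square_integrable (lebesgue_on \<Omega>) z" "\<And>j. square_integrable (lebesgue_on \<Omega>) (\<lambda>x. h x $ j)"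
    and \<psi>: "\<And>n. \<psi> n \<in> test_functions \<Omega>" "(\<lambda>n. \<integral>x. (\<psi> n x - z x)\<^sup>2 \<partial>lebesgue_on \<Omega>) \<longlonglongrightarrow> 0"
    "\<And>j. (\<lambda>n. \<integral>x. (grad (\<psi> n) x $ j - h x $ j)\<^sup>2 \<partial>lebesgue_on \<Omega>) \<longlonglongrightarrow> 0"
    using H1_0_approximation[OF z(1)] by blast
  have ug: "square_integrable (lebesgue_on \<Omega>) (\<lambda>x. g x $ j * u x)"
  proof -
    obtain C where C: "\<And>x. x \<in> \<Omega> \<Longrightarrow> \<bar>u x\<bar> \<le> C" using bounded_measurable_onD(2)[OF u(3)] by auto
    show ?thesis
      by (rule square_integrable_mult_bounded(1)[OF g(2) bounded_measurable_onD(1)[OF u(3)], of C]) (use C in simp)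
  qed
  have uu: "square_integrable (lebesgue_on \<Omega>) (\<lambda>x. u x * u x)" by (intro square_integrable_bm bm_mult u(3))
  have sq: "square_integrable (lebesgue_on \<Omega>) (\<psi> n)" "square_integrable (lebesgue_on \<Omega>) (\<lambda>x. grad (\<psi> n) x $ j)" for n
    using bm_C1[OF test_functions_C1[OF \<psi>(1)[of n]]] by (auto intro!: square_integrable_bm bm_vec_nth)
  have const: "(\<lambda>n::nat. \<integral>x. (f x - f x)\<^sup>2 \<partial>lebesgue_on \<Omega>) \<longlonglongrightarrow> 0" for f :: "real^'d \<Rightarrow> real" by simp
  have "(\<lambda>n. \<integral>x. u x * u x * grad (\<psi> n) x $ j \<partial>lebesgue_on \<Omega>) \<longlonglongrightarrow> (\<integral>x. u x * u x * h x $ j \<partial>lebesgue_on \<Omega>)"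
    by (rule tendsto_integral_mult[OF uu uu const sq(2) h(2) \<psi>(3)])
  moreover have "(\<lambda>n. \<integral>x. (g x $ j * u x) * \<psi> n x \<partial>lebesgue_on \<Omega>) \<longlonglongrightarrow> (\<integral>x. (g x $ j * u x) * z x \<partial>lebesgue_on \<Omega>)"
    by (rule tendsto_integral_mult[OF ug ug const sq(1) h(1) \<psi>(2)])
  then have "(\<lambda>n. - 2 * (\<integral>x. (g x $ j * u x) * \<psi> n x \<partial>lebesgue_on \<Omega>)) \<longlonglongrightarrow> - 2 * (\<integral>x. (g x $ j * u x) * z x \<partial>lebesgue_on \<Omega>)"
    by (rule tendsto_mult_left)
  moreover have "(\<integral>x. u x * u x * grad (\<psi> n) x $ j \<partial>lebesgue_on \<Omega>) = - 2 * (\<integral>x. (g x $ j * u x) * \<psi> n x \<partial>lebesgue_on \<Omega>)" for n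
    using integral_square_by_parts[OF g \<phi> test_functions_C1[OF \<psi>(1)[of n]], of j] by (simp add: mult.commute)
  ultimately have "(\<integral>x. u x * u x * h x $ j \<partial>lebesgue_on \<Omega>) = - 2 * (\<integral>x. (g x $ j * u x) * z x \<partial>lebesgue_on \<Omega>)"
    by (simp add: LIMSEQ_unique)
  moreover have U_lebesgue: "U \<in> sets lebesgue" using U(1) by simp
  have restrict: "(\<integral>x. f x \<partial>lebesgue_on \<Omega>) = (\<integral>x. f x \<partial>lebesgue_on U)" for f :: "real^'d \<Rightarrow> real"
    using integral_lebesgue_on_Int_negligible[OF sets_domain U_lebesgue U(3), of f] U(2) by (simp add: Int_absorb1)
  ultimately have eq: "(\<integral>x. u x * u x * h x $ j \<partial>lebesgue_on U) = - 2 * (\<integral>x. (g x $ j * u x) * z x \<partial>lebesgue_on U)"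
    unfolding restrict by blast
  have ae: "AE x in lebesgue_on U. g x $ j = grad u x $ j" "AE x in lebesgue_on U. h x $ j = grad z x $ j"
    using AE_weak_gradient[OF U(1,2) u(2) g \<phi>, of j] AE_weak_gradient[OF U(1,2) z(2) h \<psi>, of j] U_lebesgue
    by (simp_all add: AE_restrict_space_iff)
  have m: "u \<in> borel_measurable (lebesgue_on U)" "z \<in> borel_measurable (lebesgue_on U)"
    "(\<lambda>x. grad u x $ j) \<in> borel_measurable (lebesgue_on U)" "(\<lambda>x. grad z x $ j) \<in> borel_measurable (lebesgue_on U)"
    using bm_subset[OF u(3) U(2)] bm_subset[OF z(3) U(2)] u(4) z(4) bounded_measurable_onD(1) by blast+
  have m': "(\<lambda>x. g x $ j) \<in> borel_measurable (lebesgue_on U)" "(\<lambda>x. h x $ j) \<in> borel_measurable (lebesgue_on U)"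
    using g(2)[of j] h(2)[of j] by (auto simp: square_integrable_def intro: measurable_restrict_mono[OF _ U(2)])
  have "(\<integral>x. u x * u x * h x $ j \<partial>lebesgue_on U) = (\<integral>x. u x * u x * grad z x $ j \<partial>lebesgue_on U)"
    by (rule integral_cong_AE) (use ae(2) m m' in \<open>auto elim: eventually_mono\<close>)
  moreover have "(\<integral>x. (g x $ j * u x) * z x \<partial>lebesgue_on U) = (\<integral>x. u x * grad u x $ j * z x \<partial>lebesgue_on U)"
    by (rule integral_cong_AE) (use ae(1) m m' in \<open>auto elim: eventually_mono\<close>)
  ultimately show ?thesis using eq by simp
qed

text \<open>The coordinate \<open>x $ j\<close> serves as multiplier, its derivative in direction
  \<open>j\<close> being 1: the integral of u^2 becomes a multiple of an integral that contains
  \<partial>_j u. This is the Poincare argument in one direction.\<close>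

lemma H1_0_zero_if_partial_derivative_zero:
  assumes U: "open U" "U \<subseteq> \<Omega>" "negligible (\<Omega> - U)"
    and u: "u \<in> H1_0 \<Omega>" "C1_on U u" "continuous_on \<Omega> u" and zero: "\<And>x. x \<in> U \<Longrightarrow> grad u x $ j = 0" and x: "x \<in> \<Omega>"
  shows "u x = 0"
proof -
  obtain g \<phi> where g: "square_integrable (lebesgue_on \<Omega>) u" "\<And>j. square_integrable (lebesgue_on \<Omega>) (\<lambda>x. g x $ j)"
    and \<phi>: "\<And>n. \<phi> n \<in> test_functions \<Omega>" "(\<lambda>n. \<integral>x. (\<phi> n x - u x)\<^sup>2 \<partial>lebesgue_on \<Omega>) \<longlonglongrightarrow> 0"
    "\<And>j. (\<lambda>n. \<integral>x. (grad (\<phi> n) x $ j - g x $ j)\<^sup>2 \<partial>lebesgue_on \<Omega>) \<longlonglongrightarrow> 0"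
    using H1_0_approximation[OF u(1)] by blast
  have U_lebesgue: "U \<in> sets lebesgue" using U(1) by simp
  have restrict: "(\<integral>x. f x \<partial>lebesgue_on \<Omega>) = (\<integral>x. f x \<partial>lebesgue_on U)" for f :: "real^'d \<Rightarrow> real"
    using integral_lebesgue_on_Int_negligible[OF sets_domain U_lebesgue U(3), of f] U(2) by (simp add: Int_absorb1)
  have "(\<integral>x. u x * u x * grad (\<lambda>x. x $ j) x $ j \<partial>lebesgue_on \<Omega>) = - 2 * (\<integral>x. u x * g x $ j * x $ j \<partial>lebesgue_on \<Omega>)"
    by (rule integral_square_by_parts[OF g \<phi> C1_on_coordinate])
  moreover have "(\<integral>x. u x * g x $ j * x $ j \<partial>lebesgue_on U) = 0"
  proof (rule integral_eq_zero_AE)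
    have "AE x in lebesgue_on U. g x $ j = grad u x $ j"
      using AE_weak_gradient[OF U(1,2) u(2) g \<phi>, of j] U_lebesgue by (simp add: AE_restrict_space_iff)
    moreover have "AE x in lebesgue_on U. grad u x $ j = 0" by (intro AE_I2) (simp add: zero)
    ultimately show "AE x in lebesgue_on U. u x * g x $ j * x $ j = 0" by eventually_elim simp
  qed
  ultimately have "(\<integral>x. (u x)\<^sup>2 \<partial>lebesgue_on \<Omega>) = 0"
    by (simp add: restrict grad_coordinate power2_eq_square)
  then have "AE x in lebesgue_on \<Omega>. (u x)\<^sup>2 = 0"
    using g(1) by (subst (asm) integral_nonneg_eq_0_iff_AE) (auto simp: square_integrable_def)
  then have "AE x in lebesgue. x \<in> \<Omega> \<longrightarrow> u x = 0"
    using sets_domain by (simp add: AE_restrict_space_iff)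
  then show ?thesis by (rule continuous_AE_zero[OF open_domain u(3) _ x])
qed

end

section \<open>Geometry of the cells\<close>

lemma C1_on_const: "C1_on S (\<lambda>x. c)"
  by (simp add: C1_on_def)

lemma C1_on_power: "C1_on S f \<Longrightarrow> C1_on S (\<lambda>x. f x ^ n)"
  by (induction n) (auto intro: C1_on_const C1_on_mult)

lemma C1_on_prod: "finite I \<Longrightarrow> (\<And>i. i \<in> I \<Longrightarrow> C1_on S (f i)) \<Longrightarrow> C1_on S (\<lambda>x. \<Prod>i\<in>I. f i x)"
proof (induction rule: finite_induct)
  case (insert i I)
  then show ?case using C1_on_mult[of S "f i" "\<lambda>x. \<Prod>i\<in>I. f i x"] by simp
qed (simp add: C1_on_const)

lemma C1_on_sum_scale: "(\<And>i. i \<in> I \<Longrightarrow> C1_on S (f i)) \<Longrightarrow> C1_on S (\<lambda>x. \<Sum>i\<in>I. a i * f i x)"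
proof (induction I rule: infinite_finite_induct)
  case (insert i I)
  then show ?case using C1_on_lincomb[of S "f i" "\<lambda>x. \<Sum>i\<in>I. a i * f i x" "a i" 1] by simp
qed (simp_all add: C1_on_const)

lemma C1_on_monomial: "C1_on S (monomial \<alpha>)"
proof -
  have "C1_on S (\<lambda>x. \<Prod>i\<in>UNIV. x $ i ^ \<alpha> i)"
    by (intro C1_on_prod C1_on_power C1_on_coordinate) simp
  then show ?thesis by (simp add: monomial_def[abs_def])
qed

lemma C1_on_poly_P: "p \<in> poly_P k \<Longrightarrow> C1_on S p"
  by (auto simp: poly_P_def intro!: C1_on_sum_scale C1_on_monomial)

lemma C1_on_poly_Q: "p \<in> poly_Q k \<Longrightarrow> C1_on S p"
  by (auto simp: poly_Q_def intro!: C1_on_sum_scale C1_on_monomial)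

lemma C1_on_ref_poly: "p \<in> ref_poly s k \<Longrightarrow> C1_on S p"
  by (cases s) (auto intro: C1_on_poly_P C1_on_poly_Q)

section \<open>Reference cells, inverse Jacobians and transformed gradients\<close>

lemma compact_ref_cell: "compact (ref_cell s)" and convex_ref_cell: "convex (ref_cell s)"
  by (cases s; simp add: compact_convex_hull finite_imp_compact)+

lemma compact_cell_ref: "compact (cell_ref K)" and convex_cell_ref: "convex (cell_ref K)"
  unfolding cell_ref_def by (rule compact_ref_cell convex_ref_cell)+

lemma continuous_on_det [continuous_intros]:
  fixes A :: "'a::topological_space \<Rightarrow> real^'n^'n"
  assumes "\<And>i j. continuous_on S (\<lambda>x. A x $ i $ j)"
  shows "continuous_on S (\<lambda>x. det (A x))"
  unfolding det_def by (intro continuous_intros assms)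

text \<open>Cramer's formula for the inverse of a nonsingular \<open>A\<close> applied to
  \<open>b\<close>. As a quotient of determinants it depends continuously on the entries of
  \<open>A\<close>.\<close>

definition solve :: "real^'n^'n \<Rightarrow> real^'n \<Rightarrow> real^'n" where
  "solve A b = (\<chi> k. det (\<chi> i j. if j = k then b $ i else A $ i $ j) / det A)"

lemma matrix_mult_solve: "det A \<noteq> 0 \<Longrightarrow> A *v solve A b = b"
  using cramer[of A "solve A b" b] by (simp add: solve_def)

lemma jac_has_derivative:
  fixes F :: "real^'d \<Rightarrow> real^'d"
  assumes "\<And>i. (\<lambda>y. F y $ i) differentiable (at x)"
  shows "(F has_derivative (\<lambda>h. jac F x *v h)) (at x)"
proof -
  have "((\<lambda>y. \<chi> i. F y $ i) has_derivative (\<lambda>h. \<chi> i. grad (\<lambda>y. F y $ i) x \<bullet> h)) (at x)"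
  proof (subst has_derivative_componentwise_within, safe)
    fix b :: "real^'d" assume "b \<in> Basis"
    then obtain i where b: "b = axis i 1" by (auto simp: Basis_vec_def)
    show "((\<lambda>y. (\<chi> i. F y $ i) \<bullet> b) has_derivative (\<lambda>h. (\<chi> i. grad (\<lambda>y. F y $ i) x \<bullet> h) \<bullet> b)) (at x)"
      unfolding b by (simp add: inner_axis has_derivative_grad[OF assms])
  qed
  moreover have "(\<lambda>h. \<chi> i. grad (\<lambda>y. F y $ i) x \<bullet> h) = (\<lambda>h. jac F x *v h)"
    by (simp add: fun_eq_iff jac_def matrix_vector_mult_def inner_vec_def vec_eq_iff)
  ultimately show ?thesis by simp
qed

text \<open>The image of the open reference cell, not the interior of the region: here the inverse
  of the cell map is available and differentiable, and openness follows from invariance of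
  domain.\<close>

definition inner_cell :: "'d::finite cell \<Rightarrow> (real^'d) set" where
  "inner_cell K = cell_map K ` interior (cell_ref K)"

locale cell =
  fixes K :: "'d::finite cell"
  assumes valid: "valid_cell K"
begin

lemma C1_component: "C1_on S (\<lambda>x. cell_map K x $ j)"
  using valid by (auto simp: valid_cell_def intro: C1_on_ref_poly)

lemma cell_map_derivative: "(cell_map K has_derivative (\<lambda>h. jac (cell_map K) x *v h)) (at x)"
  by (rule jac_has_derivative) (use C1_onD(1)[OF C1_component[of UNIV]] in simp)

lemma continuous_cell_map: "continuous_on S (cell_map K)"
  using cell_map_derivative by (meson continuous_at_imp_continuous_on has_derivative_continuous)

lemma inj_cell_map: "inj_on (cell_map K) (cell_ref K)"
  using valid by (simp add: valid_cell_def)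

lemma open_inner_cell: "open (inner_cell K)"
  unfolding inner_cell_def
  by (rule invariance_of_domain[OF continuous_cell_map open_interior inj_on_subset[OF inj_cell_map interior_subset]])

lemma compact_region: "compact (region K)"
  unfolding region_def by (rule compact_continuous_image[OF continuous_cell_map compact_cell_ref])

text \<open>The boundary of the convex reference cell is a null set, and a differentiable map
  between spaces of equal dimension preserves null sets.\<close>

lemma negligible_region_diff: "negligible (region K - inner_cell K)"
proof (rule negligible_subset)
  have "cell_map K differentiable_on frontier (cell_ref K)"
    using cell_map_derivative by (auto simp: differentiable_on_def differentiable_def intro: has_derivative_at_withinI)
  then show "negligible (cell_map K ` frontier (cell_ref K))"
    by (rule negligible_differentiable_image_negligible[OF order_refl negligible_convex_frontier[OF convex_cell_ref]])
  show "region K - inner_cell K \<subseteq> cell_map K ` frontier (cell_ref K)"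
    using closure_subset by (auto simp: region_def inner_cell_def frontier_def)
qed

text \<open>The inverse transpose of the Jacobian applied to the gradient of \<open>p\<close>: by
  the chain rule the gradient of \<open>p\<close> composed with the inverse cell map, written at the
  reference point.\<close>

definition pulled_grad :: "(real^'d \<Rightarrow> real) \<Rightarrow> real^'d \<Rightarrow> real^'d" where
  "pulled_grad p x = (\<chi> j. grad p x \<bullet> solve (jac (cell_map K) x) (axis j 1))"

text \<open>The Jacobian is nonsingular up to the boundary of the reference cell, so the transformed
  gradient is continuous on a compact set. This is the source of all bounds on gradients of finite
  element functions.\<close>

lemma continuous_pulled_grad:
  assumes p: "C1_on UNIV p"
  shows "continuous_on (cell_ref K) (pulled_grad p)"
proof -
  have F: "continuous_on (cell_ref K) (\<lambda>x. jac (cell_map K) x $ i $ j)" for i j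
    unfolding jac_def vec_lambda_beta by (intro continuous_intros C1_onD(2)[OF C1_component])
  have nz: "\<forall>x\<in>cell_ref K. det (jac (cell_map K) x) \<noteq> 0" using valid by (simp add: valid_cell_def)
  have "continuous_on (cell_ref K) (\<lambda>x. solve (jac (cell_map K) x) b)" for b
    unfolding solve_def
  proof (intro continuous_on_vec_lambda continuous_on_divide continuous_on_det F nz)
    fix k i j
    show "continuous_on (cell_ref K) (\<lambda>x. (\<chi> i j. if j = k then b $ i else jac (cell_map K) x $ i $ j) $ i $ j)"
      using F[of i j] by (cases "j = k") simp_all
  qed
  then show ?thesis
    unfolding pulled_grad_def
    by (intro continuous_on_vec_lambda continuous_on_inner continuous_on_subset[OF C1_onD(2)[OF p]]) auto
qed

text \<open>If the cell map is not affine, \<open>w\<close> itself need not be a polynomial, but it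
  is \<open>p\<close> composed with the inverse map, and its gradient takes values of
  \<open>pulled_grad p\<close>.\<close>

lemma inner_cell_gradient:
  assumes w: "\<And>x. x \<in> cell_ref K \<Longrightarrow> w (cell_map K x) = p x" and p: "C1_on UNIV p"
  shows "C1_on (inner_cell K) w" and "bounded (grad w ` inner_cell K)"
proof -
  let ?F = "cell_map K" and ?R = "cell_ref K"
  define G where "G = inv_into (interior ?R) ?F"
  have inj: "inj_on ?F (interior ?R)" by (rule inj_on_subset[OF inj_cell_map interior_subset])
  have GF: "G (?F x) = x" if "x \<in> interior ?R" for x
    unfolding G_def by (rule inv_into_f_f[OF inj that])
  have G_in: "G y \<in> interior ?R" "?F (G y) = y" if "y \<in> inner_cell K" for y
    using that unfolding inner_cell_def G_def by (auto intro: inv_into_into f_inv_into_f)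
  \<comment> \<open>For an injective map on an open set a right inverse of the derivative is enough
    to differentiate the inverse map; Cramer's formula provides it.\<close>
  have dG: "(G has_derivative (\<lambda>h. solve (jac ?F x) h)) (at (?F x))" if x: "x \<in> interior ?R" for x
  proof (rule Brouwer_Fixpoint.has_derivative_inverse_on[where f="?F" and g=G and S="interior ?R" and x=x
        and f'="\<lambda>x h. jac ?F x *v h" and g'="\<lambda>x h. solve (jac ?F x) h"])
    show "(?F has_derivative (\<lambda>h. jac ?F x *v h)) (at x)" for x by (rule cell_map_derivative)
    have "det (jac ?F x) \<noteq> 0" using valid x interior_subset by (auto simp: valid_cell_def)
    then show "(\<lambda>h. jac ?F x *v h) \<circ> (\<lambda>h. solve (jac ?F x) h) = id"
      by (simp add: fun_eq_iff matrix_mult_solve)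
  qed (use GF x in simp_all)
  have dw: "(w has_derivative (\<lambda>h. grad p x \<bullet> solve (jac ?F x) h)) (at (?F x))" if x: "x \<in> interior ?R" for x
  proof (rule has_derivative_transform_within_open[OF _ open_inner_cell])
    have "(p has_derivative (\<lambda>h. grad p x \<bullet> h)) (at (G (?F x)))"
      unfolding GF[OF x] by (rule has_derivative_grad) (use C1_onD(1)[OF p] in simp)
    from has_derivative_compose[OF dG[OF x] this]
    show "((\<lambda>y. p (G y)) has_derivative (\<lambda>h. grad p x \<bullet> solve (jac ?F x) h)) (at (?F x))" .
    show "?F x \<in> inner_cell K" using x by (auto simp: inner_cell_def)
    show "p (G y) = w y" if "y \<in> inner_cell K" for y
      using w[of "G y"] G_in[OF that] interior_subset by (metis subsetD)
  qed
  have gw: "grad w y = pulled_grad p (G y)" if "y \<in> inner_cell K" for y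
  proof -
    have "grad w (?F (G y)) = pulled_grad p (G y)"
      using grad_nth[OF dw[OF G_in(1)[OF that]]] by (simp add: vec_eq_iff pulled_grad_def)
    then show ?thesis using G_in(2)[OF that] by simp
  qed
  have "continuous_on (inner_cell K) G"
  proof (intro continuous_at_imp_continuous_on ballI)
    fix y assume "y \<in> inner_cell K"
    then show "isCont G y" using dG[OF G_in(1)] G_in(2) by (metis has_derivative_continuous)
  qed
  then have "continuous_on (inner_cell K) (\<lambda>y. pulled_grad p (G y))"
    by (rule continuous_on_compose2[OF continuous_pulled_grad[OF p]]) (use G_in(1) interior_subset in blast)
  then have "continuous_on (inner_cell K) (grad w)" by (subst continuous_on_cong[OF refl gw])
  moreover have "w differentiable (at y)" if "y \<in> inner_cell K" for y
    using dw[OF G_in(1)[OF that]] G_in(2)[OF that] by (auto simp: differentiable_def)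
  ultimately show "C1_on (inner_cell K) w" by (simp add: C1_on_def)
  have "grad w ` inner_cell K \<subseteq> pulled_grad p ` ?R"
    using gw G_in(1) interior_subset by blast
  then show "bounded (grad w ` inner_cell K)"
    by (rule bounded_subset[OF compact_imp_bounded[OF compact_continuous_image[OF continuous_pulled_grad[OF p] compact_cell_ref]]])
qed

end

section \<open>The regular part of a mesh\<close>

text \<open>Cell boundaries are removed so that all finite element functions are C1 here at the same
  time. The intersection with \<Omega> matters as well: the closure of a slit domain has interior
  points outside the domain.\<close>

definition regular_part :: "(real^'d) set \<Rightarrow> 'd::finite cell set \<Rightarrow> (real^'d) set" where
  "regular_part \<Omega> \<T> = \<Omega> \<inter> (\<Union>K\<in>\<T>. inner_cell K)"

lemma negligible_polytope_lowdim:
  fixes S :: "(real^'d) set"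
  assumes "polytope S" "aff_dim S = int CARD('d) - 1"
  shows "negligible S"
proof -
  have "interior S = {}" by (rule low_dim_interior) (use assms(2) in simp)
  then show ?thesis using negligible_convex_interior[OF polytope_imp_convex[OF assms(1)]] by simp
qed

locale mesh =
  fixes \<Omega> :: "(real^'d) set" and \<T> :: "'d cell set"
  assumes polyhedral: "polyhedral_domain \<Omega>" and conforming: "conforming_triangulation \<Omega> \<T>"
begin

sublocale bounded_open_set \<Omega>
  using polyhedral by unfold_locales (auto simp: polyhedral_domain_def)

abbreviation U where "U \<equiv> regular_part \<Omega> \<T>"

lemma finite_cells: "finite \<T>"
  and valid_cells: "K \<in> \<T> \<Longrightarrow> cell K"
  and Union_regions: "(\<Union>K\<in>\<T>. region K) = closure \<Omega>"
  using conforming by (auto simp: conforming_triangulation_def cell_def)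

lemma open_U: "open U"
  unfolding regular_part_def
  using valid_cells cell.open_inner_cell by (intro open_Int open_domain open_UN) blast

lemma U_subset: "U \<subseteq> \<Omega>" by (auto simp: regular_part_def)

text \<open>What is missing from the closure lies in the frontier, a finite union of polytopes of
  lower dimension, or in one of the finitely many cell boundaries.\<close>

lemma negligible_closure_diff: "negligible (closure \<Omega> - U)"
proof (rule negligible_subset)
  obtain P where P: "finite P" "\<And>S. S \<in> P \<Longrightarrow> polytope S \<and> aff_dim S = int CARD('d) - 1" "frontier \<Omega> = \<Union> P"
    using polyhedral by (auto simp: polyhedral_domain_def)
  have "negligible (frontier \<Omega>)"
    unfolding P(3) using P(1,2) negligible_polytope_lowdim by (intro negligible_Union) auto
  moreover have "negligible (\<Union>K\<in>\<T>. region K - inner_cell K)"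
    using finite_cells valid_cells cell.negligible_region_diff by (intro negligible_Union) auto
  ultimately show "negligible (frontier \<Omega> \<union> (\<Union>K\<in>\<T>. region K - inner_cell K))" by (rule negligible_Un)
  have "interior \<Omega> = \<Omega>" using open_domain by (rule interior_open)
  then show "closure \<Omega> - U \<subseteq> frontier \<Omega> \<union> (\<Union>K\<in>\<T>. region K - inner_cell K)"
  proof (intro subsetI)
    fix x assume x: "x \<in> closure \<Omega> - U"
    then obtain K where "K \<in> \<T>" "x \<in> region K" using Union_regions by blast
    then show "x \<in> frontier \<Omega> \<union> (\<Union>K\<in>\<T>. region K - inner_cell K)"
      using x \<open>interior \<Omega> = \<Omega>\<close> by (auto simp: regular_part_def frontier_def)
  qed
qed

lemma negligible_diff: "negligible (\<Omega> - U)"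
  by (rule negligible_subset[OF negligible_closure_diff]) (use closure_subset in blast)

lemma W_space_C1:
  assumes "w \<in> W_space \<Omega> \<T> k"
  shows "C1_on U w" "bounded (grad w ` U)"
proof -
  have c: "C1_on (inner_cell K) w" "bounded (grad w ` inner_cell K)" if K: "K \<in> \<T>" for K
  proof -
    interpret cell K by (rule valid_cells[OF K])
    obtain p where p: "p \<in> ref_poly (cell_shape_of K) k" "\<And>x. x \<in> cell_ref K \<Longrightarrow> w (cell_map K x) = p x"
      using assms K by (auto simp: W_space_def)
    show "C1_on (inner_cell K) w" "bounded (grad w ` inner_cell K)"
      using inner_cell_gradient[OF p(2) C1_on_ref_poly[OF p(1)]] by auto
  qed
  have "continuous_on (\<Union>K\<in>\<T>. inner_cell K) (grad w)"
    by (intro continuous_on_open_UN cell.open_inner_cell valid_cells C1_onD(2)[OF c(1)])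
  then have "continuous_on U (grad w)" by (rule continuous_on_subset) (auto simp: regular_part_def)
  then show "C1_on U w" using c(1) by (auto simp: C1_on_def regular_part_def)
  have "bounded (\<Union>K\<in>\<T>. grad w ` inner_cell K)" using finite_cells c(2) by (intro bounded_UN) auto
  then show "bounded (grad w ` U)" by (rule bounded_subset) (auto simp: regular_part_def)
qed

lemma W_space_bm:
  assumes "w \<in> W_space \<Omega> \<T> k"
  shows "bounded_measurable_on (closure \<Omega>) w" "bounded_measurable_on \<Omega> w" "bounded_measurable_on U (grad w)"
proof -
  have c: "continuous_on (closure \<Omega>) w" using assms by (simp add: W_space_def)
  have "compact (closure \<Omega>)" using bounded_domain by simp
  then show "bounded_measurable_on (closure \<Omega>) w"
    using compact_imp_bounded[OF compact_continuous_image[OF c]] by (intro bm_continuous[OF c]) auto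
  then show "bounded_measurable_on \<Omega> w" by (rule bm_subset[OF _ closure_subset])
  show "bounded_measurable_on U (grad w)"
    using open_U by (intro bm_continuous C1_onD(2)[OF W_space_C1(1)[OF assms]] W_space_C1(2)[OF assms]) simp
qed

end

section \<open>Finite-dimensional function spaces\<close>

lemma sum_fun_apply: "(\<Sum>i\<in>I. f i) x = (\<Sum>i\<in>I. f i x)"
  by (induction I rule: infinite_finite_induct) simp_all

text \<open>Combinations of two elements with two coefficients include sums and multiples, and they
  are the shape in which linearity of integrals is checked.\<close>

definition fun_subspace :: "('a \<Rightarrow> 'b::real_vector) set \<Rightarrow> bool" where
  "fun_subspace V \<longleftrightarrow> (\<lambda>x. 0) \<in> V \<and> (\<forall>u\<in>V. \<forall>v\<in>V. \<forall>a b. (\<lambda>x. a *\<^sub>R u x + b *\<^sub>R v x) \<in> V)"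

definition linear_form_on :: "('a \<Rightarrow> 'b::real_vector) set \<Rightarrow> (('a \<Rightarrow> 'b) \<Rightarrow> real) \<Rightarrow> bool" where
  "linear_form_on V l \<longleftrightarrow> (\<forall>u\<in>V. \<forall>v\<in>V. \<forall>a b. l (\<lambda>x. a *\<^sub>R u x + b *\<^sub>R v x) = a * l u + b * l v)"

definition lin_comb :: "nat \<Rightarrow> (nat \<Rightarrow> 'a \<Rightarrow> 'b::real_vector) \<Rightarrow> (nat \<Rightarrow> real) \<Rightarrow> 'a \<Rightarrow> 'b" where
  "lin_comb n e c x = (\<Sum>i<n. c i *\<^sub>R e i x)"

text \<open>Indexed by numbers, so that coefficients are the sequences to which solvability of
  saddle point systems applies. Only the first \<open>n\<close> entries of a coefficient sequence
  count, and independence concerns those alone.\<close>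

definition fun_basis :: "('a \<Rightarrow> 'b::real_vector) set \<Rightarrow> nat \<Rightarrow> (nat \<Rightarrow> 'a \<Rightarrow> 'b) \<Rightarrow> bool" where
  "fun_basis V n e \<longleftrightarrow> (\<forall>i<n. e i \<in> V) \<and> (\<forall>v\<in>V. \<exists>c. v = lin_comb n e c) \<and>
     (\<forall>c. lin_comb n e c = (\<lambda>x. 0) \<longrightarrow> (\<forall>i<n. c i = 0))"

lemma fun_subspaceD:
  assumes "fun_subspace V"
  shows "(\<lambda>x. 0) \<in> V" "u \<in> V \<Longrightarrow> v \<in> V \<Longrightarrow> (\<lambda>x. a *\<^sub>R u x + b *\<^sub>R v x) \<in> V"
  using assms by (auto simp: fun_subspace_def)

lemma linear_form_onD:
  assumes "linear_form_on V l" "u \<in> V" "v \<in> V"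
  shows "l (\<lambda>x. a *\<^sub>R u x + b *\<^sub>R v x) = a * l u + b * l v"
  using assms by (simp add: linear_form_on_def)

lemma lin_comb_Suc: "lin_comb (Suc n) e c = (\<lambda>x. 1 *\<^sub>R lin_comb n e c x + c n *\<^sub>R e n x)"
  by (simp add: lin_comb_def fun_eq_iff)

lemma lin_comb_in:
  assumes "fun_subspace V" "\<And>i. i < n \<Longrightarrow> e i \<in> V"
  shows "lin_comb n e c \<in> V"
  using assms(2)
proof (induction n)
  case 0
  then show ?case using fun_subspaceD(1)[OF assms(1)] by (simp add: lin_comb_def[abs_def])
next
  case (Suc n)
  then show ?case unfolding lin_comb_Suc by (intro fun_subspaceD(2)[OF assms(1)]) auto
qed

lemma linear_form_on_lin_comb:
  assumes V: "fun_subspace V" and l: "linear_form_on V l" and e: "\<And>i. i < n \<Longrightarrow> e i \<in> V"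
  shows "l (lin_comb n e c) = (\<Sum>i<n. c i * l (e i))"
  using e
proof (induction n)
  case 0
  \<comment> \<open>The value at the zero function is obtained from the trivial combination.\<close>
  have "l (\<lambda>x. 0 *\<^sub>R (\<lambda>x. 0) x + 0 *\<^sub>R (\<lambda>x. 0) x) = 0 * l (\<lambda>x. 0) + 0 * l (\<lambda>x. 0)"
    by (rule linear_form_onD[OF l fun_subspaceD(1)[OF V] fun_subspaceD(1)[OF V]])
  then show ?case by (simp add: lin_comb_def[abs_def])
next
  case (Suc n)
  have "l (lin_comb (Suc n) e c) = 1 * l (lin_comb n e c) + c n * l (e n)"
    unfolding lin_comb_Suc using Suc.prems by (intro linear_form_onD[OF l] lin_comb_in[OF V]) auto
  then show ?case using Suc by simp
qed

lemma lin_comb_diff: "lin_comb n e c x - lin_comb n e d x = lin_comb n e (\<lambda>i. c i - d i) x"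
  by (simp add: lin_comb_def sum_subtractf scaleR_left_diff_distrib)

text \<open>The spanning functions \<open>b\<close> may lie outside \<open>V\<close>. A maximal
  independent subset of \<open>V\<close> lies inside, and as part of the span of finitely many
  functions it is finite.\<close>

lemma fun_basis_exists:
  fixes V :: "('a \<Rightarrow> 'b::real_vector) set"
  assumes I: "finite I" and span: "\<And>v. v \<in> V \<Longrightarrow> \<exists>c. \<forall>x. v x = (\<Sum>i\<in>I. c i *\<^sub>R b i x)"
  obtains n e where "fun_basis V n e"
proof -
  interpret fs: vector_space "\<lambda>(c::real) (f :: 'a \<Rightarrow> 'b). (\<lambda>x. c *\<^sub>R f x)"
    by unfold_locales (simp_all add: fun_eq_iff scaleR_right_distrib scaleR_left_distrib)
  have sub: "V \<subseteq> fs.span (b ` I)"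
  proof
    fix v assume "v \<in> V"
    then obtain c where "v = (\<Sum>i\<in>I. (\<lambda>x. c i *\<^sub>R b i x))" using span by (auto simp: fun_eq_iff sum_fun_apply)
    moreover have "(\<Sum>i\<in>I. (\<lambda>x. c i *\<^sub>R b i x)) \<in> fs.span (b ` I)"
      by (intro fs.span_sum fs.span_scale fs.span_base) auto
    ultimately show "v \<in> fs.span (b ` I)" by simp
  qed
  obtain B where B: "B \<subseteq> V" "\<not> fs.dependent B" "V \<subseteq> fs.span B"
    using fs.maximal_independent_subset[of V] by blast
  have fin: "finite B" using fs.independent_span_bound[OF finite_imageI[OF I] B(2)] B(1) sub by blast
  obtain e where e: "bij_betw e {..<card B} B" using ex_bij_betw_nat_finite[OF fin] by (auto simp: atLeast0LessThan)
  have reindex: "(\<Sum>v\<in>B. (\<lambda>x. u v *\<^sub>R v x)) = lin_comb (card B) e (\<lambda>i. u (e i))" for u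
    by (simp add: fun_eq_iff sum_fun_apply lin_comb_def sum.reindex_bij_betw[OF e, of "\<lambda>v. u v *\<^sub>R v _", symmetric])
  have "fun_basis V (card B) e"
    unfolding fun_basis_def
  proof (intro conjI allI impI ballI)
    show "e i \<in> V" if "i < card B" for i using bij_betw_apply[OF e, of i] that B(1) by auto
    show "\<exists>c. v = lin_comb (card B) e c" if v: "v \<in> V" for v
    proof -
      have "v \<in> range (\<lambda>u. \<Sum>v\<in>B. (\<lambda>x. u v *\<^sub>R v x))" using v B(3) fs.span_finite[OF fin] by auto
      then obtain u where "v = (\<Sum>v\<in>B. (\<lambda>x. u v *\<^sub>R v x))" by blast
      then show ?thesis unfolding reindex by blast
    qed
    fix c i assume z: "lin_comb (card B) e c = (\<lambda>x. 0)" and i: "i < card B"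
    define u where "u v = c (inv_into {..<card B} e v)" for v
    have ue: "u (e i) = c i" if "i < card B" for i
      using that e by (simp add: u_def bij_betw_def inv_into_f_f)
    have "lin_comb (card B) e (\<lambda>i. u (e i)) = lin_comb (card B) e c"
      by (simp add: lin_comb_def fun_eq_iff ue)
    then have "(\<Sum>v\<in>B. (\<lambda>x. u v *\<^sub>R v x)) = 0" unfolding reindex using z by (simp add: fun_eq_iff)
    then have "\<forall>v\<in>B. u v = 0" using B(2) fs.dependent_finite[OF fin] by blast
    then show "c i = 0" using bij_betw_apply[OF e, of i] i ue[OF i] by auto
  qed
  then show ?thesis by (rule that)
qed

text \<open>Pieces may overlap, as cells do along common faces, so each point is assigned to one
  chosen piece by \<open>sel\<close>. The local functions cut off accordingly may be discontinuous
  and lie outside \<open>V\<close>, but they span it.\<close>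

lemma fun_basis_piecewise:
  fixes V :: "('a \<Rightarrow> 'b::euclidean_space) set"
  assumes fin: "finite I" "finite J"
    and off: "\<And>w x. w \<in> V \<Longrightarrow> x \<notin> (\<Union>i\<in>I. A i) \<Longrightarrow> w x = 0"
    and on: "\<And>w i r. w \<in> V \<Longrightarrow> i \<in> I \<Longrightarrow> r \<in> Basis \<Longrightarrow> \<exists>a. \<forall>x\<in>A i. w x \<bullet> r = (\<Sum>j\<in>J. a j * m i j x)"
  obtains n e where "fun_basis V n e"
proof -
  define sel where "sel x = (SOME i. i \<in> I \<and> x \<in> A i)" for x
  define b where "b = (\<lambda>(i, j, r) x. if x \<in> (\<Union>i\<in>I. A i) \<and> sel x = i then m i j x *\<^sub>R (r :: 'b) else 0)"
  have sel: "sel x \<in> I" "x \<in> A (sel x)" if "x \<in> (\<Union>i\<in>I. A i)" for x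
    using someI_ex[of "\<lambda>i. i \<in> I \<and> x \<in> A i"] that by (auto simp: sel_def)
  show ?thesis
  proof (rule fun_basis_exists[of "I \<times> J \<times> Basis" V b])
    show "finite (I \<times> J \<times> (Basis :: 'b set))" using fin by simp
    fix w assume w: "w \<in> V"
    have "\<forall>i\<in>I. \<forall>r\<in>Basis. \<exists>a. \<forall>x\<in>A i. w x \<bullet> r = (\<Sum>j\<in>J. a j * m i j x)" using on[OF w] by blast
    then obtain a where a: "\<And>i r x. i \<in> I \<Longrightarrow> r \<in> Basis \<Longrightarrow> x \<in> A i \<Longrightarrow> w x \<bullet> r = (\<Sum>j\<in>J. a i r j * m i j x)"
      by metis
    have "w x = (\<Sum>p\<in>I \<times> J \<times> Basis. (case p of (i, j, r) \<Rightarrow> a i r j) *\<^sub>R b p x)" for x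
    proof (cases "x \<in> (\<Union>i\<in>I. A i)")
      case False
      then show ?thesis using off[OF w] by (simp add: b_def case_prod_unfold)
    next
      case True
      have "(\<Sum>p\<in>I \<times> J \<times> Basis. (case p of (i, j, r) \<Rightarrow> a i r j) *\<^sub>R b p x)
          = (\<Sum>i\<in>I. \<Sum>p\<in>J \<times> Basis. a i (snd p) (fst p) *\<^sub>R (if sel x = i then m i (fst p) x *\<^sub>R snd p else 0))"
        using True by (simp add: sum.cartesian_product b_def case_prod_unfold)
      also have "\<dots> = (\<Sum>i\<in>I. if sel x = i then (\<Sum>p\<in>J \<times> Basis. a i (snd p) (fst p) *\<^sub>R (m i (fst p) x *\<^sub>R snd p)) else 0)"
        by (intro sum.cong refl) simp
      also have "\<dots> = (\<Sum>p\<in>J \<times> Basis. a (sel x) (snd p) (fst p) *\<^sub>R (m (sel x) (fst p) x *\<^sub>R snd p))"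
        using fin(1) sel(1)[OF True] by simp
      also have "\<dots> = (\<Sum>j\<in>J. \<Sum>r\<in>Basis. (a (sel x) r j * m (sel x) j x) *\<^sub>R r)"
        by (simp add: sum.cartesian_product case_prod_unfold)
      also have "\<dots> = (\<Sum>r\<in>Basis. (w x \<bullet> r) *\<^sub>R r)"
        by (subst sum.swap) (simp add: a[OF sel(1)[OF True] _ sel(2)[OF True]] scaleR_left.sum)
      also have "\<dots> = w x" by (rule euclidean_representation)
      finally show ?thesis by simp
    qed
    then show "\<exists>c. \<forall>x. w x = (\<Sum>p\<in>I \<times> J \<times> Basis. c p *\<^sub>R b p x)" by blast
  qed (rule that)
qed

lemma pos_def_matrix_lower_bound:
  fixes M :: "nat \<Rightarrow> nat \<Rightarrow> real"
  assumes pos: "\<And>c. \<exists>i<n. c i \<noteq> 0 \<Longrightarrow> 0 < (\<Sum>i<n. \<Sum>j<n. c i * (c j * M i j))"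
  obtains l where "0 < l" "\<And>c. l * (\<Sum>i<n. (c i)\<^sup>2) \<le> (\<Sum>i<n. \<Sum>j<n. c i * (c j * M i j))"
proof -
  define q where "q c = (\<Sum>i<n. \<Sum>j<n. c i * (c j * M i j))" for c
  obtain l where l: "0 < l" "\<And>c. c \<in> UNIV \<Longrightarrow> \<forall>i\<ge>n. c i = 0 \<Longrightarrow> l * (\<Sum>i<n. (c i)\<^sup>2) \<le> q c"
  proof (rule pos_def_form_lower_bound[of q UNIV n])
    show "continuous_on UNIV q" unfolding q_def by (intro continuous_intros)
    show "q (\<lambda>i. s * c i) = s\<^sup>2 * q c" for s c
      by (simp add: q_def sum_distrib_left power2_eq_square ac_simps)
  qed (use pos in \<open>auto simp: q_def\<close>)
  have "l * (\<Sum>i<n. (c i)\<^sup>2) \<le> q c" for c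
    using l(2)[of "\<lambda>i. if i < n then c i else 0"] by (simp add: q_def)
  then show ?thesis using that l(1) by (auto simp: q_def)
qed

text \<open>A linear positive definite system is a saddle point system with an affine velocity field
  and no pressure unknowns.\<close>

lemma pos_def_system_solvable:
  fixes M :: "nat \<Rightarrow> nat \<Rightarrow> real"
  assumes pos: "\<And>c. \<exists>i<n. c i \<noteq> 0 \<Longrightarrow> 0 < (\<Sum>i<n. \<Sum>j<n. c i * (c j * M i j))"
  shows "\<exists>c. \<forall>j<n. (\<Sum>i<n. c i * M i j) = \<beta> j"
proof -
  obtain l where l: "0 < l" "\<And>c. l * (\<Sum>i<n. (c i)\<^sup>2) \<le> (\<Sum>i<n. \<Sum>j<n. c i * (c j * M i j))"
    using pos_def_matrix_lower_bound[OF pos] by blast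
  obtain c where "\<And>j. j < n \<Longrightarrow> (\<Sum>i<n. c i * M i j) - \<beta> j - (\<Sum>l<(0::nat). (0::real)) = 0"
  proof (rule saddle_point_system_solvable[of n "\<lambda>c j. (\<Sum>i<n. c i * M i j) - \<beta> j" l \<beta> "\<lambda>_ _. 0" 0 "\<lambda>_ _. 0"])
    show "l * (\<Sum>j<n. (c j)\<^sup>2) - (\<Sum>j<n. \<beta> j * c j) \<le> (\<Sum>j<n. c j * ((\<Sum>i<n. c i * M i j) - \<beta> j))" for c
    proof -
      have "(\<Sum>j<n. c j * ((\<Sum>i<n. c i * M i j) - \<beta> j)) = (\<Sum>j<n. \<Sum>i<n. c i * (c j * M i j)) - (\<Sum>j<n. \<beta> j * c j)"
        by (simp add: right_diff_distrib sum_subtractf sum_distrib_left ac_simps)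
      also have "(\<Sum>j<n. \<Sum>i<n. c i * (c j * M i j)) = (\<Sum>i<n. \<Sum>j<n. c i * (c j * M i j))" by (rule sum.swap)
      finally show ?thesis using l(2)[of c] by simp
    qed
  qed (auto intro!: continuous_intros l(1) simp: fun_eq_iff)
  then show ?thesis by auto
qed

section \<open>Multiindices and polynomial spaces\<close>

lemma finite_multiindices: "finite {\<alpha> :: 'd::finite \<Rightarrow> nat. \<forall>i. \<alpha> i \<le> k}"
proof -
  have "{\<alpha> :: 'd \<Rightarrow> nat. \<forall>i. \<alpha> i \<le> k} = PiE UNIV (\<lambda>_. {..k})" by (auto simp: PiE_def)
  then show ?thesis by (simp add: finite_PiE)
qed

lemma multiindex_le_sum: "(\<Sum>i\<in>UNIV. \<alpha> i) \<le> (k::nat) \<Longrightarrow> \<alpha> (i::'d::finite) \<le> k"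
  using member_le_sum[of i UNIV \<alpha>] by simp

text \<open>Padding with zero coefficients writes a polynomial of bounded total degree over the
  multiindices with bounded entries, so that simplices and cubes share one finite index set.\<close>

lemma poly_P_coefficients:
  assumes "p \<in> poly_P k"
  shows "\<exists>a. \<forall>x. p x = (\<Sum>\<alpha> | \<forall>i. \<alpha> i \<le> k. a \<alpha> * monomial \<alpha> x)"
proof -
  obtain a where a: "p = (\<lambda>x. \<Sum>\<alpha> | (\<Sum>i\<in>UNIV. \<alpha> i) \<le> k. a \<alpha> * monomial \<alpha> x)" using assms by (auto simp: poly_P_def)
  have "p x = (\<Sum>\<alpha> | \<forall>i. \<alpha> i \<le> k. (if (\<Sum>i\<in>UNIV. \<alpha> i) \<le> k then a \<alpha> else 0) * monomial \<alpha> x)" for x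
    unfolding a using multiindex_le_sum
    by (intro sum.mono_neutral_cong_left finite_multiindices) auto
  then show ?thesis by (intro exI[of _ "\<lambda>\<alpha>. if (\<Sum>i\<in>UNIV. \<alpha> i) \<le> k then a \<alpha> else 0"]) simp
qed

lemma ref_poly_coefficients:
  assumes "p \<in> ref_poly s k"
  shows "\<exists>a. \<forall>x. p x = (\<Sum>\<alpha> | \<forall>i. \<alpha> i \<le> k. a \<alpha> * monomial \<alpha> x)"
proof (cases s)
  case Simplex
  then show ?thesis using assms poly_P_coefficients by simp
next
  case Cube
  then show ?thesis using assms by (auto simp: poly_Q_def)
qed

lemma poly_P_lincomb: "p \<in> poly_P k \<Longrightarrow> q \<in> poly_P k \<Longrightarrow> (\<lambda>x. a * p x + b * q x) \<in> poly_P k"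
  unfolding poly_P_def
proof clarify
  fix c d :: "('d::finite \<Rightarrow> nat) \<Rightarrow> real"
  show "\<exists>aa. (\<lambda>x. a * (\<Sum>\<alpha> | (\<Sum>i\<in>UNIV. \<alpha> i) \<le> k. c \<alpha> * monomial \<alpha> x) + b * (\<Sum>\<alpha> | (\<Sum>i\<in>UNIV. \<alpha> i) \<le> k. d \<alpha> * monomial \<alpha> x))
    = (\<lambda>x. \<Sum>\<alpha> | (\<Sum>i\<in>UNIV. \<alpha> i) \<le> k. aa \<alpha> * monomial \<alpha> x)"
    by (intro exI[of _ "\<lambda>\<alpha>. a * c \<alpha> + b * d \<alpha>"]) (simp add: fun_eq_iff sum_distrib_left sum.distrib algebra_simps)
qed

lemma poly_Q_lincomb: "p \<in> poly_Q k \<Longrightarrow> q \<in> poly_Q k \<Longrightarrow> (\<lambda>x. a * p x + b * q x) \<in> poly_Q k"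
  unfolding poly_Q_def
proof clarify
  fix c d :: "('d::finite \<Rightarrow> nat) \<Rightarrow> real"
  show "\<exists>aa. (\<lambda>x. a * (\<Sum>\<alpha> | \<forall>i. \<alpha> i \<le> k. c \<alpha> * monomial \<alpha> x) + b * (\<Sum>\<alpha> | \<forall>i. \<alpha> i \<le> k. d \<alpha> * monomial \<alpha> x))
    = (\<lambda>x. \<Sum>\<alpha> | \<forall>i. \<alpha> i \<le> k. aa \<alpha> * monomial \<alpha> x)"
    by (intro exI[of _ "\<lambda>\<alpha>. a * c \<alpha> + b * d \<alpha>"]) (simp add: fun_eq_iff sum_distrib_left sum.distrib algebra_simps)
qed

lemma poly_P_zero: "(\<lambda>x. 0) \<in> poly_P k"
  unfolding poly_P_def by (intro CollectI exI[of _ "\<lambda>_. 0"]) simp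

lemma poly_Q_zero: "(\<lambda>x. 0) \<in> poly_Q k"
  unfolding poly_Q_def by (intro CollectI exI[of _ "\<lambda>_. 0"]) simp

lemma ref_poly_lincomb: "p \<in> ref_poly s k \<Longrightarrow> q \<in> ref_poly s k \<Longrightarrow> (\<lambda>x. a * p x + b * q x) \<in> ref_poly s k"
  by (cases s) (simp_all add: poly_P_lincomb poly_Q_lincomb)

lemma ref_poly_zero: "(\<lambda>x. 0) \<in> ref_poly s k"
  by (cases s) (simp_all add: poly_P_zero poly_Q_zero)

text \<open>Linearity of the integrand is asked on \<open>A\<close> only, since classical gradients
  are additive only where derivatives exist.\<close>

lemma linear_form_on_integral:
  fixes \<Phi> :: "('a \<Rightarrow> 'b::real_vector) \<Rightarrow> real^'d \<Rightarrow> real"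
  assumes A: "A \<in> lmeasurable" and bm: "\<And>u. u \<in> V \<Longrightarrow> bounded_measurable_on A (\<Phi> u)"
    and lin: "\<And>u v a b x. u \<in> V \<Longrightarrow> v \<in> V \<Longrightarrow> x \<in> A \<Longrightarrow> \<Phi> (\<lambda>x. a *\<^sub>R u x + b *\<^sub>R v x) x = a * \<Phi> u x + b * \<Phi> v x"
  shows "linear_form_on V (\<lambda>u. \<integral>x. \<Phi> u x \<partial>lebesgue_on A)"
  unfolding linear_form_on_def
proof (intro ballI allI)
  fix u v a b assume uv: "u \<in> V" "v \<in> V"
  have "(\<integral>x. \<Phi> (\<lambda>x. a *\<^sub>R u x + b *\<^sub>R v x) x \<partial>lebesgue_on A) = (\<integral>x. a * \<Phi> u x + b * \<Phi> v x \<partial>lebesgue_on A)"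
    by (rule Bochner_Integration.integral_cong) (simp_all add: lin[OF uv])
  also have "\<dots> = a * (\<integral>x. \<Phi> u x \<partial>lebesgue_on A) + b * (\<integral>x. \<Phi> v x \<partial>lebesgue_on A)"
    using bm_integrable[OF bm[OF uv(1)] A] bm_integrable[OF bm[OF uv(2)] A] by simp
  finally show "(\<integral>x. \<Phi> (\<lambda>x. a *\<^sub>R u x + b *\<^sub>R v x) x \<partial>lebesgue_on A)
    = a * (\<integral>x. \<Phi> u x \<partial>lebesgue_on A) + b * (\<integral>x. \<Phi> v x \<partial>lebesgue_on A)" .
qed

section \<open>Finite element spaces and local projections\<close>

context mesh
begin

lemma U_lmeasurable: "U \<in> lmeasurable"
  by (rule lmeasurable_open[OF bounded_subset[OF bounded_domain U_subset] open_U])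

lemma U_sets: "U \<in> sets lebesgue"
  by (rule fmeasurableD[OF U_lmeasurable])

text \<open>Every integral of the problem, over the domain, a cell or a patch, may thus be taken
  over regular points only.\<close>

lemma integral_restrict_U:
  fixes f :: "real^'d \<Rightarrow> real"
  assumes "A \<in> sets lebesgue" "A \<subseteq> closure \<Omega>"
  shows "(\<integral>x. f x \<partial>lebesgue_on A) = (\<integral>x. f x \<partial>lebesgue_on (A \<inter> U))"
  by (rule integral_lebesgue_on_Int_negligible[OF assms(1) U_sets])
     (rule negligible_subset[OF negligible_closure_diff], use assms(2) in blast)

lemma integral_domain_eq: "(\<integral>x. f x \<partial>lebesgue_on \<Omega>) = (\<integral>x. f x \<partial>lebesgue_on U)" for f :: "real^'d \<Rightarrow> real"
  using integral_restrict_U[OF sets_domain closure_subset] U_subset by (simp add: Int_absorb1)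

lemma bm_U: "bounded_measurable_on \<Omega> f \<Longrightarrow> bounded_measurable_on U f"
  by (rule bm_subset[OF _ U_subset])

lemma W_space_zero: "(\<lambda>x. 0) \<in> W_space \<Omega> \<T> k"
  using ref_poly_zero by (auto simp: W_space_def intro!: bexI[of _ "\<lambda>x. 0"])

lemma W_space_lincomb:
  assumes w: "w \<in> W_space \<Omega> \<T> k" and z: "z \<in> W_space \<Omega> \<T> k"
  shows "(\<lambda>x. a * w x + b * z x) \<in> W_space \<Omega> \<T> k"
proof -
  have "\<exists>p\<in>ref_poly (cell_shape_of K) k. \<forall>x\<in>cell_ref K. a * w (cell_map K x) + b * z (cell_map K x) = p x"
    if K: "K \<in> \<T>" for K
  proof -
    obtain p q where "p \<in> ref_poly (cell_shape_of K) k" "\<forall>x\<in>cell_ref K. w (cell_map K x) = p x"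
      "q \<in> ref_poly (cell_shape_of K) k" "\<forall>x\<in>cell_ref K. z (cell_map K x) = q x"
      using w z K unfolding W_space_def by blast
    then show ?thesis using ref_poly_lincomb[of p _ k q a b] by (intro bexI[of _ "\<lambda>x. a * p x + b * q x"]) auto
  qed
  moreover have "continuous_on (closure \<Omega>) (\<lambda>x. a * w x + b * z x)"
    using w z by (intro continuous_intros) (auto simp: W_space_def)
  ultimately show ?thesis using w z by (simp add: W_space_def)
qed

lemma W_space_off: "w \<in> W_space \<Omega> \<T> k \<Longrightarrow> x \<notin> (\<Union>K\<in>\<T>. region K) \<Longrightarrow> w x = 0"
  unfolding Union_regions by (simp add: W_space_def)

lemma W_space_coefficients:
  assumes "w \<in> W_space \<Omega> \<T> k" "K \<in> \<T>"
  shows "\<exists>a. \<forall>y\<in>region K. w y = (\<Sum>\<alpha> | \<forall>i. \<alpha> i \<le> k. a \<alpha> * monomial \<alpha> (inv_into (cell_ref K) (cell_map K) y))"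
proof -
  interpret cell K by (rule valid_cells[OF assms(2)])
  obtain p where p: "p \<in> ref_poly (cell_shape_of K) k" "\<And>x. x \<in> cell_ref K \<Longrightarrow> w (cell_map K x) = p x"
    using assms by (auto simp: W_space_def)
  obtain a where a: "\<And>x. p x = (\<Sum>\<alpha> | \<forall>i. \<alpha> i \<le> k. a \<alpha> * monomial \<alpha> x)" using ref_poly_coefficients[OF p(1)] by blast
  have "w y = (\<Sum>\<alpha> | \<forall>i. \<alpha> i \<le> k. a \<alpha> * monomial \<alpha> (inv_into (cell_ref K) (cell_map K) y))" if "y \<in> region K" for y
  proof -
    have "inv_into (cell_ref K) (cell_map K) y \<in> cell_ref K" "cell_map K (inv_into (cell_ref K) (cell_map K) y) = y"
      using that unfolding region_def by (auto intro: inv_into_into f_inv_into_f)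
    then have "w y = p (inv_into (cell_ref K) (cell_map K) y)" using p(2) by metis
    then show ?thesis unfolding a .
  qed
  then show ?thesis by blast
qed

section \<open>Discrete velocities and pressures\<close>

lemma V_spaceD:
  assumes "u \<in> V_space \<Omega> \<T> k"
  shows "(\<lambda>x. u x $ i) \<in> W_space \<Omega> \<T> k" "(\<lambda>x. u x $ i) \<in> H1_0 \<Omega>"
  using assms by (auto simp: V_space_def)

lemma fun_subspace_V: "fun_subspace (V_space \<Omega> \<T> k)"
  by (auto simp: fun_subspace_def V_space_def W_space_zero H1_0_zero W_space_lincomb H1_0_lincomb)

lemma V_basis_exists: obtains n e where "fun_basis (V_space \<Omega> \<T> k) n e"
proof (rule fun_basis_piecewise[OF finite_cells finite_multiindices])
  show "u x = 0" if u: "u \<in> V_space \<Omega> \<T> k" and x: "x \<notin> (\<Union>K\<in>\<T>. region K)" for u x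
    using W_space_off[OF V_spaceD(1)[OF u] x] by (simp add: vec_eq_iff)
  show "\<exists>a. \<forall>x\<in>region K. u x \<bullet> r = (\<Sum>\<alpha> | \<forall>i. \<alpha> i \<le> k. a \<alpha> * monomial \<alpha> (inv_into (cell_ref K) (cell_map K) x))"
    if u: "u \<in> V_space \<Omega> \<T> k" and K: "K \<in> \<T>" and r: "r \<in> Basis" for u K r
  proof -
    obtain i where "r = axis i 1" using r by (auto simp: Basis_vec_def)
    then show ?thesis using W_space_coefficients[OF V_spaceD(1)[OF u] K, of i] by (simp add: inner_axis)
  qed
qed (rule that)

lemma fun_subspace_Q: "fun_subspace (Q_space \<Omega> \<T> k)"
  unfolding fun_subspace_def
proof (intro conjI ballI allI)
  show "(\<lambda>x. 0) \<in> Q_space \<Omega> \<T> k"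
    by (simp add: Q_space_def W_space_zero L2_zero_mean_def L2_def)
  fix p q a b assume pq: "p \<in> Q_space \<Omega> \<T> k" "q \<in> Q_space \<Omega> \<T> k"
  have bm: "bounded_measurable_on \<Omega> p" "bounded_measurable_on \<Omega> q"
    using pq W_space_bm(2) by (auto simp: Q_space_def)
  have "(\<lambda>x. a * p x + b * q x) \<in> L2 \<Omega>"
    by (intro bm_L2 bm_add bm_mult bm_const bm lmeasurable_domain)
  moreover have "(\<integral>x. a * p x + b * q x \<partial>lebesgue_on \<Omega>) = 0"
    using bm_integrable[OF bm(1) lmeasurable_domain] bm_integrable[OF bm(2) lmeasurable_domain] pq
    by (simp add: Q_space_def L2_zero_mean_def)
  ultimately show "(\<lambda>x. a *\<^sub>R p x + b *\<^sub>R q x) \<in> Q_space \<Omega> \<T> k"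
    using pq by (simp add: Q_space_def L2_zero_mean_def W_space_lincomb)
qed

lemma Q_basis_exists: obtains n e where "fun_basis (Q_space \<Omega> \<T> k) n e"
proof (rule fun_basis_piecewise[OF finite_cells finite_multiindices])
  show "p x = 0" if "p \<in> Q_space \<Omega> \<T> k" "x \<notin> (\<Union>K\<in>\<T>. region K)" for p x
    using that W_space_off by (auto simp: Q_space_def)
  show "\<exists>a. \<forall>x\<in>region K. p x \<bullet> r = (\<Sum>\<alpha> | \<forall>i. \<alpha> i \<le> k. a \<alpha> * monomial \<alpha> (inv_into (cell_ref K) (cell_map K) x))"
    if "p \<in> Q_space \<Omega> \<T> k" "K \<in> \<T>" "r \<in> Basis" for p K r
    using that W_space_coefficients[of p k K] by (simp add: Q_space_def)
qed (rule that)

lemma Q_space_bm: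
  assumes "p \<in> Q_space \<Omega> \<T> k"
  shows "bounded_measurable_on U p" "bounded_measurable_on U (grad p)"
proof -
  have W: "p \<in> W_space \<Omega> \<T> k" using assms by (simp add: Q_space_def)
  show "bounded_measurable_on U p" "bounded_measurable_on U (grad p)"
    by (rule bm_U[OF W_space_bm(2)[OF W]] W_space_bm(3)[OF W])+
qed

lemma grad_lincomb_U:
  assumes "p \<in> W_space \<Omega> \<T> k" "q \<in> W_space \<Omega> \<T> k" "x \<in> U"
  shows "grad (\<lambda>x. a * p x + b * q x) x = a *\<^sub>R grad p x + b *\<^sub>R grad q x"
  by (rule grad_lincomb[OF C1_onD(1)[OF W_space_C1(1)[OF assms(1)] assms(3)] C1_onD(1)[OF W_space_C1(1)[OF assms(2)] assms(3)]])

lemma bm_closure_V: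
  assumes "u \<in> V_space \<Omega> \<T> k" shows "bounded_measurable_on (closure \<Omega>) u"
  using bm_vec_lambda[of "closure \<Omega>" "\<lambda>i x. u x $ i"] W_space_bm(1)[OF V_spaceD(1)[OF assms]] by simp

lemma V_space_bm:
  assumes "u \<in> V_space \<Omega> \<T> k"
  shows "bounded_measurable_on U u" "bounded_measurable_on U (jac u)" "bounded_measurable_on U (dvg u)"
proof -
  show "bounded_measurable_on U u" by (rule bm_U[OF bm_subset[OF bm_closure_V[OF assms] closure_subset]])
  show j: "bounded_measurable_on U (jac u)"
    unfolding jac_def[abs_def] by (rule bm_vec_lambda, rule W_space_bm(3)[OF V_spaceD(1)[OF assms]])
  show "bounded_measurable_on U (dvg u)" unfolding dvg_def[abs_def] by (rule bm_trace[OF j])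
qed

lemma jac_lincomb_U:
  assumes "u \<in> V_space \<Omega> \<T> k" "v \<in> V_space \<Omega> \<T> k" "x \<in> U"
  shows "jac (\<lambda>x. a *\<^sub>R u x + b *\<^sub>R v x) x = a *\<^sub>R jac u x + b *\<^sub>R jac v x"
  by (simp add: jac_def vec_eq_iff grad_lincomb_U[OF V_spaceD(1)[OF assms(1)] V_spaceD(1)[OF assms(2)] assms(3)])

lemma dvg_lincomb_U:
  assumes "u \<in> V_space \<Omega> \<T> k" "v \<in> V_space \<Omega> \<T> k" "x \<in> U"
  shows "dvg (\<lambda>x. a *\<^sub>R u x + b *\<^sub>R v x) x = a * dvg u x + b * dvg v x"
  unfolding dvg_def jac_lincomb_U[OF assms] by (simp add: trace_def sum.distrib sum_distrib_left)

text \<open>The Jacobian is continuous on the regular part, hence zero there and not just almost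
  everywhere. Each component then vanishes in the domain because of its boundary values, on the
  closure by continuity, and outside by the convention of extension by zero.\<close>

lemma V_space_zero_if_jac_zero:
  assumes u: "u \<in> V_space \<Omega> \<T> k" and z: "(\<integral>x. jac u x \<bullet> jac u x \<partial>lebesgue_on U) = 0"
  shows "u = (\<lambda>x. 0)"
proof -
  have i: "integrable (lebesgue_on U) (\<lambda>x. jac u x \<bullet> jac u x)"
    by (intro bm_integrable[OF _ U_lmeasurable] bm_inner V_space_bm(2)[OF u])
  have "AE x in lebesgue_on U. jac u x \<bullet> jac u x = 0"
    using integral_nonneg_eq_0_iff_AE[OF i] z by simp
  then have ae: "AE x in lebesgue. x \<in> U \<longrightarrow> jac u x = 0"
    using U_sets by (simp add: AE_restrict_space_iff)
  have "continuous_on U (jac u)"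
    unfolding jac_def[abs_def] by (intro continuous_on_vec_lambda C1_onD(2)[OF W_space_C1(1)[OF V_spaceD(1)[OF u]]])
  then have jz: "jac u x = 0" if "x \<in> U" for x by (rule continuous_AE_zero[OF open_U _ ae that])
  have "u x $ i = 0" if x: "x \<in> \<Omega>" for x i
  proof (rule H1_0_zero_if_partial_derivative_zero[OF open_U U_subset negligible_diff V_spaceD(2)[OF u] W_space_C1(1)[OF V_spaceD(1)[OF u]] _ _ x])
    show "continuous_on \<Omega> (\<lambda>x. u x $ i)"
      using V_spaceD(1)[OF u, of i] closure_subset by (auto simp: W_space_def intro: continuous_on_subset)
    show "grad (\<lambda>x. u x $ i) y $ i = 0" if "y \<in> U" for y
      using jz[OF that] by (simp add: jac_def vec_eq_iff)
  qed
  then have "u x $ i = 0" if "x \<in> closure \<Omega>" for x i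
    using V_spaceD(1)[OF u, of i] continuous_constant_on_closure[OF _ _ that, of "\<lambda>x. u x $ i" 0]
    by (simp add: W_space_def)
  moreover have "u x $ i = 0" if "x \<notin> closure \<Omega>" for x i
    using V_spaceD(1)[OF u, of i] that by (simp add: W_space_def)
  ultimately show ?thesis by (auto simp: fun_eq_iff vec_eq_iff)
qed

text \<open>In components the integrand is the sum of \<open>?P i j + 1/2 * ?R i j\<close>.
  Integration by parts with the components \<open>i\<close> and \<open>j\<close> cancels each pair
  separately: \<open>?R i j\<close> integrates to -2 times the integral of
  \<open>?P i j\<close>.\<close>

lemma convection_skew:
  assumes u: "u \<in> V_space \<Omega> \<T> k"
  shows "(\<integral>x. (jac u x *v u x + (1/2) *\<^sub>R (dvg u x *\<^sub>R u x)) \<bullet> u x \<partial>lebesgue_on U) = 0"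
proof -
  let ?u = "\<lambda>i x. u x $ i"
  let ?P = "\<lambda>i j x. ?u i x * grad (?u i) x $ j * ?u j x" and ?R = "\<lambda>i j x. ?u i x * ?u i x * grad (?u j) x $ j"
  have bu: "bounded_measurable_on \<Omega> (?u i)" "bounded_measurable_on U (\<lambda>x. grad (?u i) x $ j)" for i j
    using W_space_bm[OF V_spaceD(1)[OF u]] by (auto intro: bm_vec_nth)
  have iP: "integrable (lebesgue_on U) (?P i j)" and iR: "integrable (lebesgue_on U) (?R i j)" for i j
    by (intro bm_integrable[OF _ U_lmeasurable] bm_mult bm_U bu)+
  have pw: "(jac u x *v u x + (1/2) *\<^sub>R (dvg u x *\<^sub>R u x)) \<bullet> u x = (\<Sum>i\<in>UNIV. \<Sum>j\<in>UNIV. ?P i j x + (1/2) * ?R i j x)" for x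
    by (simp add: inner_vec_def matrix_vector_mult_def jac_def dvg_def trace_def sum_distrib_left sum_distrib_right
        sum.distrib distrib_right distrib_left ac_simps)
  have parts: "(\<integral>x. ?R i j x \<partial>lebesgue_on U) = - 2 * (\<integral>x. ?P i j x \<partial>lebesgue_on U)" for i j
    by (intro integral_square_by_parts_grad open_U U_subset negligible_diff V_spaceD(2)[OF u]
        W_space_C1(1)[OF V_spaceD(1)[OF u]] bu)
  have "(\<integral>x. ?P i j x + (1/2) * ?R i j x \<partial>lebesgue_on U) = 0" for i j
    using iP[of i j] iR[of i j] parts[of i j] by simp
  moreover have "integrable (lebesgue_on U) (\<lambda>x. ?P i j x + (1/2) * ?R i j x)" for i j
    using iP[of i j] iR[of i j] by simp
  ultimately show ?thesis unfolding pw by (subst Bochner_Integration.integral_sum | simp)+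
qed

end

section \<open>Patches and the L2 projection onto patchwise polynomials\<close>

locale macro_mesh = mesh \<Omega> \<T> for \<Omega> :: "(real^'d) set" and \<T> +
  fixes \<M> :: "'d cell set set"
  assumes macro: "macro_triangulation \<T> \<M>"
begin

lemma finite_patches: "finite \<M>"
  using macro finite_cells by (auto simp: macro_triangulation_def intro: finite_elements)

lemma patch_subset: "M \<in> \<M> \<Longrightarrow> M \<subseteq> \<T>"
  using macro by (auto simp: macro_triangulation_def partition_on_def)

lemma patch_region_subset: "M \<in> \<M> \<Longrightarrow> patch_region M \<subseteq> closure \<Omega>"
  using patch_subset unfolding patch_region_def Union_regions[symmetric] by blast

lemma patch_region_sets: "M \<in> \<M> \<Longrightarrow> patch_region M \<in> sets lebesgue"
proof -
  assume M: "M \<in> \<M>"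
  have "compact (patch_region M)"
    unfolding patch_region_def
  proof (rule compact_UN[OF finite_subset[OF patch_subset[OF M] finite_cells]])
    show "compact (region K)" if "K \<in> M" for K
      using cell.compact_region[OF valid_cells] patch_subset[OF M] that by blast
  qed
  then show ?thesis using lmeasurable_compact fmeasurableD by blast
qed

definition patch_interiors :: "(real^'d) set" where
  "patch_interiors = (\<Union>M\<in>\<M>. interior (patch_region M))"

lemma open_patch_interiors: "open patch_interiors"
  by (auto simp: patch_interiors_def)

lemma patch_interiors_subset: "patch_interiors \<subseteq> closure \<Omega>"
  using patch_region_subset interior_subset unfolding patch_interiors_def by blast

lemma D_spaceD:
  assumes "\<zeta> \<in> D_space \<M> k"
  shows "M \<in> \<M> \<Longrightarrow> \<exists>p\<in>poly_P (k - 1). \<forall>x\<in>interior (patch_region M). \<zeta> x $ i = p x"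
    and "x \<notin> patch_interiors \<Longrightarrow> \<zeta> x = 0"
  using assms by (auto simp: D_space_def patch_interiors_def)

lemma fun_subspace_D: "fun_subspace (D_space \<M> k)"
  unfolding fun_subspace_def
proof (intro conjI ballI allI)
  show "(\<lambda>x. 0) \<in> D_space \<M> k" using poly_P_zero by (auto simp: D_space_def intro!: bexI[of _ "\<lambda>x. 0"])
  fix \<zeta> \<xi> a b assume zx: "\<zeta> \<in> D_space \<M> k" "\<xi> \<in> D_space \<M> k"
  have "\<exists>p\<in>poly_P (k - 1). \<forall>x\<in>interior (patch_region M). (a *\<^sub>R \<zeta> x + b *\<^sub>R \<xi> x) $ i = p x" if M: "M \<in> \<M>" for M i
  proof -
    obtain p q where "p \<in> poly_P (k - 1)" "\<forall>x\<in>interior (patch_region M). \<zeta> x $ i = p x"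
      "q \<in> poly_P (k - 1)" "\<forall>x\<in>interior (patch_region M). \<xi> x $ i = q x"
      using D_spaceD(1)[OF zx(1) M] D_spaceD(1)[OF zx(2) M] by metis
    then show ?thesis using poly_P_lincomb[of p _ q a b] by (intro bexI[of _ "\<lambda>x. a * p x + b * q x"]) auto
  qed
  then show "(\<lambda>x. a *\<^sub>R \<zeta> x + b *\<^sub>R \<xi> x) \<in> D_space \<M> k"
    using D_spaceD(2)[OF zx(1)] D_spaceD(2)[OF zx(2)] by (simp add: D_space_def patch_interiors_def)
qed

lemma D_basis_exists: obtains n e where "fun_basis (D_space \<M> k) n e"
proof (rule fun_basis_piecewise[OF finite_patches finite_multiindices])
  show "\<zeta> x = 0" if "\<zeta> \<in> D_space \<M> k" "x \<notin> (\<Union>M\<in>\<M>. interior (patch_region M))" for \<zeta> x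
    using D_spaceD(2)[OF that(1)] that(2) by (simp add: patch_interiors_def)
  show "\<exists>a. \<forall>x\<in>interior (patch_region M). \<zeta> x \<bullet> r = (\<Sum>\<alpha> | \<forall>i. \<alpha> i \<le> k - 1. a \<alpha> * monomial \<alpha> x)"
    if z: "\<zeta> \<in> D_space \<M> k" "M \<in> \<M>" and r: "r \<in> Basis" for \<zeta> M r
  proof -
    obtain i where i: "r = axis i 1" using r by (auto simp: Basis_vec_def)
    obtain p where p: "p \<in> poly_P (k - 1)" "\<forall>x\<in>interior (patch_region M). \<zeta> x $ i = p x"
      using D_spaceD(1)[OF z] by blast
    obtain a where a: "\<And>x. p x = (\<Sum>\<alpha> | \<forall>i. \<alpha> i \<le> k - 1. a \<alpha> * monomial \<alpha> x)"
      using poly_P_coefficients[OF p(1)] by blast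
    show ?thesis unfolding i inner_axis using p(2) a by (intro exI[of _ a]) simp
  qed
qed (rule that)

lemma continuous_D:
  assumes z: "\<zeta> \<in> D_space \<M> k" shows "continuous_on patch_interiors \<zeta>"
proof -
  have "continuous_on (interior (patch_region M)) (\<lambda>x. \<zeta> x $ i)" if M: "M \<in> \<M>" for M i
  proof -
    obtain p where p: "p \<in> poly_P (k - 1)" "\<And>x. x \<in> interior (patch_region M) \<Longrightarrow> \<zeta> x $ i = p x"
      using D_spaceD(1)[OF z M] by blast
    have "continuous_on (interior (patch_region M)) p" by (rule C1_onD(3)[OF C1_on_poly_P[OF p(1)]])
    then show ?thesis by (subst continuous_on_cong[OF refl p(2)])
  qed
  then have "continuous_on (interior (patch_region M)) \<zeta>" if "M \<in> \<M>" for M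
    using continuous_on_vec_lambda[of "interior (patch_region M)" "\<lambda>i x. \<zeta> x $ i"] that by (simp add: vec_lambda_eta)
  then show ?thesis unfolding patch_interiors_def by (intro continuous_on_open_UN) auto
qed

text \<open>There are finitely many patches, and a polynomial is bounded on the compact closure of
  the domain.\<close>

lemma bounded_D:
  assumes z: "\<zeta> \<in> D_space \<M> k" shows "bounded (range \<zeta>)"
proof -
  have b: "bounded ((\<lambda>x. \<zeta> x $ i) ` interior (patch_region M))" if M: "M \<in> \<M>" for M i
  proof -
    obtain p where p: "p \<in> poly_P (k - 1)" "\<And>x. x \<in> interior (patch_region M) \<Longrightarrow> \<zeta> x $ i = p x"
      using D_spaceD(1)[OF z M] by blast
    have "compact (p ` closure \<Omega>)"
      using bounded_domain by (intro compact_continuous_image C1_onD(3)[OF C1_on_poly_P[OF p(1)]]) simp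
    then have "bounded (p ` closure \<Omega>)" by (rule compact_imp_bounded)
    moreover have "(\<lambda>x. \<zeta> x $ i) ` interior (patch_region M) \<subseteq> p ` closure \<Omega>"
      using p(2) patch_region_subset[OF M] interior_subset by (auto intro!: image_eqI)
    ultimately show ?thesis by (rule bounded_subset)
  qed
  have c: "bounded (range (\<lambda>x. \<zeta> x $ i))" for i
  proof (rule bounded_subset)
    show "bounded (insert 0 (\<Union>M\<in>\<M>. (\<lambda>x. \<zeta> x $ i) ` interior (patch_region M)))"
      using b finite_patches by (simp add: bounded_UN)
    show "range (\<lambda>x. \<zeta> x $ i) \<subseteq> insert 0 (\<Union>M\<in>\<M>. (\<lambda>x. \<zeta> x $ i) ` interior (patch_region M))"
      using D_spaceD(2)[OF z] by (force simp: patch_interiors_def)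
  qed
  then obtain B where B: "\<And>i x. \<bar>\<zeta> x $ i\<bar> \<le> B i" unfolding bounded_iff by simp metis
  have "norm (\<zeta> x) \<le> (\<Sum>i\<in>UNIV. B i)" for x
    using norm_le_l1_cart[of "\<zeta> x"] sum_mono[of UNIV "\<lambda>i. \<bar>\<zeta> x $ i\<bar>" B] B by (meson order_trans)
  then show ?thesis by (auto simp: bounded_iff)
qed

lemma bm_D:
  assumes z: "\<zeta> \<in> D_space \<M> k" and A: "A \<in> sets lebesgue"
  shows "bounded_measurable_on A \<zeta>"
proof -
  have "\<zeta> \<in> borel_measurable (lebesgue_on patch_interiors)"
    using open_patch_interiors by (intro continuous_imp_measurable_on_sets_lebesgue continuous_D[OF z]) auto
  then have "(\<lambda>x. if x \<in> patch_interiors then \<zeta> x else 0) \<in> borel_measurable (lebesgue_on UNIV)"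
    using open_patch_interiors by (subst borel_measurable_if_lebesgue_on) auto
  moreover have "(\<lambda>x. if x \<in> patch_interiors then \<zeta> x else 0) = \<zeta>"
    using D_spaceD(2)[OF z] by (auto simp: fun_eq_iff)
  ultimately have "\<zeta> \<in> borel_measurable (lebesgue_on UNIV)" by simp
  then have "bounded_measurable_on UNIV \<zeta>" using bounded_D[OF z] by (simp add: bounded_measurable_on_def)
  then show ?thesis by (rule bm_subset) simp
qed

text \<open>Elements of \<open>D_space\<close> are continuous in the patch interiors, which the
  regular part exhausts up to a null set, and vanish elsewhere by the choice of representative. The
  L2 product is therefore definite on functions, not merely on classes.\<close>

lemma D_zero_if_integral_zero:
  assumes z: "\<zeta> \<in> D_space \<M> k" and int: "(\<integral>x. \<zeta> x \<bullet> \<zeta> x \<partial>lebesgue_on U) = 0"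
  shows "\<zeta> = (\<lambda>x. 0)"
proof -
  have i: "integrable (lebesgue_on U) (\<lambda>x. \<zeta> x \<bullet> \<zeta> x)"
    by (intro bm_integrable[OF _ U_lmeasurable] bm_inner bm_D[OF z U_sets])
  have "AE x in lebesgue_on U. \<zeta> x \<bullet> \<zeta> x = 0"
    using integral_nonneg_eq_0_iff_AE[OF i] int by simp
  then have 1: "AE x in lebesgue. x \<in> U \<longrightarrow> \<zeta> x = 0"
    using U_sets by (simp add: AE_restrict_space_iff)
  have 2: "AE x in lebesgue. x \<notin> closure \<Omega> - U"
    using negligible_closure_diff by (intro AE_not_in) (simp add: negligible_iff_null_sets)
  have "AE x in lebesgue. x \<in> patch_interiors \<longrightarrow> \<zeta> x = 0"
    using 1 2 by eventually_elim (use patch_interiors_subset in blast)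
  then have "\<zeta> x = 0" if "x \<in> patch_interiors" for x
    by (rule continuous_AE_zero[OF open_patch_interiors continuous_D[OF z] _ that])
  then show ?thesis using D_spaceD(2)[OF z] by blast
qed

text \<open>The property by which \<open>L2_projection\<close> is described, with the integral moved
  to the regular part.\<close>

definition is_projection :: "nat \<Rightarrow> (real^'d \<Rightarrow> real^'d) \<Rightarrow> (real^'d \<Rightarrow> real^'d) \<Rightarrow> bool" where
  "is_projection k g \<zeta> \<longleftrightarrow> \<zeta> \<in> D_space \<M> k \<and> (\<forall>\<psi>\<in>D_space \<M> k. (\<integral>x. (g x - \<zeta> x) \<bullet> \<psi> x \<partial>lebesgue_on U) = 0)"

text \<open>Both orthogonality relations are tested with the difference of the candidates;
  subtracting them leaves its squared norm.\<close>

lemma is_projection_unique: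
  assumes g: "bounded_measurable_on U g" and z: "is_projection k g \<zeta>" and x: "is_projection k g \<xi>"
  shows "\<zeta> = \<xi>"
proof -
  have D: "\<zeta> \<in> D_space \<M> k" "\<xi> \<in> D_space \<M> k" using z x by (auto simp: is_projection_def)
  have d: "(\<lambda>x. \<zeta> x - \<xi> x) \<in> D_space \<M> k" using fun_subspaceD(2)[OF fun_subspace_D D, of 1 "-1"] by simp
  note b = bm_D[OF D(1) U_sets] bm_D[OF D(2) U_sets] bm_D[OF d U_sets]
  have i: "integrable (lebesgue_on U) (\<lambda>x. (g x - \<zeta> x) \<bullet> (\<zeta> x - \<xi> x))" "integrable (lebesgue_on U) (\<lambda>x. (g x - \<xi> x) \<bullet> (\<zeta> x - \<xi> x))"
    by (intro bm_integrable[OF _ U_lmeasurable] bm_inner bm_diff g b)+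
  have "(\<integral>x. (\<zeta> x - \<xi> x) \<bullet> (\<zeta> x - \<xi> x) \<partial>lebesgue_on U)
      = (\<integral>x. (g x - \<xi> x) \<bullet> (\<zeta> x - \<xi> x) - (g x - \<zeta> x) \<bullet> (\<zeta> x - \<xi> x) \<partial>lebesgue_on U)"
    by (rule Bochner_Integration.integral_cong) (simp_all add: inner_diff_left)
  also have "\<dots> = 0" using i z x d by (simp add: is_projection_def)
  finally have "(\<lambda>x. \<zeta> x - \<xi> x) = (\<lambda>x. 0)" by (rule D_zero_if_integral_zero[OF d])
  then show ?thesis by (simp add: fun_eq_iff)
qed

text \<open>These are the normal equations. The Gram matrix of a basis of \<open>D_space\<close> is
  positive definite because the L2 product is definite there.\<close>

lemma is_projection_exists:
  assumes g: "bounded_measurable_on U g"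
  shows "\<exists>\<zeta>. is_projection k g \<zeta>"
proof -
  obtain n e where e: "fun_basis (D_space \<M> k) n e" by (rule D_basis_exists)
  have eD: "\<And>i. i < n \<Longrightarrow> e i \<in> D_space \<M> k" using e by (simp add: fun_basis_def)
  let ?I = "\<lambda>f. \<integral>x. f x \<partial>lebesgue_on U"
  have l1: "linear_form_on (D_space \<M> k) (\<lambda>\<zeta>. ?I (\<lambda>x. \<zeta> x \<bullet> \<psi> x))" and l2: "linear_form_on (D_space \<M> k) (\<lambda>\<zeta>. ?I (\<lambda>x. \<psi> x \<bullet> \<zeta> x))"
    if "bounded_measurable_on U \<psi>" for \<psi>
    by (rule linear_form_on_integral[OF U_lmeasurable], intro bm_inner that bm_D[OF _ U_sets],
        simp_all add: inner_add_left inner_add_right)+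
  define M where "M i j = ?I (\<lambda>x. e i x \<bullet> e j x)" for i j
  have quad: "(\<Sum>i<n. \<Sum>j<n. c i * (c j * M i j)) = ?I (\<lambda>x. lin_comb n e c x \<bullet> lin_comb n e c x)" for c
  proof -
    have L: "lin_comb n e c \<in> D_space \<M> k" by (rule lin_comb_in[OF fun_subspace_D eD])
    have inner: "?I (\<lambda>x. e i x \<bullet> lin_comb n e c x) = (\<Sum>j<n. c j * M i j)" if "i < n" for i
      unfolding M_def by (rule linear_form_on_lin_comb[OF fun_subspace_D l2[OF bm_D[OF eD[OF that] U_sets]] eD])
    have "?I (\<lambda>x. lin_comb n e c x \<bullet> lin_comb n e c x) = (\<Sum>i<n. c i * ?I (\<lambda>x. e i x \<bullet> lin_comb n e c x))"
      by (rule linear_form_on_lin_comb[OF fun_subspace_D l1[OF bm_D[OF L U_sets]] eD])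
    then show ?thesis by (simp add: inner sum_distrib_left)
  qed
  have pos: "0 < (\<Sum>i<n. \<Sum>j<n. c i * (c j * M i j))" if c: "\<exists>i<n. c i \<noteq> 0" for c
  proof -
    have L: "lin_comb n e c \<in> D_space \<M> k" by (rule lin_comb_in[OF fun_subspace_D eD])
    have "lin_comb n e c \<noteq> (\<lambda>x. 0)" using c e by (auto simp: fun_basis_def)
    then have "?I (\<lambda>x. lin_comb n e c x \<bullet> lin_comb n e c x) \<noteq> 0" using D_zero_if_integral_zero[OF L] by blast
    moreover have "0 \<le> ?I (\<lambda>x. lin_comb n e c x \<bullet> lin_comb n e c x)" by (rule Bochner_Integration.integral_nonneg) simp
    ultimately show ?thesis unfolding quad by linarith
  qed
  obtain c where c: "\<And>j. j < n \<Longrightarrow> (\<Sum>i<n. c i * M i j) = ?I (\<lambda>x. g x \<bullet> e j x)"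
    using pos_def_system_solvable[of n M "\<lambda>j. ?I (\<lambda>x. g x \<bullet> e j x)", OF pos] by blast
  define \<zeta> where "\<zeta> = lin_comb n e c"
  have z: "\<zeta> \<in> D_space \<M> k" unfolding \<zeta>_def by (rule lin_comb_in[OF fun_subspace_D eD])
  have bz: "bounded_measurable_on U (\<lambda>x. g x - \<zeta> x)" by (intro bm_diff g bm_D[OF z U_sets])
  have orth: "?I (\<lambda>x. (g x - \<zeta> x) \<bullet> e j x) = 0" if j: "j < n" for j
  proof -
    have i: "integrable (lebesgue_on U) (\<lambda>x. g x \<bullet> e j x)" "integrable (lebesgue_on U) (\<lambda>x. \<zeta> x \<bullet> e j x)"
      by (intro bm_integrable[OF _ U_lmeasurable] bm_inner g bm_D[OF z U_sets] bm_D[OF eD[OF j] U_sets])+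
    have "?I (\<lambda>x. \<zeta> x \<bullet> e j x) = (\<Sum>i<n. c i * M i j)"
      unfolding \<zeta>_def M_def by (rule linear_form_on_lin_comb[OF fun_subspace_D l1[OF bm_D[OF eD[OF j] U_sets]] eD])
    then show ?thesis using c[OF j] i by (simp add: inner_diff_left)
  qed
  have "?I (\<lambda>x. (g x - \<zeta> x) \<bullet> \<psi> x) = 0" if \<psi>: "\<psi> \<in> D_space \<M> k" for \<psi>
  proof -
    obtain d where d: "\<psi> = lin_comb n e d" using \<psi> e unfolding fun_basis_def by blast
    have "?I (\<lambda>x. (g x - \<zeta> x) \<bullet> lin_comb n e d x) = (\<Sum>j<n. d j * ?I (\<lambda>x. (g x - \<zeta> x) \<bullet> e j x))"
      by (rule linear_form_on_lin_comb[OF fun_subspace_D l2[OF bz] eD])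
    then show ?thesis unfolding d using orth by simp
  qed
  then show ?thesis using z by (auto simp: is_projection_def)
qed

lemma L2_projection_eq:
  assumes g: "bounded_measurable_on U g" and z: "is_projection k g \<zeta>"
  shows "L2_projection \<Omega> \<M> k g = \<zeta>"
  unfolding L2_projection_def integral_domain_eq is_projection_def[symmetric]
  by (rule the_equality[where P="is_projection k g", OF z is_projection_unique[OF g _ z]])

lemma is_projection_L2_projection:
  assumes "bounded_measurable_on U g"
  shows "is_projection k g (L2_projection \<Omega> \<M> k g)"
  using is_projection_exists[OF assms] L2_projection_eq[OF assms] by metis

lemma bm_L2_projection:
  assumes "bounded_measurable_on U g"
  shows "bounded_measurable_on U (L2_projection \<Omega> \<M> k g)"
  using is_projection_L2_projection[OF assms, of k] bm_D[OF _ U_sets] by (auto simp: is_projection_def)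

text \<open>By uniqueness it suffices that the combination of the projections has the orthogonality
  property. The relation for \<open>f\<close> is asked on the regular part only, which is where
  gradients and Jacobians of sums split.\<close>

lemma L2_projection_lincomb:
  assumes g: "bounded_measurable_on U g" and h: "bounded_measurable_on U h"
    and f: "\<And>x. x \<in> U \<Longrightarrow> f x = a *\<^sub>R g x + b *\<^sub>R h x"
  shows "L2_projection \<Omega> \<M> k f = (\<lambda>x. a *\<^sub>R L2_projection \<Omega> \<M> k g x + b *\<^sub>R L2_projection \<Omega> \<M> k h x)"
proof (rule L2_projection_eq)
  have "bounded_measurable_on U (\<lambda>x. a *\<^sub>R g x + b *\<^sub>R h x)" by (intro bm_intros g h)
  then show "bounded_measurable_on U f" by (subst bm_cong[OF f])
  let ?g = "L2_projection \<Omega> \<M> k g" and ?h = "L2_projection \<Omega> \<M> k h"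
  have P: "is_projection k g ?g" "is_projection k h ?h" using is_projection_L2_projection g h by auto
  then have D: "?g \<in> D_space \<M> k" "?h \<in> D_space \<M> k" by (auto simp: is_projection_def)
  show "is_projection k f (\<lambda>x. a *\<^sub>R ?g x + b *\<^sub>R ?h x)"
    unfolding is_projection_def
  proof (intro conjI ballI)
    show "(\<lambda>x. a *\<^sub>R ?g x + b *\<^sub>R ?h x) \<in> D_space \<M> k" by (rule fun_subspaceD(2)[OF fun_subspace_D D])
    fix \<psi> assume p: "\<psi> \<in> D_space \<M> k"
    have i: "integrable (lebesgue_on U) (\<lambda>x. (g x - ?g x) \<bullet> \<psi> x)" "integrable (lebesgue_on U) (\<lambda>x. (h x - ?h x) \<bullet> \<psi> x)"
      by (intro bm_integrable[OF _ U_lmeasurable] bm_inner bm_diff g h bm_D[OF D(1) U_sets] bm_D[OF D(2) U_sets] bm_D[OF p U_sets])+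
    have "(\<integral>x. (f x - (a *\<^sub>R ?g x + b *\<^sub>R ?h x)) \<bullet> \<psi> x \<partial>lebesgue_on U)
      = (\<integral>x. a * ((g x - ?g x) \<bullet> \<psi> x) + b * ((h x - ?h x) \<bullet> \<psi> x) \<partial>lebesgue_on U)"
      by (rule Bochner_Integration.integral_cong) (simp_all add: f inner_diff_left inner_add_left algebra_simps)
    also have "\<dots> = 0" using i P p by (simp add: is_projection_def)
    finally show "(\<integral>x. (f x - (a *\<^sub>R ?g x + b *\<^sub>R ?h x)) \<bullet> \<psi> x \<partial>lebesgue_on U) = 0" .
  qed
qed

end

section \<open>Nodal interpolation on simplicial meshes\<close>

definition affine_fun :: "(real^'d \<Rightarrow> real) \<Rightarrow> bool" where
  "affine_fun p \<longleftrightarrow> (\<exists>c b. p = (\<lambda>x. c + b \<bullet> x))"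

lemma affine_fun_combination:
  assumes "affine_fun p"
  shows "p ((1 - t) *\<^sub>R x + t *\<^sub>R y) = (1 - t) * p x + t * p y"
  using assms by (auto simp: affine_fun_def inner_add_right algebra_simps)

lemma affine_fun_sum_scale: "(\<And>i. i \<in> I \<Longrightarrow> affine_fun (f i)) \<Longrightarrow> affine_fun (\<lambda>x. \<Sum>i\<in>I. a i * f i x)"
proof (induction I rule: infinite_finite_induct)
  case (insert i I)
  obtain c b where "f i = (\<lambda>x. c + b \<bullet> x)" using insert(4)[of i] by (auto simp: affine_fun_def)
  moreover obtain c' b' where "(\<lambda>x. \<Sum>i\<in>I. a i * f i x) = (\<lambda>x. c' + b' \<bullet> x)"
    using insert(3,4) unfolding affine_fun_def by (metis insertCI)
  ultimately have "(\<lambda>x. \<Sum>i\<in>insert i I. a i * f i x) = (\<lambda>x. (a i * c + c') + (a i *\<^sub>R b + b') \<bullet> x)"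
    using insert(1,2) by (simp add: fun_eq_iff inner_add_left algebra_simps)
  then show ?case unfolding affine_fun_def by blast
qed (auto simp: affine_fun_def intro!: exI[of _ 0])

text \<open>A multiindex of total degree at most one is zero or a unit vector, so the monomial is 1
  or a coordinate.\<close>

lemma affine_monomial:
  fixes \<alpha> :: "'d::finite \<Rightarrow> nat"
  assumes "(\<Sum>i\<in>UNIV. \<alpha> i) \<le> 1"
  shows "affine_fun (monomial \<alpha>)"
proof (cases "\<forall>i. \<alpha> i = 0")
  case True
  then have "monomial \<alpha> = (\<lambda>x. 1 + 0 \<bullet> x)" by (simp add: monomial_def fun_eq_iff)
  then show ?thesis unfolding affine_fun_def by blast
next
  case False
  then obtain i where i: "\<alpha> i \<noteq> 0" by blast
  have "\<alpha> i + (\<Sum>j\<in>UNIV - {i}. \<alpha> j) \<le> 1" using assms by (simp add: sum.remove[of UNIV i])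
  then have "\<alpha> i = 1" "(\<Sum>j\<in>UNIV - {i}. \<alpha> j) = 0" using i by linarith+
  then have a: "\<alpha> i = 1" "\<And>j. j \<noteq> i \<Longrightarrow> \<alpha> j = 0" by (simp_all add: sum_eq_0_iff)
  have "monomial \<alpha> x = 0 + axis i 1 \<bullet> x" for x
    using a by (simp add: monomial_def prod.remove[of UNIV i] inner_axis')
  then have "monomial \<alpha> = (\<lambda>x. 0 + axis i 1 \<bullet> x)" by blast
  then show ?thesis unfolding affine_fun_def by blast
qed

lemma poly_P_1_affine: "p \<in> poly_P 1 \<Longrightarrow> affine_fun p"
  by (auto simp: poly_P_def intro!: affine_fun_sum_scale affine_monomial)

lemma monomial_in_poly_P:
  assumes "(\<Sum>i\<in>UNIV. \<alpha> i) \<le> k" shows "monomial (\<alpha> :: 'd::finite \<Rightarrow> nat) \<in> poly_P k"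
proof -
  have fin: "finite {\<alpha> :: 'd \<Rightarrow> nat. (\<Sum>i\<in>UNIV. \<alpha> i) \<le> k}"
    by (rule finite_subset[OF _ finite_multiindices[of k]]) (auto intro: multiindex_le_sum)
  have "monomial \<alpha> = (\<lambda>x. \<Sum>\<beta> | (\<Sum>i\<in>UNIV. \<beta> i) \<le> k. of_bool (\<beta> = \<alpha>) * monomial \<beta> x)"
  proof
    fix x
    have "(\<Sum>\<beta> | (\<Sum>i\<in>UNIV. \<beta> i) \<le> k. of_bool (\<beta> = \<alpha>) * monomial \<beta> x)
        = (\<Sum>\<beta> | (\<Sum>i\<in>UNIV. \<beta> i) \<le> k. if \<beta> = \<alpha> then monomial \<beta> x else 0)"
      by (rule sum.cong) simp_all
    also have "\<dots> = monomial \<alpha> x" using assms by (subst sum.delta[OF fin]) simp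
    finally show "monomial \<alpha> x = (\<Sum>\<beta> | (\<Sum>i\<in>UNIV. \<beta> i) \<le> k. of_bool (\<beta> = \<alpha>) * monomial \<beta> x)" ..
  qed
  then show ?thesis unfolding poly_P_def mem_Collect_eq by (rule exI[of _ "\<lambda>\<beta>. of_bool (\<beta> = \<alpha>)"])
qed

lemma affine_in_poly_P: "(\<lambda>x. c + b \<bullet> x) \<in> poly_P 1"
proof -
  have one: "(\<lambda>x. 1) \<in> poly_P 1" using monomial_in_poly_P[of "\<lambda>i. 0" 1] by (simp add: monomial_def[abs_def])
  have coord: "(\<lambda>x. x $ i) \<in> poly_P 1" for i
  proof -
    have "monomial (\<lambda>j. of_bool (j = i)) = (\<lambda>x. x $ i)"
      by (simp add: monomial_def fun_eq_iff prod.remove[of UNIV i])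
    then show ?thesis using monomial_in_poly_P[of "\<lambda>j. of_bool (j = i)" 1] by simp
  qed
  have "(\<lambda>x. \<Sum>i\<in>I. b $ i * x $ i) \<in> poly_P 1" for I
  proof (induction I rule: infinite_finite_induct)
    case (insert i I)
    then show ?case using poly_P_lincomb[OF coord[of i] insert(3), of "b $ i" 1] by simp
  qed (simp_all add: poly_P_zero)
  from poly_P_lincomb[OF one this[of UNIV], of c 1] show ?thesis by (simp add: inner_vec_def)
qed

text \<open>The points with property \<open>P\<close> form a convex set that contains the extreme
  points, hence all of \<open>R\<close> by the Krein-Milman theorem. Statements about affine
  functions on cells and faces thereby reduce to vertices.\<close>

lemma convex_extreme_point_induct:
  fixes R :: "'a::euclidean_space set"
  assumes R: "compact R" "convex R"
    and ext: "\<And>x. x extreme_point_of R \<Longrightarrow> P x"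
    and conv: "\<And>x y t. x \<in> R \<Longrightarrow> y \<in> R \<Longrightarrow> P x \<Longrightarrow> P y \<Longrightarrow> 0 \<le> t \<Longrightarrow> t \<le> 1 \<Longrightarrow> P ((1 - t) *\<^sub>R x + t *\<^sub>R y)"
    and x: "x \<in> R"
  shows "P x"
proof -
  have "convex {x \<in> R. P x}"
    unfolding convex_alt using R(2) conv by (auto simp: convex_alt)
  moreover have "{x. x extreme_point_of R} \<subseteq> {x \<in> R. P x}" using ext by (auto simp: extreme_point_of_def)
  ultimately have "convex hull {x. x extreme_point_of R} \<subseteq> {x \<in> R. P x}" by (intro hull_minimal)
  then show ?thesis using Krein_Milman_Minkowski[OF R] x by auto
qed

section \<open>Gluing the local interpolants\<close>

locale simplicial_mesh = mesh \<Omega> \<T> for \<Omega> :: "(real^'d) set" and \<T> +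
  assumes simplicial: "simplicial \<T>"
begin

lemma shape: "K \<in> \<T> \<Longrightarrow> cell_shape_of K = Simplex"
  using simplicial by (simp add: simplicial_def)

lemma affine_cell_map:
  assumes K: "K \<in> \<T>"
  shows "cell_map K ((1 - t) *\<^sub>R x + t *\<^sub>R y) = (1 - t) *\<^sub>R cell_map K x + t *\<^sub>R cell_map K y"
proof -
  have "affine_fun (\<lambda>x. cell_map K x $ j)" for j
    using valid_cells[OF K] shape[OF K] by (auto simp: cell_def valid_cell_def intro!: poly_P_1_affine)
  from affine_fun_combination[OF this] show ?thesis by (simp add: vec_eq_iff)
qed

lemma W_space_affine:
  assumes "w \<in> W_space \<Omega> \<T> 1" "K \<in> \<T>"
  obtains p where "affine_fun p" "\<And>x. x \<in> cell_ref K \<Longrightarrow> w (cell_map K x) = p x"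
  using assms shape[OF assms(2)] poly_P_1_affine unfolding W_space_def by fastforce

text \<open>The argument \<open>x\<close> is a reference point, while \<open>g\<close> is read at
  the images of the reference vertices, the origin and the unit vectors.\<close>

definition local_interpolant :: "(real^'d \<Rightarrow> real) \<Rightarrow> 'd cell \<Rightarrow> real^'d \<Rightarrow> real" where
  "local_interpolant g K x = g (cell_map K 0) + (\<chi> i. g (cell_map K (axis i 1)) - g (cell_map K 0)) \<bullet> x"

lemma affine_local_interpolant: "affine_fun (local_interpolant g K)"
  unfolding affine_fun_def local_interpolant_def[abs_def] by blast

lemma extreme_point_cell_ref:
  assumes "K \<in> \<T>" "v extreme_point_of cell_ref K"
  shows "v = 0 \<or> (\<exists>i. v = axis i 1)"
proof -
  have "v \<in> insert 0 (Basis :: (real^'d) set)"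
    using assms shape[OF assms(1)] by (intro extreme_point_of_convex_hull) (simp add: cell_ref_def)
  then show ?thesis by (auto simp: Basis_vec_def)
qed

lemma local_interpolant_vertex:
  assumes "K \<in> \<T>" "v extreme_point_of cell_ref K"
  shows "local_interpolant g K v = g (cell_map K v)"
  using extreme_point_cell_ref[OF assms] by (auto simp: local_interpolant_def inner_axis)

abbreviation cell_inv :: "'d cell \<Rightarrow> real^'d \<Rightarrow> real^'d" where
  "cell_inv K \<equiv> inv_into (cell_ref K) (cell_map K)"

lemma inj_cell: "K \<in> \<T> \<Longrightarrow> inj_on (cell_map K) (cell_ref K)"
  using cell.inj_cell_map[OF valid_cells] .

lemma cell_inv_map: "K \<in> \<T> \<Longrightarrow> x \<in> cell_ref K \<Longrightarrow> cell_inv K (cell_map K x) = x"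
  using inj_cell by (simp add: inv_into_f_f)

text \<open>Both cell maps are affine and injective on their reference cells, so a segment through
  \<open>y\<close> on one side corresponds to a segment through \<open>x\<close> on the other. A
  common face thus has the same vertices seen from either cell.\<close>

lemma extreme_point_transfer:
  assumes K: "K \<in> \<T>" and L: "L \<in> \<T>" and G: "G \<subseteq> cell_ref K" and H: "H \<subseteq> cell_ref L"
    and eq: "cell_map K ` G = cell_map L ` H"
    and x: "x extreme_point_of G" and y: "y \<in> H" "cell_map L y = cell_map K x"
  shows "y extreme_point_of H"
  unfolding extreme_point_of_def
proof (intro conjI y ballI notI)
  fix a b assume ab: "a \<in> H" "b \<in> H" and seg: "y \<in> open_segment a b"
  obtain t where t: "0 < t" "t < 1" "y = (1 - t) *\<^sub>R a + t *\<^sub>R b" and ne: "a \<noteq> b"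
    using seg by (auto simp: in_segment)
  obtain a' b' where a': "a' \<in> G" "cell_map K a' = cell_map L a" and b': "b' \<in> G" "cell_map K b' = cell_map L b"
    using imageI[OF ab(1), of "cell_map L"] imageI[OF ab(2), of "cell_map L"] unfolding eq[symmetric] by auto
  have xG: "x \<in> G" using x by (simp add: extreme_point_of_def)
  have "a' \<noteq> b'"
  proof
    assume "a' = b'"
    then have "cell_map L a = cell_map L b" using a'(2) b'(2) by simp
    then have "a = b" by (rule inj_onD[OF inj_cell[OF L]]) (use ab H in blast)+
    then show False using ne by simp
  qed
  have "cell_map K ((1 - t) *\<^sub>R a' + t *\<^sub>R b') = cell_map K x"
    using y(2) unfolding t(3) affine_cell_map[OF K] affine_cell_map[OF L] a'(2) b'(2) by simp
  moreover have "(1 - t) *\<^sub>R a' + t *\<^sub>R b' \<in> cell_ref K"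
    using convexD_alt[OF convex_cell_ref, of a' K b' t] subsetD[OF G a'(1)] subsetD[OF G b'(1)] t(1,2) by simp
  ultimately have "(1 - t) *\<^sub>R a' + t *\<^sub>R b' = x" using inj_onD[OF inj_cell[OF K]] xG G by blast
  then have "x \<in> open_segment a' b'" using t \<open>a' \<noteq> b'\<close> by (auto simp: in_segment)
  then show False using x a'(1) b'(1) by (auto simp: extreme_point_of_def)
qed

text \<open>On a common face both local interpolants are affine and agree at the extreme points, which are
  vertices of both cells.\<close>

lemma local_interpolant_agree:
  assumes K: "K \<in> \<T>" and L: "L \<in> \<T>" and y: "y \<in> region K" "y \<in> region L"
  shows "local_interpolant g K (cell_inv K y) = local_interpolant g L (cell_inv L y)"
proof (cases "K = L")
  case False
  obtain G H where G: "G face_of cell_ref K" and H: "H face_of cell_ref L"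
    and eqG: "region K \<inter> region L = cell_map K ` G" and eqH: "region K \<inter> region L = cell_map L ` H"
    using conforming K L False unfolding conforming_triangulation_def by meson
  have sub: "G \<subseteq> cell_ref K" "H \<subseteq> cell_ref L" using G H by (auto dest: face_of_imp_subset)
  have eq: "cell_map K ` G = cell_map L ` H" using eqG eqH by simp
  have conv: "compact G" "convex G" "convex H"
    using face_of_imp_compact[OF convex_cell_ref compact_cell_ref G] face_of_imp_convex G H convex_cell_ref by auto
  \<comment> \<open>The property refers to the points of \<open>H\<close> with the same image, so
    that it passes to convex combinations: since both maps are affine and injective, the partner of
    a combination is the combination of the partners.\<close>
  let ?P = "\<lambda>x. \<forall>z\<in>H. cell_map L z = cell_map K x \<longrightarrow> local_interpolant g K x = local_interpolant g L z"
  have P: "?P x" if "x \<in> G" for x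
  proof (rule convex_extreme_point_induct[OF conv(1,2) _ _ that])
    fix x assume x: "x extreme_point_of G"
    show "?P x"
    proof (intro ballI impI)
      fix z assume z: "z \<in> H" "cell_map L z = cell_map K x"
      have "z extreme_point_of H" by (rule extreme_point_transfer[OF K L sub eq x z])
      then have "z extreme_point_of cell_ref L" "x extreme_point_of cell_ref K"
        using x extreme_point_of_face[OF G] extreme_point_of_face[OF H] by auto
      then show "local_interpolant g K x = local_interpolant g L z"
        using local_interpolant_vertex[OF K] local_interpolant_vertex[OF L] z(2) by simp
    qed
  next
    fix a b and t :: real assume ab: "a \<in> G" "b \<in> G" "?P a" "?P b" and t: "0 \<le> t" "t \<le> 1"
    show "?P ((1 - t) *\<^sub>R a + t *\<^sub>R b)"
    proof (intro ballI impI)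
      fix z assume z: "z \<in> H" "cell_map L z = cell_map K ((1 - t) *\<^sub>R a + t *\<^sub>R b)"
      obtain a' b' where a': "a' \<in> H" "cell_map L a' = cell_map K a" and b': "b' \<in> H" "cell_map L b' = cell_map K b"
        using imageI[OF ab(1), of "cell_map K"] imageI[OF ab(2), of "cell_map K"] unfolding eq by auto
      have "(1 - t) *\<^sub>R a' + t *\<^sub>R b' \<in> cell_ref L"
        using convexD_alt[OF convex_cell_ref, of a' L b' t] subsetD[OF sub(2) a'(1)] subsetD[OF sub(2) b'(1)] t by simp
      moreover have "cell_map L ((1 - t) *\<^sub>R a' + t *\<^sub>R b') = cell_map L z"
        unfolding z(2) affine_cell_map[OF K] affine_cell_map[OF L] a'(2) b'(2) ..
      moreover have "z \<in> cell_ref L" using z(1) sub(2) by blast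
      ultimately have z_eq: "z = (1 - t) *\<^sub>R a' + t *\<^sub>R b'"
        using inj_onD[OF inj_cell[OF L], of "(1 - t) *\<^sub>R a' + t *\<^sub>R b'" z] by simp
      show "local_interpolant g K ((1 - t) *\<^sub>R a + t *\<^sub>R b) = local_interpolant g L z"
        unfolding z_eq affine_fun_combination[OF affine_local_interpolant] using ab(3,4) a' b' by auto
    qed
  qed
  have "y \<in> cell_map K ` G" "y \<in> cell_map L ` H" using y eqG eqH by blast+
  then obtain x z where x: "x \<in> G" "y = cell_map K x" and z: "z \<in> H" "y = cell_map L z" by blast
  have "cell_inv K y = x" unfolding x(2) by (rule cell_inv_map[OF K subsetD[OF sub(1) x(1)]])
  moreover have "cell_inv L y = z" unfolding z(2) by (rule cell_inv_map[OF L subsetD[OF sub(2) z(1)]])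
  moreover have "cell_map L z = cell_map K x" using x(2) z(2) by simp
  ultimately show ?thesis using P[OF x(1)] z(1) by simp
qed simp

text \<open>The cell is an arbitrary choice among those containing \<open>y\<close>; agreement on
  common faces makes the choice immaterial.\<close>

definition interpolant :: "(real^'d \<Rightarrow> real) \<Rightarrow> real^'d \<Rightarrow> real" where
  "interpolant g y = (if y \<in> closure \<Omega>
     then local_interpolant g (SOME K. K \<in> \<T> \<and> y \<in> region K) (cell_inv (SOME K. K \<in> \<T> \<and> y \<in> region K) y) else 0)"

lemma region_subset: "K \<in> \<T> \<Longrightarrow> region K \<subseteq> closure \<Omega>"
  using Union_regions by blast

lemma interpolant_on_region:
  assumes "K \<in> \<T>" "y \<in> region K"
  shows "interpolant g y = local_interpolant g K (cell_inv K y)"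
proof -
  let ?L = "SOME K. K \<in> \<T> \<and> y \<in> region K"
  have "?L \<in> \<T> \<and> y \<in> region ?L" by (rule someI[of _ K]) (use assms in simp)
  moreover have "y \<in> closure \<Omega>" using region_subset[OF assms(1)] assms(2) by blast
  ultimately show ?thesis
    using local_interpolant_agree[of ?L K y g] assms by (simp add: interpolant_def)
qed

text \<open>Continuity is pasted together over the finite cover by closed regions.\<close>

lemma interpolant_in_W: "interpolant g \<in> W_space \<Omega> \<T> 1"
proof -
  have "continuous_on (region K) (interpolant g)" if K: "K \<in> \<T>" for K
  proof -
    interpret cell K by (rule valid_cells[OF K])
    have "continuous_on (region K) (cell_inv K)"
      unfolding region_def
      by (rule continuous_on_inv[OF continuous_cell_map compact_cell_ref]) (use cell_inv_map[OF K] in simp)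
    then have "continuous_on (region K) (\<lambda>y. local_interpolant g K (cell_inv K y))"
      unfolding local_interpolant_def by (intro continuous_intros)
    then show ?thesis by (subst continuous_on_cong[OF refl interpolant_on_region[OF K]])
  qed
  then have "continuous_on (\<Union>K\<in>\<T>. region K) (interpolant g)"
    by (intro continuous_on_closed_Union finite_cells compact_imp_closed cell.compact_region valid_cells)
  moreover have "\<exists>p\<in>ref_poly (cell_shape_of K) 1. \<forall>x\<in>cell_ref K. interpolant g (cell_map K x) = p x" if K: "K \<in> \<T>" for K
  proof (intro bexI ballI)
    show "local_interpolant g K \<in> ref_poly (cell_shape_of K) 1"
      unfolding local_interpolant_def[abs_def] shape[OF K] ref_poly.simps by (rule affine_in_poly_P)
    fix x assume x: "x \<in> cell_ref K"
    then have "cell_map K x \<in> region K" by (simp add: region_def)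
    then show "interpolant g (cell_map K x) = local_interpolant g K x"
      using interpolant_on_region[OF K] cell_inv_map[OF K x] by simp
  qed
  moreover have "interpolant g x = 0" if "x \<notin> closure \<Omega>" for x
    using that by (simp add: interpolant_def)
  ultimately show ?thesis unfolding W_space_def Union_regions by blast
qed

text \<open>In the reference coordinates of each cell both functions are affine and agree at the
  vertices. This is the uniqueness behind the description in
  \<open>nodal_interpolation\<close>.\<close>

lemma W_space_eq_interpolant:
  assumes w: "w \<in> W_space \<Omega> \<T> 1" and nodal: "\<And>a. a \<in> mesh_vertices \<T> \<Longrightarrow> w a = g a"
  shows "w = interpolant g"
proof
  fix y
  show "w y = interpolant g y"
  proof (cases "y \<in> closure \<Omega>")
    case True
    then obtain K where K: "K \<in> \<T>" "y \<in> region K" using Union_regions by blast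
    obtain p where p: "affine_fun p" "\<And>x. x \<in> cell_ref K \<Longrightarrow> w (cell_map K x) = p x"
      using W_space_affine[OF w K(1)] by blast
    have "p x = local_interpolant g K x" if x: "x \<in> cell_ref K" for x
    proof (rule convex_extreme_point_induct[OF compact_cell_ref convex_cell_ref _ _ x])
      fix v assume v: "v extreme_point_of cell_ref K"
      then have "w (cell_map K v) = g (cell_map K v)" using K(1) by (intro nodal) (auto simp: mesh_vertices_def)
      moreover have "v \<in> cell_ref K" using v by (simp add: extreme_point_of_def)
      ultimately show "p v = local_interpolant g K v" using p(2) local_interpolant_vertex[OF K(1) v] by metis
    qed (simp add: affine_fun_combination[OF p(1)] affine_fun_combination[OF affine_local_interpolant])
    moreover have "cell_inv K y \<in> cell_ref K" "cell_map K (cell_inv K y) = y"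
      using K(2) unfolding region_def by (auto intro: inv_into_into f_inv_into_f)
    ultimately show ?thesis using p(2) interpolant_on_region[OF K] by metis
  next
    case False
    then show ?thesis using w by (simp add: W_space_def interpolant_def)
  qed
qed

lemma interpolant_vertex:
  assumes "a \<in> mesh_vertices \<T>" shows "interpolant g a = g a"
proof -
  obtain K v where K: "K \<in> \<T>" "v extreme_point_of cell_ref K" "a = cell_map K v"
    using assms by (auto simp: mesh_vertices_def)
  then have v: "v \<in> cell_ref K" by (simp add: extreme_point_of_def)
  then have "a \<in> region K" using K(3) by (simp add: region_def)
  then show ?thesis
    using interpolant_on_region[OF K(1)] cell_inv_map[OF K(1) v] local_interpolant_vertex[OF K(1,2)] K(3) by simp
qed

lemma nodal_interpolation_eq: "nodal_interpolation \<Omega> \<T> g = interpolant g"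
  unfolding nodal_interpolation_def
  using interpolant_in_W interpolant_vertex W_space_eq_interpolant by (intro the_equality) auto

lemma interpolant_lincomb: "interpolant (\<lambda>x. a * g x + b * h x) y = a * interpolant g y + b * interpolant h y"
proof -
  have "local_interpolant (\<lambda>x. a * g x + b * h x) K x = a * local_interpolant g K x + b * local_interpolant h K x" for K x
    by (simp add: local_interpolant_def inner_vec_def sum_distrib_left algebra_simps sum.distrib sum_subtractf)
  then show ?thesis by (simp add: interpolant_def)
qed

text \<open>The square of an affine function is convex, hence lies below the affine interpolation of
  its vertex values. This makes the form \<open>T_BH\<close> nonnegative.\<close>

lemma interpolant_square_ge:
  assumes p: "p \<in> W_space \<Omega> \<T> 1" and y: "y \<in> closure \<Omega>"
  shows "p y * p y \<le> interpolant (\<lambda>x. p x * p x) y"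
proof -
  let ?I = "local_interpolant (\<lambda>x. p x * p x)"
  obtain K where K: "K \<in> \<T>" "y \<in> region K" using y Union_regions by blast
  obtain r where r: "affine_fun r" "\<And>x. x \<in> cell_ref K \<Longrightarrow> p (cell_map K x) = r x"
    using W_space_affine[OF p K(1)] by blast
  have "(r x)\<^sup>2 \<le> ?I K x" if x: "x \<in> cell_ref K" for x
  proof (rule convex_extreme_point_induct[OF compact_cell_ref convex_cell_ref _ _ x])
    fix v assume v: "v extreme_point_of cell_ref K"
    then have "v \<in> cell_ref K" by (simp add: extreme_point_of_def)
    then show "(r v)\<^sup>2 \<le> ?I K v" using r(2) local_interpolant_vertex[OF K(1) v] by (simp add: power2_eq_square)
  next
    fix a b and t :: real assume ab: "(r a)\<^sup>2 \<le> ?I K a" "(r b)\<^sup>2 \<le> ?I K b" and t: "0 \<le> t" "t \<le> 1"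
    have "(1 - t) * (r a)\<^sup>2 + t * (r b)\<^sup>2 - ((1 - t) * r a + t * r b)\<^sup>2 = t * (1 - t) * (r a - r b)\<^sup>2"
      by (simp add: power2_eq_square algebra_simps)
    moreover have "0 \<le> t * (1 - t) * (r a - r b)\<^sup>2" using t by simp
    moreover have "(1 - t) * (r a)\<^sup>2 \<le> (1 - t) * ?I K a" "t * (r b)\<^sup>2 \<le> t * ?I K b"
      using ab t by (auto intro: mult_left_mono)
    ultimately show "(r ((1 - t) *\<^sub>R a + t *\<^sub>R b))\<^sup>2 \<le> ?I K ((1 - t) *\<^sub>R a + t *\<^sub>R b)"
      unfolding affine_fun_combination[OF r(1)] affine_fun_combination[OF affine_local_interpolant] by linarith
  qed
  moreover have "cell_inv K y \<in> cell_ref K" "cell_map K (cell_inv K y) = y"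
    using K(2) unfolding region_def by (auto intro: inv_into_into f_inv_into_f)
  ultimately show ?thesis using r(2) interpolant_on_region[OF K] by (metis power2_eq_square)
qed

end

section \<open>The discrete problem\<close>

lemma linear_form_on_add:
  "linear_form_on V l \<Longrightarrow> linear_form_on V l' \<Longrightarrow> linear_form_on V (\<lambda>v. l v + l' v)"
  by (simp add: linear_form_on_def algebra_simps)

lemma linear_form_on_scale: "linear_form_on V l \<Longrightarrow> linear_form_on V (\<lambda>v. r * l v)"
  by (simp add: linear_form_on_def algebra_simps)

lemma linear_form_on_diff:
  "linear_form_on V l \<Longrightarrow> linear_form_on V l' \<Longrightarrow> linear_form_on V (\<lambda>v. l v - l' v)"
  by (simp add: linear_form_on_def algebra_simps)

lemma linear_form_on_sum:
  "(\<And>i. i \<in> I \<Longrightarrow> linear_form_on V (l i)) \<Longrightarrow> linear_form_on V (\<lambda>v. \<Sum>i\<in>I. l i v)"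
  by (simp add: linear_form_on_def sum.distrib sum_distrib_left)

lemma matrix_vector_mult_lincomb_left:
  fixes A B :: "real^'n^'m"
  shows "(a *\<^sub>R A + b *\<^sub>R B) *v x = a *\<^sub>R (A *v x) + b *\<^sub>R (B *v x)"
  by (simp add: vec_eq_iff matrix_vector_mult_def sum.distrib sum_distrib_left algebra_simps)

lemma matrix_vector_mult_scale_left: "(a *\<^sub>R (A :: real^'n^'m)) *v x = a *\<^sub>R (A *v x)"
  using matrix_vector_mult_lincomb_left[of a A 0 A x] by simp

lemma matrix_vector_mult_lincomb_right:
  fixes A :: "real^'n^'m"
  shows "A *v (a *\<^sub>R x + b *\<^sub>R y) = a *\<^sub>R (A *v x) + b *\<^sub>R (A *v y)"
  by (simp add: vec_eq_iff matrix_vector_mult_def sum.distrib sum_distrib_left algebra_simps)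

lemma lin_comb_cong: "(\<And>i. i < n \<Longrightarrow> c i = c' i) \<Longrightarrow> lin_comb n e c = lin_comb n e c'"
  by (simp add: lin_comb_def fun_eq_iff)

context mesh
begin

text \<open>Differentiated and transporting field are separated, although both are the velocity in
  the problem. Trilinearity turns the convective term into a polynomial in the coefficients, hence
  into a continuous function of them.\<close>

lemma linear_form_convection:
  defines "\<Phi> u w v x \<equiv> (jac u x *v w x + (1/2) *\<^sub>R (dvg u x *\<^sub>R w x)) \<bullet> v x"
  assumes V: "u \<in> V_space \<Omega> \<T> k" "w \<in> V_space \<Omega> \<T> k" "v \<in> V_space \<Omega> \<T> k"
  shows "linear_form_on (V_space \<Omega> \<T> k) (\<lambda>u. \<integral>x. \<Phi> u w v x \<partial>lebesgue_on U)"
    and "linear_form_on (V_space \<Omega> \<T> k) (\<lambda>w. \<integral>x. \<Phi> u w v x \<partial>lebesgue_on U)"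
    and "linear_form_on (V_space \<Omega> \<T> k) (\<lambda>v. \<integral>x. \<Phi> u w v x \<partial>lebesgue_on U)"
proof -
  have bm: "bounded_measurable_on U (\<Phi> u w v)"
    if "u \<in> V_space \<Omega> \<T> k" "w \<in> V_space \<Omega> \<T> k" "v \<in> V_space \<Omega> \<T> k" for u w v
    unfolding \<Phi>_def
    by (intro bm_inner bm_add bm_matrix_vector_mult bm_scaleR bm_const V_space_bm(1)[OF that(2)] V_space_bm(1)[OF that(3)]
        V_space_bm(2)[OF that(1)] V_space_bm(3)[OF that(1)])
  show "linear_form_on (V_space \<Omega> \<T> k) (\<lambda>u. \<integral>x. \<Phi> u w v x \<partial>lebesgue_on U)"
    by (rule linear_form_on_integral[OF U_lmeasurable bm[OF _ V(2,3)]], assumption)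
       (simp add: \<Phi>_def jac_lincomb_U dvg_lincomb_U matrix_vector_mult_lincomb_left matrix_vector_mult_scale_left
        inner_add_left algebra_simps)
  show "linear_form_on (V_space \<Omega> \<T> k) (\<lambda>w. \<integral>x. \<Phi> u w v x \<partial>lebesgue_on U)"
    by (rule linear_form_on_integral[OF U_lmeasurable bm[OF V(1) _ V(3)]], assumption)
       (simp add: \<Phi>_def matrix_vector_mult_lincomb_right inner_add_left algebra_simps)
  show "linear_form_on (V_space \<Omega> \<T> k) (\<lambda>v. \<integral>x. \<Phi> u w v x \<partial>lebesgue_on U)"
    by (rule linear_form_on_integral[OF U_lmeasurable bm[OF V(1,2)]], assumption)
       (simp add: \<Phi>_def inner_add_right)
qed

lemma linear_form_diffusion:
  assumes "bounded_measurable_on U G"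
  shows "linear_form_on (V_space \<Omega> \<T> k) (\<lambda>u. \<integral>x. jac u x \<bullet> G x \<partial>lebesgue_on U)"
    and "linear_form_on (V_space \<Omega> \<T> k) (\<lambda>u. \<integral>x. G x \<bullet> jac u x \<partial>lebesgue_on U)"
  by (rule linear_form_on_integral[OF U_lmeasurable], intro bm_inner V_space_bm(2) assms, assumption,
      simp add: jac_lincomb_U inner_add_left inner_add_right)+

lemma linear_form_divergence:
  assumes "bounded_measurable_on U p"
  shows "linear_form_on (V_space \<Omega> \<T> k) (\<lambda>v. \<integral>x. p x * dvg v x \<partial>lebesgue_on U)"
  by (rule linear_form_on_integral[OF U_lmeasurable], intro bm_mult V_space_bm(3) assms, assumption,
      simp add: dvg_lincomb_U algebra_simps)

lemma linear_form_pressure: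
  assumes "bounded_measurable_on U d"
  shows "linear_form_on (Q_space \<Omega> \<T> k) (\<lambda>q. \<integral>x. q x * d x \<partial>lebesgue_on U)"
  by (rule linear_form_on_integral[OF U_lmeasurable], intro bm_mult Q_space_bm(1) assms, assumption,
      simp add: algebra_simps)

lemma integral_jac_lin_comb:
  assumes e: "\<And>i. i < n \<Longrightarrow> e i \<in> V_space \<Omega> \<T> k"
  shows "(\<integral>x. jac (lin_comb n e c) x \<bullet> jac (lin_comb n e c) x \<partial>lebesgue_on U)
    = (\<Sum>i<n. \<Sum>j<n. c i * (c j * (\<integral>x. jac (e i) x \<bullet> jac (e j) x \<partial>lebesgue_on U)))"
proof -
  have L: "lin_comb n e c \<in> V_space \<Omega> \<T> k" by (rule lin_comb_in[OF fun_subspace_V e])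
  have "(\<integral>x. jac (e i) x \<bullet> jac (lin_comb n e c) x \<partial>lebesgue_on U)
      = (\<Sum>j<n. c j * (\<integral>x. jac (e i) x \<bullet> jac (e j) x \<partial>lebesgue_on U))" if "i < n" for i
    by (rule linear_form_on_lin_comb[OF fun_subspace_V linear_form_diffusion(2)[OF V_space_bm(2)[OF e[OF that]]] e])
  moreover have "(\<integral>x. jac (lin_comb n e c) x \<bullet> jac (lin_comb n e c) x \<partial>lebesgue_on U)
      = (\<Sum>i<n. c i * (\<integral>x. jac (e i) x \<bullet> jac (lin_comb n e c) x \<partial>lebesgue_on U))"
    by (rule linear_form_on_lin_comb[OF fun_subspace_V linear_form_diffusion(1)[OF V_space_bm(2)[OF L]] e])
  ultimately show ?thesis by (simp add: sum_distrib_left)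
qed

text \<open>All stabilizations enter through the properties listed here: linearity in the test
  function, sign, symmetry of \<open>T\<close>, and continuity of \<open>S\<close> along coefficient
  vectors. Momentum and mass equations are solved as the two blocks of a saddle point system and
  then added.\<close>

lemma discrete_problem_solvable:
  fixes k :: nat and S :: "(real^'d \<Rightarrow> real^'d) \<Rightarrow> (real^'d \<Rightarrow> real^'d) \<Rightarrow> real" and T :: "(real^'d \<Rightarrow> real) \<Rightarrow> (real^'d \<Rightarrow> real) \<Rightarrow> real"
  defines "V \<equiv> V_space \<Omega> \<T> k" and "Q \<equiv> Q_space \<Omega> \<T> k"
  assumes \<mu>: "0 < \<mu>" and F: "linear_form_on V F"
    and T: "\<And>p. p \<in> Q \<Longrightarrow> linear_form_on Q (T p)" "\<And>p q. p \<in> Q \<Longrightarrow> q \<in> Q \<Longrightarrow> T p q = T q p" "\<And>p. p \<in> Q \<Longrightarrow> 0 \<le> T p p"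
    and S: "\<And>u. u \<in> V \<Longrightarrow> linear_form_on V (S u)" "\<And>u. u \<in> V \<Longrightarrow> 0 \<le> S u u"
      "\<And>n e v. (\<And>i. i < n \<Longrightarrow> e i \<in> V) \<Longrightarrow> v \<in> V \<Longrightarrow> continuous_on UNIV (\<lambda>c. S (lin_comb n e c) v)"
  shows "\<exists>u\<in>V. \<exists>p\<in>Q. \<forall>v\<in>V. \<forall>q\<in>Q.
           (\<integral>x. (jac u x *v u x + (1/2) *\<^sub>R (dvg u x *\<^sub>R u x)) \<bullet> v x \<partial>lebesgue_on U)
         + \<mu> * (\<integral>x. jac u x \<bullet> jac v x \<partial>lebesgue_on U)
         - (\<integral>x. p x * dvg v x \<partial>lebesgue_on U)
         + S u v
         + (\<integral>x. q x * dvg u x \<partial>lebesgue_on U)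
         + T p q
         = F v"
proof -
  obtain n e where "fun_basis (V_space \<Omega> \<T> k) n e" by (rule V_basis_exists)
  then have e: "fun_basis V n e" by (simp add: V_def)
  obtain m g where "fun_basis (Q_space \<Omega> \<T> k) m g" by (rule Q_basis_exists)
  then have g: "fun_basis Q m g" by (simp add: Q_def)
  have eV: "\<And>i. i < n \<Longrightarrow> e i \<in> V" using e by (simp add: fun_basis_def)
  have gQ: "\<And>i. i < m \<Longrightarrow> g i \<in> Q" using g by (simp add: fun_basis_def)
  have sV: "fun_subspace V" and sQ: "fun_subspace Q" unfolding V_def Q_def by (rule fun_subspace_V fun_subspace_Q)+
  let ?E = "lin_comb n e" and ?G = "lin_comb m g"
  have EV: "?E c \<in> V" for c by (rule lin_comb_in[OF sV eV])
  have GQ: "?G d \<in> Q" for d by (rule lin_comb_in[OF sQ gQ])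
  define N where "N u w v = (\<integral>x. (jac u x *v w x + (1/2) *\<^sub>R (dvg u x *\<^sub>R w x)) \<bullet> v x \<partial>lebesgue_on U)" for u w v
  define a where "a u v = (\<integral>x. jac u x \<bullet> jac v x \<partial>lebesgue_on U)" for u v :: "real^'d \<Rightarrow> real^'d"
  define D where "D p v = (\<integral>x. p x * dvg v x \<partial>lebesgue_on U)" for p and v :: "real^'d \<Rightarrow> real^'d"
  have N: "linear_form_on V (\<lambda>u. N u w v)" "linear_form_on V (\<lambda>w. N u w v)" "linear_form_on V (\<lambda>v. N u w v)"
    if "u \<in> V" "w \<in> V" "v \<in> V" for u w v
    using linear_form_convection[of u k w v] that unfolding N_def V_def by blast+
  have la: "linear_form_on V (\<lambda>u. a u v)" "linear_form_on V (\<lambda>u. a v u)" if "v \<in> V" for v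
    using linear_form_diffusion[OF V_space_bm(2), of v k] that unfolding a_def V_def by blast+
  have lD: "linear_form_on V (D p)" if "p \<in> Q" for p
    using linear_form_divergence[OF Q_space_bm(1), of p k] that unfolding D_def[abs_def] V_def Q_def by blast
  have lD': "linear_form_on Q (\<lambda>p. D p v)" if "v \<in> V" for v
    using linear_form_pressure[OF V_space_bm(3), of v k] that unfolding D_def V_def Q_def by blast
  define R where "R u v = N u u v + \<mu> * a u v + S u v - F v" for u v
  have lR: "linear_form_on V (R u)" if "u \<in> V" for u
    unfolding R_def[abs_def]
    by (intro linear_form_on_diff linear_form_on_add linear_form_on_scale N(3)[OF that that that] la(2) S(1) F that)
  \<comment> \<open>Set to zero beyond the basis, so that symmetry holds for all indices, whereas
    \<open>T\<close> is symmetric on the pressure space only.\<close>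
  define t where "t k l = (if k < m \<and> l < m then T (g k) (g l) else 0)" for k l
  have a_quad: "a (?E c) (?E c) = (\<Sum>i<n. \<Sum>j<n. c i * (c j * a (e i) (e j)))" for c
    unfolding a_def by (rule integral_jac_lin_comb) (use eV in \<open>simp add: V_def\<close>)
  obtain l where l: "0 < l" "\<And>c. l * (\<Sum>i<n. (c i)\<^sup>2) \<le> (\<Sum>i<n. \<Sum>j<n. c i * (c j * a (e i) (e j)))"
  proof (rule pos_def_matrix_lower_bound[of n "\<lambda>i j. a (e i) (e j)"])
    fix c :: "nat \<Rightarrow> real" assume c: "\<exists>i<n. c i \<noteq> 0"
    have "?E c \<noteq> (\<lambda>x. 0)" using c e by (auto simp: fun_basis_def)
    then have "a (?E c) (?E c) \<noteq> 0" using V_space_zero_if_jac_zero[of "?E c" k] EV[of c] unfolding a_def V_def by blast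
    moreover have "0 \<le> a (?E c) (?E c)" unfolding a_def by (rule Bochner_Integration.integral_nonneg) simp
    ultimately show "0 < (\<Sum>i<n. \<Sum>j<n. c i * (c j * a (e i) (e j)))" unfolding a_quad[symmetric] by linarith
  qed blast
  \<comment> \<open>Linearity is known in the second argument; symmetry moves it to the
    first.\<close>
  have T_G: "T (?G d) q = (\<Sum>k<m. d k * T (g k) q)" if q: "q \<in> Q" for d q
  proof -
    have "T (?G d) q = T q (?G d)" by (rule T(2)[OF GQ q])
    also have "\<dots> = (\<Sum>k<m. d k * T q (g k))" by (rule linear_form_on_lin_comb[OF sQ T(1)[OF q] gQ])
    also have "\<dots> = (\<Sum>k<m. d k * T (g k) q)" by (rule sum.cong) (simp_all add: T(2)[OF q gQ])
    finally show ?thesis .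
  qed
  obtain c d where c: "\<And>j. j < n \<Longrightarrow> R (?E c) (e j) - (\<Sum>l<m. D (g l) (e j) * d l) = 0"
    and d: "\<And>l. l < m \<Longrightarrow> (\<Sum>j<n. D (g l) (e j) * c j) + (\<Sum>k<m. t k l * d k) = 0"
  proof (rule saddle_point_system_solvable[of n "\<lambda>c j. R (?E c) (e j)" "\<mu> * l" "\<lambda>j. F (e j)" t m "\<lambda>j l. D (g l) (e j)"])
    fix j assume j: "j < n"
    have "N (?E c) (?E c) (e j) = (\<Sum>i<n. c i * (\<Sum>k<n. c k * N (e i) (e k) (e j)))" for c
    proof -
      have "N (?E c) (?E c) (e j) = (\<Sum>i<n. c i * N (e i) (?E c) (e j))"
        by (rule linear_form_on_lin_comb[OF sV N(1)[OF EV EV eV[OF j]] eV])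
      also have "\<dots> = (\<Sum>i<n. c i * (\<Sum>k<n. c k * N (e i) (e k) (e j)))"
        using linear_form_on_lin_comb[OF sV N(2)[OF eV EV eV[OF j]] eV] by (intro sum.cong) auto
      finally show ?thesis .
    qed
    moreover have "a (?E c) (e j) = (\<Sum>i<n. c i * a (e i) (e j))" for c
      by (rule linear_form_on_lin_comb[OF sV la(1)[OF eV[OF j]] eV])
    ultimately have "(\<lambda>c. R (?E c) (e j)) = (\<lambda>c. (\<Sum>i<n. c i * (\<Sum>k<n. c k * N (e i) (e k) (e j)))
        + \<mu> * (\<Sum>i<n. c i * a (e i) (e j)) + S (?E c) (e j) - F (e j))"
      by (simp add: R_def fun_eq_iff)
    then show "continuous_on UNIV (\<lambda>c. R (?E c) (e j))"
      by (rule ssubst[where P="continuous_on UNIV"]) (intro continuous_intros S(3)[of n e, OF eV eV[OF j]])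
  next
    fix c c' :: "nat \<Rightarrow> real" assume "\<And>i. i < n \<Longrightarrow> c i = c' i"
    then have "?E c = ?E c'" by (rule lin_comb_cong)
    then show "(\<lambda>j. R (?E c) (e j)) = (\<lambda>j. R (?E c') (e j))" by simp
  next
    show "0 < \<mu> * l" using \<mu> l(1) by simp
  next
    fix c :: "nat \<Rightarrow> real"
    have "(\<Sum>j<n. c j * R (?E c) (e j)) = R (?E c) (?E c)"
      by (rule linear_form_on_lin_comb[OF sV lR[OF EV] eV, symmetric])
    moreover have "N (?E c) (?E c) (?E c) = 0"
      unfolding N_def by (rule convection_skew) (use EV[of c] in \<open>simp add: V_def\<close>)
    moreover have "F (?E c) = (\<Sum>j<n. c j * F (e j))" by (rule linear_form_on_lin_comb[OF sV F eV])
    moreover have "\<mu> * (l * (\<Sum>i<n. (c i)\<^sup>2)) \<le> \<mu> * a (?E c) (?E c)"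
      using l(2)[of c] \<mu> by (simp add: a_quad)
    ultimately show "\<mu> * l * (\<Sum>j<n. (c j)\<^sup>2) - (\<Sum>j<n. F (e j) * c j) \<le> (\<Sum>j<n. c j * R (?E c) (e j))"
      using S(2)[OF EV[of c]] by (simp add: R_def mult.assoc mult.commute[of "F _"])
  next
    show "t k l = t l k" for k l using T(2) gQ by (simp add: t_def)
  next
    fix d :: "nat \<Rightarrow> real"
    have "(\<Sum>k<m. \<Sum>l<m. t k l * d k * d l) = (\<Sum>k<m. d k * (\<Sum>l<m. d l * T (g k) (g l)))"
      by (simp add: t_def sum_distrib_left ac_simps)
    also have "\<dots> = (\<Sum>k<m. d k * T (g k) (?G d))"
      using linear_form_on_lin_comb[OF sQ T(1)[OF gQ] gQ] by (intro sum.cong) auto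
    also have "\<dots> = T (?G d) (?G d)" by (rule T_G[OF GQ, symmetric])
    finally show "0 \<le> (\<Sum>k<m. \<Sum>l<m. t k l * d k * d l)" using T(3)[OF GQ] by simp
  qed blast
  \<comment> \<open>Equations tested with basis functions extend to all test functions by linearity,
    here and in the mass equation below.\<close>
  have mom: "R (?E c) v - D (?G d) v = 0" if v: "v \<in> V" for v
  proof -
    have lin: "linear_form_on V (\<lambda>v. R (?E c) v - D (?G d) v)" by (intro linear_form_on_diff lR lD EV GQ)
    have "R (?E c) (e j) - D (?G d) (e j) = 0" if j: "j < n" for j
    proof -
      have "D (?G d) (e j) = (\<Sum>l<m. d l * D (g l) (e j))"
        by (rule linear_form_on_lin_comb[OF sQ lD'[OF eV[OF j]] gQ])
      then show ?thesis using c[OF j] by (simp add: mult.commute)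
    qed
    moreover obtain b where b: "v = ?E b" using e v unfolding fun_basis_def by blast
    moreover have "R (?E c) (?E b) - D (?G d) (?E b) = (\<Sum>j<n. b j * (R (?E c) (e j) - D (?G d) (e j)))"
      by (rule linear_form_on_lin_comb[OF sV lin eV])
    ultimately show ?thesis by simp
  qed
  have mass: "D q (?E c) + T (?G d) q = 0" if q: "q \<in> Q" for q
  proof -
    have lin: "linear_form_on Q (\<lambda>q. D q (?E c) + T (?G d) q)" by (intro linear_form_on_add lD' T(1) EV GQ)
    have "D (g l) (?E c) + T (?G d) (g l) = 0" if j: "l < m" for l
    proof -
      have "D (g l) (?E c) = (\<Sum>j<n. c j * D (g l) (e j))"
        by (rule linear_form_on_lin_comb[OF sV lD[OF gQ[OF j]] eV])
      moreover have "T (?G d) (g l) = (\<Sum>k<m. t k l * d k)"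
        using j by (simp add: T_G[OF gQ[OF j]] t_def mult.commute)
      ultimately show ?thesis using d[OF j] by (simp add: mult.commute)
    qed
    moreover obtain b where b: "q = ?G b" using g q unfolding fun_basis_def by blast
    moreover have "D (?G b) (?E c) + T (?G d) (?G b) = (\<Sum>l<m. b l * (D (g l) (?E c) + T (?G d) (g l)))"
      by (rule linear_form_on_lin_comb[OF sQ lin gQ])
    ultimately show ?thesis by simp
  qed
  have "N (?E c) (?E c) v + \<mu> * a (?E c) v - D (?G d) v + S (?E c) v + D q (?E c) + T (?G d) q = F v"
    if "v \<in> V" "q \<in> Q" for v q
    using mom[OF that(1)] mass[OF that(2)] by (simp add: R_def)
  then show ?thesis using EV[of c] GQ[of d] unfolding N_def a_def D_def by blast
qed

text \<open>The energy norm of a difference of two combinations is the square root of a quadratic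
  polynomial in the coefficient differences. Continuity in the energy norm thus becomes continuity
  on coefficient space.\<close>

lemma V_continuous_on_lin_comb:
  assumes \<Phi>: "V_continuous_on \<Omega> A \<Phi>" and e: "\<And>i. i < n \<Longrightarrow> e i \<in> V_space \<Omega> \<T> k"
  shows "continuous_on {c. lin_comb n e c \<in> A} (\<lambda>c. \<Phi> (lin_comb n e c))"
proof -
  let ?E = "lin_comb n e" and ?S = "{c. lin_comb n e c \<in> A}"
  have norm: "V_norm \<Omega> (\<lambda>x. ?E c x - ?E c0 x)
      = sqrt (\<Sum>i<n. \<Sum>j<n. (c i - c0 i) * ((c j - c0 j) * (\<integral>x. jac (e i) x \<bullet> jac (e j) x \<partial>lebesgue_on U)))" for c c0
    using integral_jac_lin_comb[OF e, where c="\<lambda>i. c i - c0 i"]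
    by (simp add: lin_comb_diff V_norm_def L2_norm_on_def power2_norm_eq_inner integral_domain_eq)
  have cont: "continuous_on UNIV (\<lambda>c. V_norm \<Omega> (\<lambda>x. ?E c x - ?E c0 x))" for c0
    unfolding norm by (intro continuous_intros)
  show ?thesis
    unfolding continuous_on_def
  proof
    fix c0 assume c0: "c0 \<in> ?S"
    have zero: "V_norm \<Omega> (\<lambda>x. ?E c0 x - ?E c0 x) = 0" unfolding norm by simp
    show "((\<lambda>c. \<Phi> (?E c)) \<longlongrightarrow> \<Phi> (?E c0)) (at c0 within ?S)"
    proof (rule tendstoI)
      fix \<epsilon> :: real assume "0 < \<epsilon>"
      then obtain \<eta> where \<eta>: "0 < \<eta>" "\<And>w. w \<in> A \<Longrightarrow> V_norm \<Omega> (\<lambda>x. w x - ?E c0 x) < \<eta> \<Longrightarrow> \<bar>\<Phi> w - \<Phi> (?E c0)\<bar> < \<epsilon>"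
        using \<Phi> c0 unfolding V_continuous_on_def by blast
      have "((\<lambda>c. V_norm \<Omega> (\<lambda>x. ?E c x - ?E c0 x)) \<longlongrightarrow> V_norm \<Omega> (\<lambda>x. ?E c0 x - ?E c0 x)) (at c0)"
        by (rule bspec[OF cont[of c0, unfolded continuous_on_def] UNIV_I])
      then have "((\<lambda>c. V_norm \<Omega> (\<lambda>x. ?E c x - ?E c0 x)) \<longlongrightarrow> V_norm \<Omega> (\<lambda>x. ?E c0 x - ?E c0 x)) (nhds c0)"
        by (rule tendsto_at_iff_tendsto_nhds[THEN iffD1])
      then have "\<forall>\<^sub>F c in nhds c0. V_norm \<Omega> (\<lambda>x. ?E c x - ?E c0 x) < \<eta>"
        by (rule order_tendstoD) (simp only: zero \<eta>(1))
      then show "\<forall>\<^sub>F c in at c0 within ?S. dist (\<Phi> (?E c)) (\<Phi> (?E c0)) < \<epsilon>"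
        unfolding eventually_at_filter by eventually_elim (simp add: dist_real_def \<eta>(2))
    qed
  qed
qed

end

section \<open>Stabilization terms\<close>

lemma bounded_bilinear_matrix_vector_mult: "bounded_bilinear ((*v) :: real^'n^'m \<Rightarrow> real^'n \<Rightarrow> real^'m)"
proof (rule bilinear_conv_bounded_bilinear[THEN iffD1], unfold bilinear_def, intro conjI allI)
  fix A :: "real^'n^'m" and x :: "real^'n"
  show "linear ((*v) A)" by (rule matrix_vector_mul_linear)
  show "linear (\<lambda>A :: real^'n^'m. A *v x)"
    by (rule linearI) (simp_all add: vec_eq_iff matrix_vector_mult_def sum.distrib sum_distrib_left algebra_simps)
qed

context mesh
begin

lemma region_sets: "K \<in> \<T> \<Longrightarrow> region K \<in> sets lebesgue"
  using cell.compact_region[OF valid_cells] lmeasurable_compact fmeasurableD by blast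

lemma region_closure: "K \<in> \<T> \<Longrightarrow> region K \<subseteq> closure \<Omega>"
  using Union_regions by blast

lemma Int_U_lmeasurable:
  assumes "A \<in> sets lebesgue" shows "A \<inter> U \<in> lmeasurable"
proof (rule bounded_set_imp_lmeasurable)
  show "bounded (A \<inter> U)" by (rule bounded_subset[OF bounded_domain]) (use U_subset in blast)
  show "A \<inter> U \<in> sets lebesgue" using assms U_sets by (rule sets.Int)
qed

text \<open>Common pattern of the pressure gradient and local projection terms: \<open>R\<close> is
  a gradient or its fluctuation, linear on the regular part, and the weights may depend on the
  solution but not on the test function.\<close>

lemma weighted_form:
  fixes R :: "(real^'d \<Rightarrow> 'b::real_vector) \<Rightarrow> real^'d \<Rightarrow> 'c::euclidean_space"
  assumes bm: "\<And>u. u \<in> V \<Longrightarrow> bounded_measurable_on U (R u)"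
    and lin: "\<And>u v a b x. u \<in> V \<Longrightarrow> v \<in> V \<Longrightarrow> x \<in> U \<Longrightarrow> R (\<lambda>x. a *\<^sub>R u x + b *\<^sub>R v x) x = a *\<^sub>R R u x + b *\<^sub>R R v x"
    and A: "\<And>i. i \<in> I \<Longrightarrow> A i \<in> sets lebesgue" "\<And>i. i \<in> I \<Longrightarrow> A i \<subseteq> closure \<Omega>" and u: "u \<in> V"
  shows "linear_form_on V (\<lambda>v. \<Sum>i\<in>I. w i * (\<integral>x. R u x \<bullet> R v x \<partial>lebesgue_on (A i)))"
    and "(\<And>i. i \<in> I \<Longrightarrow> 0 \<le> w i) \<Longrightarrow> 0 \<le> (\<Sum>i\<in>I. w i * (\<integral>x. R u x \<bullet> R u x \<partial>lebesgue_on (A i)))"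
proof -
  have "linear_form_on V (\<lambda>v. \<integral>x. R u x \<bullet> R v x \<partial>lebesgue_on (A i))" if i: "i \<in> I" for i
    unfolding integral_restrict_U[OF A(1)[OF i] A(2)[OF i]]
  proof (rule linear_form_on_integral[OF Int_U_lmeasurable[OF A(1)[OF i]]])
    show "bounded_measurable_on (A i \<inter> U) (\<lambda>x. R u x \<bullet> R v x)" if "v \<in> V" for v
      by (rule bm_subset[OF bm_inner[OF bm[OF u] bm[OF that]] Int_lower2])
  qed (simp add: lin inner_add_right)
  then show "linear_form_on V (\<lambda>v. \<Sum>i\<in>I. w i * (\<integral>x. R u x \<bullet> R v x \<partial>lebesgue_on (A i)))"
    by (intro linear_form_on_sum linear_form_on_scale)
  show "0 \<le> (\<Sum>i\<in>I. w i * (\<integral>x. R u x \<bullet> R u x \<partial>lebesgue_on (A i)))" if "\<And>i. i \<in> I \<Longrightarrow> 0 \<le> w i"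
    by (intro sum_nonneg mult_nonneg_nonneg that Bochner_Integration.integral_nonneg inner_ge_zero)
qed

lemma grad_lincomb_Q:
  assumes "p \<in> Q_space \<Omega> \<T> k" "q \<in> Q_space \<Omega> \<T> k" "x \<in> U"
  shows "grad (\<lambda>x. a *\<^sub>R p x + b *\<^sub>R q x) x = a *\<^sub>R grad p x + b *\<^sub>R grad q x"
  using grad_lincomb_U[of p k q x a b] assms by (simp add: Q_space_def)

lemma T_BP_form:
  assumes p: "p \<in> Q_space \<Omega> \<T> k"
  shows "linear_form_on (Q_space \<Omega> \<T> k) (T_BP \<T> p)" "T_BP \<T> p q = T_BP \<T> q p" "0 \<le> T_BP \<T> p p"
proof -
  show "linear_form_on (Q_space \<Omega> \<T> k) (T_BP \<T> p)"
    unfolding T_BP_def[abs_def]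
    by (rule weighted_form(1)[OF Q_space_bm(2) grad_lincomb_Q region_sets region_closure p])
  show "0 \<le> T_BP \<T> p p"
    unfolding T_BP_def
    by (rule weighted_form(2)[OF Q_space_bm(2) grad_lincomb_Q region_sets region_closure p]) simp_all
  show "T_BP \<T> p q = T_BP \<T> q p" by (simp add: T_BP_def inner_commute)
qed

section \<open>Streamline diffusion with a degenerating parameter\<close>

lemma S_SUPG_form:
  assumes \<delta>: "SUPG_parameter \<Omega> \<T> k c \<delta>" and u: "u \<in> V_space \<Omega> \<T> k"
  shows "linear_form_on (V_space \<Omega> \<T> k) (S_SUPG \<T> \<delta> u)" "0 \<le> S_SUPG \<T> \<delta> u u"
proof -
  have "linear_form_on (V_space \<Omega> \<T> k) (\<lambda>v. \<integral>x. (jac u x *v u x) \<bullet> (jac v x *v u x) \<partial>lebesgue_on (region K))"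
    if K: "K \<in> \<T>" for K
    unfolding integral_restrict_U[OF region_sets[OF K] region_closure[OF K]]
  proof (rule linear_form_on_integral[OF Int_U_lmeasurable[OF region_sets[OF K]]])
    show "bounded_measurable_on (region K \<inter> U) (\<lambda>x. (jac u x *v u x) \<bullet> (jac v x *v u x))" if v: "v \<in> V_space \<Omega> \<T> k" for v
      by (rule bm_subset[OF _ Int_lower2])
         (intro bm_inner bm_matrix_vector_mult V_space_bm(1)[OF u] V_space_bm(2)[OF u] V_space_bm(2)[OF v])
  qed (simp add: jac_lincomb_U matrix_vector_mult_lincomb_left inner_add_right)
  then show "linear_form_on (V_space \<Omega> \<T> k) (S_SUPG \<T> \<delta> u)"
    unfolding S_SUPG_def[abs_def] by (intro linear_form_on_sum linear_form_on_scale)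
  show "0 \<le> S_SUPG \<T> \<delta> u u"
    unfolding S_SUPG_def using \<delta> u
    by (intro sum_nonneg mult_nonneg_nonneg Bochner_Integration.integral_nonneg inner_ge_zero)
       (simp add: SUPG_parameter_def)
qed

text \<open>At a fixed regular point each entry of the Jacobian is a linear form on the velocity
  space, so the general expansion applies.\<close>

lemma jac_lin_comb_U:
  assumes e: "\<And>i. i < n \<Longrightarrow> e i \<in> V_space \<Omega> \<T> k" and x: "x \<in> U"
  shows "jac (lin_comb n e c) x = (\<Sum>i<n. c i *\<^sub>R jac (e i) x)"
proof -
  have "jac (lin_comb n e c) x $ r $ s = (\<Sum>i<n. c i * jac (e i) x $ r $ s)" for r s
    by (rule linear_form_on_lin_comb[OF fun_subspace_V _ e])
       (simp_all add: linear_form_on_def jac_lincomb_U[OF _ _ x])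
  then show ?thesis by (simp add: vec_eq_iff)
qed

text \<open>Where the velocity vanishes on the cell, the bound on the parameter beats only one of the two
  factors of the velocity; the other one forces the stabilization term to zero.\<close>

lemma SUPG_term_bound:
  assumes \<delta>: "SUPG_parameter \<Omega> \<T> k c \<delta>" and c: "0 < c" and K: "K \<in> \<T>" and u: "u \<in> V_space \<Omega> \<T> k"
    and nz: "\<exists>x\<in>region K. u x \<noteq> 0" and B: "\<And>x. x \<in> region K \<Longrightarrow> norm (u x) \<le> B"
    and J: "\<And>x. x \<in> U \<Longrightarrow> norm (jac u x) \<le> J" and Jv: "\<And>x. x \<in> U \<Longrightarrow> norm (jac v x) \<le> Jv"
    and v: "v \<in> V_space \<Omega> \<T> k"
    and mv: "\<And>(A :: real^'d^'d) x. norm (A *v x) \<le> norm A * norm x * m" "0 \<le> m" and pos: "0 \<le> B" "0 \<le> J" "0 \<le> Jv"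
  shows "\<bar>\<delta> K u * (\<integral>x. (jac u x *v u x) \<bullet> (jac v x *v u x) \<partial>lebesgue_on (region K))\<bar>
    \<le> c * diameter (region K) * B * (J * m * (Jv * m) * measure lebesgue (region K \<inter> U))"
proof -
  let ?L = "Linf_norm_on (region K) u" and ?h = "diameter (region K)" and ?A = "region K \<inter> U"
  let ?f = "\<lambda>x. (jac u x *v u x) \<bullet> (jac v x *v u x)" and ?C = "J * m * (Jv * m)"
  have h: "0 \<le> ?h" by (rule diameter_ge_0[OF compact_imp_bounded[OF cell.compact_region[OF valid_cells[OF K]]]])
  have C: "0 \<le> ?C" using pos mv(2) by simp
  have d0: "0 \<le> \<delta> K u" and dL: "\<delta> K u \<le> c * ?h * inverse ?L"
    using \<delta> K u nz by (auto simp: SUPG_parameter_def)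
  have A: "?A \<in> lmeasurable" by (rule Int_U_lmeasurable[OF region_sets[OF K]])
  have rhs: "0 \<le> c * ?h * B * (?C * measure lebesgue ?A)"
    using c h pos mv(2) by (intro mult_nonneg_nonneg) auto
  show ?thesis
  proof (cases "?L \<le> 0")
    \<comment> \<open>A nonpositive value makes the upper bound nonpositive,
      \<open>inverse 0\<close> being 0, so the parameter vanishes.\<close>
    case True
    then have "c * ?h * inverse ?L \<le> 0" using c h by (intro mult_nonneg_nonpos) auto
    then have "\<delta> K u = 0" using d0 dL by linarith
    then show ?thesis using rhs by simp
  next
    case False
    define E where "E = esssup (lebesgue_on (region K)) (\<lambda>x. ereal (norm (u x)))"
    \<comment> \<open>Infinite values of the essential supremum would be sent to 0 by
      \<open>real_of_ereal\<close>; as \<open>?L\<close> is positive here, \<open>E\<close> is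
      finite.\<close>
    have L: "?L = real_of_ereal E" by (simp add: Linf_norm_on_def E_def)
    then have E: "E = ereal ?L" using False by (cases E) auto
    have meas: "(\<lambda>x. ereal (norm (u x))) \<in> borel_measurable (lebesgue_on (region K))"
      using bounded_measurable_onD(1)[OF bm_subset[OF bm_closure_V[OF u] region_closure[OF K]]] by simp
    have "E \<le> ereal B" unfolding E_def by (rule esssup_I[OF meas]) (use B in \<open>auto intro!: AE_I2\<close>)
    then have LB: "?L \<le> B" unfolding E by simp
    have "AE x in lebesgue_on (region K). ereal (norm (u x)) \<le> E" unfolding E_def by (rule esssup_AE)
    then have "AE x in lebesgue. x \<in> region K \<longrightarrow> norm (u x) \<le> ?L"
      unfolding E using region_sets[OF K] by (simp add: AE_restrict_space_iff)
    then have ae: "AE x in lebesgue_on ?A. norm (u x) \<le> ?L"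
      using A by (simp add: AE_restrict_space_iff fmeasurableD) (auto elim: eventually_mono)
    have bm: "bounded_measurable_on ?A ?f"
      by (rule bm_subset[OF _ Int_lower2])
         (intro bm_inner bm_matrix_vector_mult V_space_bm(1)[OF u] V_space_bm(2)[OF u] V_space_bm(2)[OF v])
    have int: "integrable (lebesgue_on ?A) ?f" by (rule bm_integrable[OF bm A])
    have fin: "integrable (lebesgue_on ?A) (\<lambda>x. ?C * ?L\<^sup>2)" by (rule bm_integrable[OF bm_const A])
    have space_A: "AE x in lebesgue_on ?A. x \<in> ?A" by (rule AE_I2) simp
    have "\<bar>\<integral>x. ?f x \<partial>lebesgue_on ?A\<bar> \<le> (\<integral>x. \<bar>?f x\<bar> \<partial>lebesgue_on ?A)"
      using integral_norm_bound[of "lebesgue_on ?A" ?f] by simp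
    also have "\<dots> \<le> (\<integral>x. ?C * ?L\<^sup>2 \<partial>lebesgue_on ?A)"
    proof (rule integral_mono_AE[OF integrable_abs[OF int] fin])
      show "AE x in lebesgue_on ?A. \<bar>?f x\<bar> \<le> ?C * ?L\<^sup>2"
        using ae space_A
      proof eventually_elim
        fix x assume ux: "norm (u x) \<le> ?L" and x: "x \<in> ?A"
        have 1: "norm (jac u x *v u x) \<le> J * ?L * m"
          by (rule order_trans[OF mv(1)]) (use J x ux mv(2) pos False in \<open>auto intro!: mult_mono mult_nonneg_nonneg\<close>)
        have 2: "norm (jac v x *v u x) \<le> Jv * ?L * m"
          by (rule order_trans[OF mv(1)]) (use Jv x ux mv(2) pos False in \<open>auto intro!: mult_mono mult_nonneg_nonneg\<close>)
        have "\<bar>?f x\<bar> \<le> norm (jac u x *v u x) * norm (jac v x *v u x)" by (rule Cauchy_Schwarz_ineq2)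
        also have "\<dots> \<le> (J * ?L * m) * (Jv * ?L * m)"
          using 1 2 False mv(2) pos by (intro mult_mono) auto
        also have "\<dots> = ?C * ?L\<^sup>2" by (simp add: power2_eq_square ac_simps)
        finally show "\<bar>?f x\<bar> \<le> ?C * ?L\<^sup>2" .
      qed
    qed
    also have "\<dots> = ?C * ?L\<^sup>2 * measure lebesgue ?A"
      using A by (simp add: measure_restrict_space fmeasurableD)
    finally have I: "\<bar>\<integral>x. ?f x \<partial>lebesgue_on ?A\<bar> \<le> ?C * ?L\<^sup>2 * measure lebesgue ?A" .
    have "\<bar>\<delta> K u * (\<integral>x. ?f x \<partial>lebesgue_on ?A)\<bar> = \<delta> K u * \<bar>\<integral>x. ?f x \<partial>lebesgue_on ?A\<bar>"
      using d0 by (simp add: abs_mult)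
    also have "\<dots> \<le> (c * ?h * inverse ?L) * (?C * ?L\<^sup>2 * measure lebesgue ?A)"
    proof (rule mult_mono[OF dL I])
      show "0 \<le> c * ?h * inverse ?L" using d0 dL by linarith
    qed simp
    also have "\<dots> = c * ?h * ?L * (?C * measure lebesgue ?A)"
      using False by (simp add: power2_eq_square field_simps)
    also have "\<dots> \<le> c * ?h * B * (?C * measure lebesgue ?A)"
      using LB c h pos mv(2) by (intro mult_right_mono mult_left_mono mult_nonneg_nonneg) auto
    finally show ?thesis unfolding integral_restrict_U[OF region_sets[OF K] region_closure[OF K]] .
  qed
qed

text \<open>Continuity is shown cell by cell and in two ways. If the velocity is nonzero somewhere
  on the cell, this persists nearby, where the parameter is continuous and the integral is a
  polynomial in the coefficients. If it vanishes on the cell, the whole term is squeezed to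
  zero.\<close>

lemma S_SUPG_continuous:
  assumes \<delta>: "SUPG_parameter \<Omega> \<T> k c \<delta>" and c: "0 < c"
    and e: "\<And>i. i < n \<Longrightarrow> e i \<in> V_space \<Omega> \<T> k" and v: "v \<in> V_space \<Omega> \<T> k"
  shows "continuous_on UNIV (\<lambda>\<gamma>. S_SUPG \<T> \<delta> (lin_comb n e \<gamma>) v)"
proof -
  let ?V = "V_space \<Omega> \<T> k" and ?E = "lin_comb n e"
  have EV: "?E \<gamma> \<in> ?V" for \<gamma> by (rule lin_comb_in[OF fun_subspace_V e])
  obtain m where m: "\<And>(A :: real^'d^'d) x. norm (A *v x) \<le> norm A * norm x * m" "0 \<le> m"
    using bounded_bilinear.nonneg_bounded[OF bounded_bilinear_matrix_vector_mult[where 'n='d and 'm='d]] by blast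
  have "\<exists>C\<ge>0. \<forall>x\<in>U. norm (jac w x) \<le> C" if w: "w \<in> ?V" for w
  proof -
    obtain C where "\<forall>x\<in>U. norm (jac w x) \<le> C" using bounded_measurable_onD(2)[OF V_space_bm(2)[OF w]] by blast
    then show ?thesis by (intro exI[of _ "\<bar>C\<bar>"]) force
  qed
  then obtain j where j: "\<And>w. w \<in> ?V \<Longrightarrow> 0 \<le> j w" "\<And>w x. w \<in> ?V \<Longrightarrow> x \<in> U \<Longrightarrow> norm (jac w x) \<le> j w" by metis
  have "\<exists>C\<ge>0. \<forall>x\<in>closure \<Omega>. norm (w x) \<le> C" if w: "w \<in> ?V" for w
  proof -
    obtain C where "\<forall>x\<in>closure \<Omega>. norm (w x) \<le> C" using bounded_measurable_onD(2)[OF bm_closure_V[OF w]] by blast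
    then show ?thesis by (intro exI[of _ "\<bar>C\<bar>"]) force
  qed
  then obtain s where s: "\<And>w. w \<in> ?V \<Longrightarrow> 0 \<le> s w" "\<And>w x. w \<in> ?V \<Longrightarrow> x \<in> closure \<Omega> \<Longrightarrow> norm (w x) \<le> s w" by metis
  have "continuous_on UNIV (\<lambda>\<gamma>. \<delta> K (?E \<gamma>) * (\<integral>x. (jac (?E \<gamma>) x *v ?E \<gamma> x) \<bullet> (jac v x *v ?E \<gamma> x) \<partial>lebesgue_on (region K)))"
    if K: "K \<in> \<T>" for K
  proof -
    let ?A = "region K \<inter> U"
    define \<tau> where "\<tau> u w z = (\<integral>x. (jac u x *v w x) \<bullet> (jac v x *v z x) \<partial>lebesgue_on ?A)" for u w z
    define \<Psi> where "\<Psi> \<gamma> = \<delta> K (?E \<gamma>) * \<tau> (?E \<gamma>) (?E \<gamma>) (?E \<gamma>)" for \<gamma>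
    have A: "?A \<in> lmeasurable" by (rule Int_U_lmeasurable[OF region_sets[OF K]])
    have bm: "bounded_measurable_on ?A (\<lambda>x. (jac u x *v w x) \<bullet> (jac v x *v z x))" if "u \<in> ?V" "w \<in> ?V" "z \<in> ?V" for u w z
      by (rule bm_subset[OF _ Int_lower2])
         (intro bm_inner bm_matrix_vector_mult V_space_bm(1)[OF that(2)] V_space_bm(1)[OF that(3)] V_space_bm(2)[OF that(1)] V_space_bm(2)[OF v])
    have l1: "linear_form_on ?V (\<lambda>u. \<tau> u w z)" if "w \<in> ?V" "z \<in> ?V" for w z
      unfolding \<tau>_def by (rule linear_form_on_integral[OF A bm[OF _ that]], assumption)
        (simp add: jac_lincomb_U matrix_vector_mult_lincomb_left inner_add_left)
    have l2: "linear_form_on ?V (\<lambda>w. \<tau> u w z)" if "u \<in> ?V" "z \<in> ?V" for u z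
      unfolding \<tau>_def by (rule linear_form_on_integral[OF A bm[OF that(1) _ that(2)]], assumption)
        (simp add: matrix_vector_mult_lincomb_right inner_add_left)
    have l3: "linear_form_on ?V (\<lambda>z. \<tau> u w z)" if "u \<in> ?V" "w \<in> ?V" for u w
      unfolding \<tau>_def by (rule linear_form_on_integral[OF A bm[OF that]], assumption)
        (simp add: matrix_vector_mult_lincomb_right inner_add_right)
    have "\<tau> (?E \<gamma>) (?E \<gamma>) (?E \<gamma>) = (\<Sum>i<n. \<gamma> i * (\<Sum>k<n. \<gamma> k * (\<Sum>l<n. \<gamma> l * \<tau> (e i) (e k) (e l))))" for \<gamma>
    proof -
      have "\<tau> (?E \<gamma>) (?E \<gamma>) (?E \<gamma>) = (\<Sum>i<n. \<gamma> i * \<tau> (e i) (?E \<gamma>) (?E \<gamma>))"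
        by (rule linear_form_on_lin_comb[OF fun_subspace_V l1[OF EV EV] e])
      also have "\<dots> = (\<Sum>i<n. \<gamma> i * (\<Sum>k<n. \<gamma> k * \<tau> (e i) (e k) (?E \<gamma>)))"
        using linear_form_on_lin_comb[OF fun_subspace_V l2[OF e EV] e] by (intro sum.cong) auto
      also have "\<dots> = (\<Sum>i<n. \<gamma> i * (\<Sum>k<n. \<gamma> k * (\<Sum>l<n. \<gamma> l * \<tau> (e i) (e k) (e l))))"
        using linear_form_on_lin_comb[OF fun_subspace_V l3[OF e e] e] by (intro sum.cong) auto
      finally show ?thesis .
    qed
    then have "(\<lambda>\<gamma>. \<tau> (?E \<gamma>) (?E \<gamma>) (?E \<gamma>))
        = (\<lambda>\<gamma>. \<Sum>i<n. \<gamma> i * (\<Sum>k<n. \<gamma> k * (\<Sum>l<n. \<gamma> l * \<tau> (e i) (e k) (e l))))" by blast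
    then have cont_\<tau>: "continuous_on S (\<lambda>\<gamma>. \<tau> (?E \<gamma>) (?E \<gamma>) (?E \<gamma>))" for S
      by (rule ssubst[where P="continuous_on S"]) (intro continuous_intros)
    let ?S = "{\<gamma>. ?E \<gamma> \<in> {u \<in> ?V. \<exists>x\<in>region K. u x \<noteq> 0}}"
    have contS: "continuous_on ?S \<Psi>"
    proof -
      have "V_continuous_on \<Omega> {u \<in> ?V. \<exists>x\<in>region K. u x \<noteq> 0} (\<delta> K)" using \<delta> K by (simp add: SUPG_parameter_def)
      from V_continuous_on_lin_comb[OF this e] show ?thesis
        unfolding \<Psi>_def by (rule continuous_on_mult[OF _ cont_\<tau>])
    qed
    \<comment> \<open>Being nonzero at a fixed point is an open condition on the coefficients, so at
      points of \<open>?S\<close> limits within \<open>?S\<close> are unrestricted limits.\<close>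
    have "?S = (\<Union>x\<in>region K. {\<gamma>. ?E \<gamma> x \<noteq> 0})" using EV by auto
    moreover have "open {\<gamma>. ?E \<gamma> x \<noteq> 0}" for x
      unfolding lin_comb_def by (intro open_Collect_neq continuous_intros)
    ultimately have openS: "open ?S" by auto
    have "(\<Psi> \<longlongrightarrow> \<Psi> \<gamma>0) (at \<gamma>0)" for \<gamma>0
    proof (cases "\<gamma>0 \<in> ?S")
      case True
      from bspec[OF contS[unfolded continuous_on_def] this] show ?thesis
        unfolding at_within_open[OF True openS] .
    next
      case False
      then have z: "?E \<gamma>0 x = 0" if "x \<in> region K" for x using EV[of \<gamma>0] that by auto
      \<comment> \<open>A bound for the velocity on the cell: \<open>?E \<gamma>0\<close> vanishes
        there, so only the differences of the coefficients contribute, and \<open>B\<close> tends to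
        zero. \<open>J\<close> bounds the Jacobian and merely stays finite.\<close>
      define B where "B \<gamma> = (\<Sum>i<n. \<bar>\<gamma> i - \<gamma>0 i\<bar> * s (e i))" for \<gamma>
      define J where "J \<gamma> = (\<Sum>i<n. \<bar>\<gamma> i\<bar> * j (e i))" for \<gamma>
      have "(\<integral>x. (jac (?E \<gamma>0) x *v ?E \<gamma>0 x) \<bullet> (jac v x *v ?E \<gamma>0 x) \<partial>lebesgue_on ?A) = (\<integral>x. 0 \<partial>lebesgue_on ?A)"
        by (rule Bochner_Integration.integral_cong) (simp_all add: z)
      then have \<Psi>0: "\<Psi> \<gamma>0 = 0" by (simp add: \<Psi>_def \<tau>_def)
      let ?B = "\<lambda>\<gamma>. c * diameter (region K) * B \<gamma> * (J \<gamma> * m * (j v * m) * measure lebesgue ?A)"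
      have Bnn: "0 \<le> B \<gamma>" and Jnn: "0 \<le> J \<gamma>" for \<gamma>
        unfolding B_def J_def by (intro sum_nonneg mult_nonneg_nonneg abs_ge_zero s(1)[OF e] j(1)[OF e]; simp)+
      have bound: "norm (\<Psi> \<gamma>) \<le> ?B \<gamma>" for \<gamma>
      proof (cases "\<exists>x\<in>region K. ?E \<gamma> x \<noteq> 0")
        case True
        have "norm (?E \<gamma> x) \<le> B \<gamma>" if x: "x \<in> region K" for x
        proof -
          have "?E \<gamma> x = ?E (\<lambda>i. \<gamma> i - \<gamma>0 i) x" using lin_comb_diff[of n e \<gamma> x \<gamma>0] z[OF x] by simp
          also have "norm \<dots> \<le> (\<Sum>i<n. norm ((\<gamma> i - \<gamma>0 i) *\<^sub>R e i x))" unfolding lin_comb_def by (rule norm_sum)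
          also have "\<dots> \<le> B \<gamma>"
            unfolding B_def using region_closure[OF K] x
            by (intro sum_mono) (auto intro!: mult_left_mono s(2) e)
          finally show ?thesis .
        qed
        moreover have "norm (jac (?E \<gamma>) x) \<le> J \<gamma>" if x: "x \<in> U" for x
        proof -
          have "norm (jac (?E \<gamma>) x) \<le> (\<Sum>i<n. norm (\<gamma> i *\<^sub>R jac (e i) x))"
            by (subst jac_lin_comb_U[OF e x], simp, rule norm_sum)
          also have "\<dots> \<le> J \<gamma>" unfolding J_def by (intro sum_mono) (auto intro!: mult_left_mono j(2) e x)
          finally show ?thesis .
        qed
        ultimately show ?thesis
          using SUPG_term_bound[OF \<delta> c K EV True _ _ j(2)[OF v] v m Bnn Jnn j(1)[OF v]]
          unfolding \<Psi>_def \<tau>_def integral_restrict_U[OF region_sets[OF K] region_closure[OF K]] real_norm_def by blast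
      next
        case False
        then have zz: "?E \<gamma> x = 0" if "x \<in> region K" for x using that by blast
        have "(\<integral>x. (jac (?E \<gamma>) x *v ?E \<gamma> x) \<bullet> (jac v x *v ?E \<gamma> x) \<partial>lebesgue_on ?A) = (\<integral>x. 0 \<partial>lebesgue_on ?A)"
          by (rule Bochner_Integration.integral_cong) (simp_all add: zz)
        then have "\<Psi> \<gamma> = 0" by (simp add: \<Psi>_def \<tau>_def)
        moreover have "0 \<le> ?B \<gamma>"
          using c m(2) Bnn[of \<gamma>] Jnn[of \<gamma>] j(1)[OF v] diameter_ge_0[OF compact_imp_bounded[OF cell.compact_region[OF valid_cells[OF K]]]]
          by (intro mult_nonneg_nonneg) auto
        ultimately show ?thesis by simp
      qed
      have "continuous_on UNIV ?B" unfolding B_def J_def by (intro continuous_intros)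
      then have "(?B \<longlongrightarrow> ?B \<gamma>0) (at \<gamma>0)" unfolding continuous_on_def by (rule bspec[OF _ UNIV_I])
      moreover have "?B \<gamma>0 = 0" by (simp add: B_def)
      ultimately have "(?B \<longlongrightarrow> 0) (at \<gamma>0)" by metis
      then have "(\<Psi> \<longlongrightarrow> 0) (at \<gamma>0)" by (rule Lim_null_comparison[OF always_eventually[OF allI[OF bound]]])
      then show ?thesis unfolding \<Psi>0 .
    qed
    then have "continuous_on UNIV \<Psi>" unfolding continuous_on_def by blast
    then show ?thesis
      unfolding \<Psi>_def \<tau>_def integral_restrict_U[OF region_sets[OF K] region_closure[OF K]] .
  qed
  then show ?thesis unfolding S_SUPG_def by (rule continuous_on_sum)
qed

end

context simplicial_mesh
begin

lemma T_BH_form: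
  assumes p: "p \<in> Q_space \<Omega> \<T> 1"
  shows "linear_form_on (Q_space \<Omega> \<T> 1) (T_BH \<Omega> \<T> p)" "T_BH \<Omega> \<T> p q = T_BH \<Omega> \<T> q p" "0 \<le> T_BH \<Omega> \<T> p p"
proof -
  have eq: "T_BH \<Omega> \<T> p q = (\<integral>x. interpolant (\<lambda>y. p y * q y) x - p x * q x \<partial>lebesgue_on U)" for p q
    unfolding T_BH_def nodal_interpolation_eq integral_domain_eq ..
  have bi: "bounded_measurable_on U (interpolant g)" for g
    by (rule bm_U[OF W_space_bm(2)[OF interpolant_in_W]])
  show "linear_form_on (Q_space \<Omega> \<T> 1) (T_BH \<Omega> \<T> p)"
    unfolding eq[abs_def]
  proof (rule linear_form_on_integral[OF U_lmeasurable])
    show "bounded_measurable_on U (\<lambda>x. interpolant (\<lambda>y. p y * q y) x - p x * q x)" if "q \<in> Q_space \<Omega> \<T> 1" for q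
      by (intro bm_diff bm_mult bi Q_space_bm(1)[OF p] Q_space_bm(1)[OF that])
    fix q r a b x
    have "(\<lambda>y. p y * (a *\<^sub>R q y + b *\<^sub>R r y)) = (\<lambda>y. a * (p y * q y) + b * (p y * r y))"
      by (simp add: fun_eq_iff algebra_simps)
    then show "interpolant (\<lambda>y. p y * (a *\<^sub>R q y + b *\<^sub>R r y)) x - p x * (a *\<^sub>R q x + b *\<^sub>R r x)
      = a * (interpolant (\<lambda>y. p y * q y) x - p x * q x) + b * (interpolant (\<lambda>y. p y * r y) x - p x * r x)"
      by (simp add: interpolant_lincomb algebra_simps)
  qed
  show "T_BH \<Omega> \<T> p q = T_BH \<Omega> \<T> q p" by (simp add: eq mult.commute)
  show "0 \<le> T_BH \<Omega> \<T> p p"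
    unfolding eq
  proof (rule Bochner_Integration.integral_nonneg_AE, rule AE_I2)
    fix x assume "x \<in> space (lebesgue_on U)"
    then have "x \<in> closure \<Omega>" using U_subset closure_subset by auto
    then show "0 \<le> interpolant (\<lambda>y. p y * p y) x - p x * p x"
      using interpolant_square_ge[of p x] p by (simp add: Q_space_def)
  qed
qed

end

context macro_mesh
begin

lemma T_LPS_form:
  assumes p: "p \<in> Q_space \<Omega> \<T> k"
  shows "linear_form_on (Q_space \<Omega> \<T> k) (T_LPS \<Omega> \<M> k p)" "T_LPS \<Omega> \<M> k p q = T_LPS \<Omega> \<M> k q p" "0 \<le> T_LPS \<Omega> \<M> k p p"
proof -
  let ?R = "\<lambda>p x. grad p x - L2_projection \<Omega> \<M> k (grad p) x"
  have bm: "bounded_measurable_on U (?R p)" if "p \<in> Q_space \<Omega> \<T> k" for p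
    by (intro bm_diff bm_L2_projection Q_space_bm(2)[OF that])
  have lin: "?R (\<lambda>x. a *\<^sub>R p x + b *\<^sub>R q x) x = a *\<^sub>R ?R p x + b *\<^sub>R ?R q x"
    if pq: "p \<in> Q_space \<Omega> \<T> k" "q \<in> Q_space \<Omega> \<T> k" and x: "x \<in> U" for p q a b x
  proof -
    have "L2_projection \<Omega> \<M> k (grad (\<lambda>x. a *\<^sub>R p x + b *\<^sub>R q x))
        = (\<lambda>x. a *\<^sub>R L2_projection \<Omega> \<M> k (grad p) x + b *\<^sub>R L2_projection \<Omega> \<M> k (grad q) x)"
      by (rule L2_projection_lincomb[OF Q_space_bm(2)[OF pq(1)] Q_space_bm(2)[OF pq(2)] grad_lincomb_Q[OF pq]])
    then show ?thesis unfolding grad_lincomb_Q[OF pq x] by (simp only: scaleR_right_diff_distrib) simp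
  qed
  show "linear_form_on (Q_space \<Omega> \<T> k) (T_LPS \<Omega> \<M> k p)"
    unfolding T_LPS_def[abs_def]
    by (rule weighted_form(1)[OF bm lin patch_region_sets patch_region_subset p])
  show "0 \<le> T_LPS \<Omega> \<M> k p p"
    unfolding T_LPS_def
    by (rule weighted_form(2)[OF bm lin patch_region_sets patch_region_subset p]) simp_all
  show "T_LPS \<Omega> \<M> k p q = T_LPS \<Omega> \<M> k q p" by (simp add: T_LPS_def inner_commute)
qed

text \<open>In the continuity claim \<open>u\<close> takes the place of the test function while the
  coefficients vary the first argument: the weight is continuous by assumption, and the integral is
  linear in the coefficients.\<close>

lemma S_LPS_form:
  assumes \<delta>: "LPS_parameter \<Omega> \<T> \<M> k c \<delta>" and u: "u \<in> V_space \<Omega> \<T> k"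
  shows "linear_form_on (V_space \<Omega> \<T> k) (S_LPS \<Omega> \<M> k \<delta> u)" "0 \<le> S_LPS \<Omega> \<M> k \<delta> u u"
    "(\<And>i. i < n \<Longrightarrow> e i \<in> V_space \<Omega> \<T> k) \<Longrightarrow> continuous_on UNIV (\<lambda>\<gamma>. S_LPS \<Omega> \<M> k \<delta> (lin_comb n e \<gamma>) u)"
proof -
  let ?V = "V_space \<Omega> \<T> k"
  let ?R = "\<lambda>u x. jac u x - L2_projection_rows \<Omega> \<M> k (jac u) x"
  have rows: "bounded_measurable_on U (\<lambda>x. jac u x $ i)" if "u \<in> ?V" for u i
    by (intro bm_vec_nth V_space_bm(2)[OF that])
  have bm: "bounded_measurable_on U (?R u)" if "u \<in> ?V" for u
    unfolding L2_projection_rows_def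
    by (intro bm_diff bm_vec_lambda bm_L2_projection rows[OF that] V_space_bm(2)[OF that])
  have lin: "?R (\<lambda>x. a *\<^sub>R u x + b *\<^sub>R v x) x = a *\<^sub>R ?R u x + b *\<^sub>R ?R v x"
    if uv: "u \<in> ?V" "v \<in> ?V" and x: "x \<in> U" for u v a b x
  proof -
    have "L2_projection \<Omega> \<M> k (\<lambda>y. jac (\<lambda>x. a *\<^sub>R u x + b *\<^sub>R v x) y $ i)
        = (\<lambda>x. a *\<^sub>R L2_projection \<Omega> \<M> k (\<lambda>y. jac u y $ i) x + b *\<^sub>R L2_projection \<Omega> \<M> k (\<lambda>y. jac v y $ i) x)" for i
      by (rule L2_projection_lincomb[OF rows[OF uv(1)] rows[OF uv(2)]]) (simp add: jac_lincomb_U[OF uv])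
    then have "L2_projection_rows \<Omega> \<M> k (jac (\<lambda>x. a *\<^sub>R u x + b *\<^sub>R v x)) x
        = a *\<^sub>R L2_projection_rows \<Omega> \<M> k (jac u) x + b *\<^sub>R L2_projection_rows \<Omega> \<M> k (jac v) x"
      by (simp add: L2_projection_rows_def vec_eq_iff)
    then show ?thesis by (simp add: jac_lincomb_U[OF uv x] algebra_simps)
  qed
  have d0: "\<And>M. M \<in> \<M> \<Longrightarrow> 0 \<le> \<delta> M u" and dc: "\<And>M. M \<in> \<M> \<Longrightarrow> V_continuous_on \<Omega> ?V (\<delta> M)"
    using \<delta> u by (auto simp: LPS_parameter_def)
  show "linear_form_on ?V (S_LPS \<Omega> \<M> k \<delta> u)"
    unfolding S_LPS_def[abs_def]
    by (rule weighted_form(1)[OF bm lin patch_region_sets patch_region_subset u])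
  show "0 \<le> S_LPS \<Omega> \<M> k \<delta> u u"
    unfolding S_LPS_def
    by (rule weighted_form(2)[OF bm lin patch_region_sets patch_region_subset u d0])
  assume e: "\<And>i. i < n \<Longrightarrow> e i \<in> ?V"
  have "continuous_on UNIV (\<lambda>\<gamma>. \<delta> M (lin_comb n e \<gamma>) *
      (\<integral>x. ?R (lin_comb n e \<gamma>) x \<bullet> ?R u x \<partial>lebesgue_on (patch_region M)))" if M: "M \<in> \<M>" for M
  proof (rule continuous_on_mult)
    have "lin_comb n e \<gamma> \<in> ?V" for \<gamma> by (rule lin_comb_in[OF fun_subspace_V e])
    then have "{\<gamma>. lin_comb n e \<gamma> \<in> ?V} = UNIV" by blast
    then show "continuous_on UNIV (\<lambda>\<gamma>. \<delta> M (lin_comb n e \<gamma>))"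
      using V_continuous_on_lin_comb[OF dc[OF M], where n=n and e=e, OF e] by simp
    have "linear_form_on ?V (\<lambda>v. \<Sum>i\<in>{M}. 1 * (\<integral>x. ?R u x \<bullet> ?R v x \<partial>lebesgue_on (patch_region i)))"
      by (rule weighted_form(1)[OF bm lin _ _ u]) (use M patch_region_sets patch_region_subset in auto)
    then have lf: "linear_form_on ?V (\<lambda>v. \<integral>x. ?R v x \<bullet> ?R u x \<partial>lebesgue_on (patch_region M))"
      by (simp add: inner_commute)
    have "(\<lambda>\<gamma>. \<integral>x. ?R (lin_comb n e \<gamma>) x \<bullet> ?R u x \<partial>lebesgue_on (patch_region M))
        = (\<lambda>\<gamma>. \<Sum>i<n. \<gamma> i * (\<integral>x. ?R (e i) x \<bullet> ?R u x \<partial>lebesgue_on (patch_region M)))"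
      by (rule ext) (rule linear_form_on_lin_comb[OF fun_subspace_V lf e])
    then show "continuous_on UNIV (\<lambda>\<gamma>. \<integral>x. ?R (lin_comb n e \<gamma>) x \<bullet> ?R u x \<partial>lebesgue_on (patch_region M))"
      by (rule ssubst[where P="continuous_on UNIV"]) (intro continuous_intros)
  qed
  then show "continuous_on UNIV (\<lambda>\<gamma>. S_LPS \<Omega> \<M> k \<delta> (lin_comb n e \<gamma>) u)"
    unfolding S_LPS_def by (rule continuous_on_sum)
qed

end

section \<open>Load functional and conclusion\<close>

lemma (in mesh) linear_form_load:
  fixes f :: "'d \<Rightarrow> (real^'d \<Rightarrow> real) \<Rightarrow> real"
  assumes "\<forall>i. f i \<in> H_minus_1 \<Omega>"
  shows "linear_form_on (V_space \<Omega> \<T> k) (\<lambda>v. \<Sum>i\<in>UNIV. f i (\<lambda>x. v x $ i))"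
proof (rule linear_form_on_sum)
  fix i :: 'd
  have add: "f i (\<lambda>x. u x + v x) = f i u + f i v" and scale: "f i (\<lambda>x. a * u x) = a * f i u"
    if "u \<in> H1_0 \<Omega>" "v \<in> H1_0 \<Omega>" for u v a
    using assms that by (auto simp: H_minus_1_def)
  show "linear_form_on (V_space \<Omega> \<T> k) (\<lambda>v. f i (\<lambda>x. v x $ i))"
    unfolding linear_form_on_def
  proof (intro ballI allI)
    fix u v and a b :: real assume uv: "u \<in> V_space \<Omega> \<T> k" "v \<in> V_space \<Omega> \<T> k"
    \<comment> \<open>The functionals are additive on H1_0 only, so the scaled components have to be
      placed in that space before they are added.\<close>
    note H = V_spaceD(2)[OF uv(1), of i] V_spaceD(2)[OF uv(2), of i]
    have "(\<lambda>x. a * u x $ i) \<in> H1_0 \<Omega>" "(\<lambda>x. b * v x $ i) \<in> H1_0 \<Omega>"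
      using H1_0_lincomb[OF H(1) H(1), of a 0] H1_0_lincomb[OF H(2) H(2), of b 0] by simp_all
    from add[OF this] show "f i (\<lambda>x. (a *\<^sub>R u x + b *\<^sub>R v x) $ i) = a * f i (\<lambda>x. u x $ i) + b * f i (\<lambda>x. v x $ i)"
      using scale[OF H(1) H(1), of a] scale[OF H(2) H(2), of b] by simp
  qed
qed

theorem corollary4p4:
  fixes \<Omega> :: "(real^'d) set"
    and \<T> :: "'d cell set"
    and \<M> :: "'d cell set set"
    and k :: nat and \<mu> c :: real
    and f :: "'d \<Rightarrow> (real^'d \<Rightarrow> real) \<Rightarrow> real"
    and T :: "(real^'d \<Rightarrow> real) \<Rightarrow> (real^'d \<Rightarrow> real) \<Rightarrow> real"
    and S :: "(real^'d \<Rightarrow> real^'d) \<Rightarrow> (real^'d \<Rightarrow> real^'d) \<Rightarrow> real"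
  assumes "CARD('d) = 2 \<or> CARD('d) = 3"
    and "polyhedral_domain \<Omega>"
    and "conforming_triangulation \<Omega> \<T>"
    and "macro_triangulation \<T> \<M>"
    and "1 \<le> k" and "0 < \<mu>" and "0 < c"
    and "\<forall>i. f i \<in> H_minus_1 \<Omega>"
    and "(k = 1 \<and> simplicial \<T> \<and> (\<forall>p\<in>Q_space \<Omega> \<T> k. \<forall>q\<in>Q_space \<Omega> \<T> k. T p q = T_BP \<T> p q)) \<or>
         (k = 1 \<and> simplicial \<T> \<and> (\<forall>p\<in>Q_space \<Omega> \<T> k. \<forall>q\<in>Q_space \<Omega> \<T> k. T p q = T_BH \<Omega> \<T> p q)) \<or>
         (\<forall>p\<in>Q_space \<Omega> \<T> k. \<forall>q\<in>Q_space \<Omega> \<T> k. T p q = T_LPS \<Omega> \<M> k p q)"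
    and "(\<exists>\<delta>. LPS_parameter \<Omega> \<T> \<M> k c \<delta> \<and> (\<forall>u\<in>V_space \<Omega> \<T> k. \<forall>v\<in>V_space \<Omega> \<T> k. S u v = S_LPS \<Omega> \<M> k \<delta> u v)) \<or>
         (\<exists>\<delta>. SUPG_parameter \<Omega> \<T> k c \<delta> \<and> (\<forall>u\<in>V_space \<Omega> \<T> k. \<forall>v\<in>V_space \<Omega> \<T> k. S u v = S_SUPG \<T> \<delta> u v))"
  shows "\<exists>(u, p)\<in>V_space \<Omega> \<T> k \<times> Q_space \<Omega> \<T> k. \<forall>(v, q)\<in>V_space \<Omega> \<T> k \<times> Q_space \<Omega> \<T> k.
           (\<integral>x. (jac u x *v u x + (1/2) *\<^sub>R (dvg u x *\<^sub>R u x)) \<bullet> v x \<partial>lebesgue_on \<Omega>)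
         + \<mu> * (\<integral>x. jac u x \<bullet> jac v x \<partial>lebesgue_on \<Omega>)
         - (\<integral>x. p x * dvg v x \<partial>lebesgue_on \<Omega>)
         + S u v
         + (\<integral>x. q x * dvg u x \<partial>lebesgue_on \<Omega>)
         + T p q
         = (\<Sum>i\<in>UNIV. f i (\<lambda>x. v x $ i))"
proof -
  let ?V = "V_space \<Omega> \<T> k" and ?Q = "Q_space \<Omega> \<T> k"
  interpret macro_mesh \<Omega> \<T> \<M>
    using assms(2-4) by unfold_locales
  \<comment> \<open>\<open>T\<close> and \<open>S\<close> are prescribed on the discrete spaces
    only; the concrete forms replace them until the end.\<close>
  obtain T' where T': "\<And>p q. p \<in> ?Q \<Longrightarrow> q \<in> ?Q \<Longrightarrow> T p q = T' p q"
    "\<And>p. p \<in> ?Q \<Longrightarrow> linear_form_on ?Q (T' p)" "\<And>p q. p \<in> ?Q \<Longrightarrow> T' p q = T' q p" "\<And>p. p \<in> ?Q \<Longrightarrow> 0 \<le> T' p p"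
    using assms(9)
  proof (elim disjE conjE)
    assume "\<forall>p\<in>?Q. \<forall>q\<in>?Q. T p q = T_BP \<T> p q"
    then show ?thesis by (intro that[of "T_BP \<T>"] T_BP_form) blast
  next
    assume k: "k = 1" and simp: "simplicial \<T>" and T: "\<forall>p\<in>?Q. \<forall>q\<in>?Q. T p q = T_BH \<Omega> \<T> p q"
    interpret simplicial_mesh \<Omega> \<T> by unfold_locales (rule simp)
    show ?thesis
      using T T_BH_form unfolding k by (intro that[of "T_BH \<Omega> \<T>", unfolded k]) blast+
  next
    assume "\<forall>p\<in>?Q. \<forall>q\<in>?Q. T p q = T_LPS \<Omega> \<M> k p q"
    then show ?thesis by (intro that[of "T_LPS \<Omega> \<M> k"] T_LPS_form) blast
  qed
  obtain S' where S': "\<And>u v. u \<in> ?V \<Longrightarrow> v \<in> ?V \<Longrightarrow> S u v = S' u v"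
    "\<And>u. u \<in> ?V \<Longrightarrow> linear_form_on ?V (S' u)" "\<And>u. u \<in> ?V \<Longrightarrow> 0 \<le> S' u u"
    "\<And>n e v. (\<And>i. i < n \<Longrightarrow> e i \<in> ?V) \<Longrightarrow> v \<in> ?V \<Longrightarrow> continuous_on UNIV (\<lambda>c. S' (lin_comb n e c) v)"
    using assms(10)
  proof (elim disjE exE conjE)
    fix \<delta> assume \<delta>: "LPS_parameter \<Omega> \<T> \<M> k c \<delta>" and S: "\<forall>u\<in>?V. \<forall>v\<in>?V. S u v = S_LPS \<Omega> \<M> k \<delta> u v"
    show ?thesis
      using S S_LPS_form[OF \<delta>] by (intro that[of "S_LPS \<Omega> \<M> k \<delta>"]) blast+
  next
    fix \<delta> assume \<delta>: "SUPG_parameter \<Omega> \<T> k c \<delta>" and S: "\<forall>u\<in>?V. \<forall>v\<in>?V. S u v = S_SUPG \<T> \<delta> u v"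
    show ?thesis
      using S S_SUPG_form[OF \<delta>] S_SUPG_continuous[OF \<delta> assms(7)] by (intro that[of "S_SUPG \<T> \<delta>"]) blast+
  qed
  obtain u p where up: "u \<in> ?V" "p \<in> ?Q" and eq: "\<forall>v\<in>?V. \<forall>q\<in>?Q.
           (\<integral>x. (jac u x *v u x + (1/2) *\<^sub>R (dvg u x *\<^sub>R u x)) \<bullet> v x \<partial>lebesgue_on U)
         + \<mu> * (\<integral>x. jac u x \<bullet> jac v x \<partial>lebesgue_on U)
         - (\<integral>x. p x * dvg v x \<partial>lebesgue_on U)
         + S' u v
         + (\<integral>x. q x * dvg u x \<partial>lebesgue_on U)
         + T' p q
         = (\<Sum>i\<in>UNIV. f i (\<lambda>x. v x $ i))"
    using discrete_problem_solvable[OF assms(6) linear_form_load[OF assms(8)] T'(2-4) S'(2-4)] by blast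
  \<comment> \<open>The integrals over the regular part are exchanged for those over the domain, and
    the concrete forms for the given ones.\<close>
  show ?thesis
    by (rule bexI[of _ "(u, p)"]) (use up eq S'(1) T'(1) in \<open>simp_all add: integral_domain_eq\<close>)
qed

end
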